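(* Let $\mathcal D$ be a right co-$H$-category and let $\mathcal{N},\mathcal{P}\in{_{\mathcal{D}}}{\mathscr{M}}^H$. Then $$HOM_{\mathcal{D}\text{-}Mod}(\mathcal{N},\mathcal{P})^{coH}=Hom_{{_{\mathcal{D}}}{\mathscr{M}}^H}(\mathcal{N},\mathcal{P}).$$
   Context: $K$ is a field and $H$ is a Hopf algebra over $K$ with bijective antipode. $Comod\text{-}H$ is the category of right $H$-comodules; coactions are written $\rho(m)=\sum m_0\otimes m_1$, and $M^{coH}=\{m\in M\mid\rho(m)=m\otimes 1_H\}$. For right $H$-comodules $M,N$, $M\otimes N$ has coaction $m\otimes n\mapsto\sum m_0\otimes n_0\otimes m_1n_1$. A right co-$H$-category $\mathcal D$ is a small $K$-linear category such that every $Hom_{\mathcal D}(X,Y)$ is a right $H$-comodule with coaction $\rho_{XY}(f)=\sum f_0\otimes f_1$, $\rho_{XX}(\mathrm{id}_X)=\mathrm{id}_X\otimes 1_H$, and $\rho_{XZ}(fg)=\sum f_0g_0\otimes f_1g_1$ for composable $g:X\to Y$, $f:Y\to Z$. A left $\mathcal D$-module is a $K$-linear functor $\mathcal D\to Vect_K$. A relative $(\mathcal D,H)$-Hopf module is a left $\mathcal D$-module $\mathcal M$ with a right $H$-comodule structure on each $\mathcal M(X)$ such that $\rho_{\mathcal M(Y)}(\mathcal M(f)(m))=\sum\mathcal M(f_0)(m_0)\otimes f_1m_1$ for all $f\in Hom_{\mathcal D}(X,Y)$, $m\in\mathcal M(X)$. The category of these, with morphisms the $\mathcal D$-module morphisms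 $\eta$ such that every $\eta(X)$ is $H$-colinear, is ${_{\mathcal{D}}}{\mathscr{M}}^H$. For $\mathcal N\in{_{\mathcal{D}}}{\mathscr{M}}^H$ and $M\in Comod\text{-}H$, $\mathcal N\otimes M\in{_{\mathcal{D}}}{\mathscr{M}}^H$ is given by $(\mathcal N\otimes M)(X)=\mathcal N(X)\otimes M$ (tensor product of comodules) and $(\mathcal N\otimes M)(f)(n\otimes m)=\mathcal N(f)(n)\otimes m$. The functor $\mathcal N\otimes(-):Comod\text{-}H\to{_{\mathcal{D}}}{\mathscr{M}}^H$ has a right adjoint $\mathscr R_{\mathcal N}$, and $HOM_{\mathcal D\text{-}Mod}(\mathcal N,\mathcal P):=\mathscr R_{\mathcal N}(\mathcal P)$. Since this is determined up to canonical isomorphism by the adjunction, "$=$" in the claim means the canonical natural isomorphism of $K$-vector spaces. *)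

theory Defs
  imports "HOL-Algebra.Module" "HOL-Algebra.AbelCoset"
begin

text \<open>
  A vector space over a field K is a HOL-Algebra module over K. The record type of modules
  extends that of rings, so it carries two fields for a multiplication and a unit; they are
  meaningful for the Hopf algebra and ignored for every other vector space.
\<close>

section \<open>Linear maps\<close>

definition linear_map ::
    "'k ring \<Rightarrow> ('k, 'a, 'x) module_scheme \<Rightarrow> ('k, 'b, 'y) module_scheme \<Rightarrow> ('a \<Rightarrow> 'b) \<Rightarrow> bool"
  where "linear_map K V W f \<longleftrightarrow>
    f \<in> carrier V \<rightarrow> carrier W \<and>
    (\<forall>u\<in>carrier V. \<forall>v\<in>carrier V. f (u \<oplus>\<^bsub>V\<^esub> v) = f u \<oplus>\<^bsub>W\<^esub> f v) \<and>
    (\<forall>c\<in>carrier K. \<forall>v\<in>carrier V. f (c \<odot>\<^bsub>V\<^esub> v) = c \<odot>\<^bsub>W\<^esub> f v)"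

definition bilinear_map ::
    "'k ring \<Rightarrow> ('k, 'a, 'x) module_scheme \<Rightarrow> ('k, 'b, 'y) module_scheme \<Rightarrow>
     ('k, 'c, 'z) module_scheme \<Rightarrow> ('a \<Rightarrow> 'b \<Rightarrow> 'c) \<Rightarrow> bool"
  where "bilinear_map K U V W \<beta> \<longleftrightarrow>
    (\<forall>u\<in>carrier U. linear_map K V W (\<beta> u)) \<and>
    (\<forall>v\<in>carrier V. linear_map K U W (\<lambda>u. \<beta> u v))"

text \<open>
  Morphism sets consist of extensional functions (equal to \<^const>\<open>undefined\<close> outside the
  carrier), so that equality in HOL is equality of morphisms.
\<close>

definition lin_hom ::
    "'k ring \<Rightarrow> ('k, 'a, 'x) module_scheme \<Rightarrow> ('k, 'b, 'y) module_scheme \<Rightarrow> ('a \<Rightarrow> 'b) set"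
  where "lin_hom K V W = {f \<in> extensional (carrier V). linear_map K V W f}"

definition lin_iso ::
    "'k ring \<Rightarrow> ('k, 'a, 'x) module_scheme \<Rightarrow> ('k, 'b, 'y) module_scheme \<Rightarrow> ('a \<Rightarrow> 'b) set"
  where "lin_iso K V W = {f \<in> lin_hom K V W. bij_betw f (carrier V) (carrier W)}"


section \<open>Tensor product over K\<close>

text \<open>
  The tensor product of V and W is the free vector space on the pairs (v, w), with v in V and
  w in W, modulo the subspace spanned by the bilinearity relations. Its elements are cosets.
\<close>

type_synonym ('k, 'a, 'b) tensor_elem = "('a \<times> 'b \<Rightarrow> 'k) set"

definition free_pairs ::
    "'k ring \<Rightarrow> ('k, 'a, 'x) module_scheme \<Rightarrow> ('k, 'b, 'y) module_scheme \<Rightarrow>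
     ('k, 'a \<times> 'b \<Rightarrow> 'k) module"
  where "free_pairs K V W = \<lparr>
    carrier = {a. finite {p. a p \<noteq> \<zero>\<^bsub>K\<^esub>} \<and> {p. a p \<noteq> \<zero>\<^bsub>K\<^esub>} \<subseteq> carrier V \<times> carrier W \<and>
                  range a \<subseteq> carrier K},
    mult = (\<lambda>_ _. undefined), one = undefined,
    zero = (\<lambda>_. \<zero>\<^bsub>K\<^esub>), add = (\<lambda>a b p. a p \<oplus>\<^bsub>K\<^esub> b p),
    smult = (\<lambda>c a p. c \<otimes>\<^bsub>K\<^esub> a p)\<rparr>"

definition pair_gen :: "'k ring \<Rightarrow> 'a \<Rightarrow> 'b \<Rightarrow> 'a \<times> 'b \<Rightarrow> 'k"
  where "pair_gen K v w = (\<lambda>p. if p = (v, w) then \<one>\<^bsub>K\<^esub> else \<zero>\<^bsub>K\<^esub>)"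

definition tensor_rels ::
    "'k ring \<Rightarrow> ('k, 'a, 'x) module_scheme \<Rightarrow> ('k, 'b, 'y) module_scheme \<Rightarrow> ('a \<times> 'b \<Rightarrow> 'k) set"
  where "tensor_rels K V W = (let F = free_pairs K V W; g = pair_gen K in
    {g (v \<oplus>\<^bsub>V\<^esub> v') w \<ominus>\<^bsub>F\<^esub> (g v w \<oplus>\<^bsub>F\<^esub> g v' w) | v v' w.
        v \<in> carrier V \<and> v' \<in> carrier V \<and> w \<in> carrier W} \<union>
    {g v (w \<oplus>\<^bsub>W\<^esub> w') \<ominus>\<^bsub>F\<^esub> (g v w \<oplus>\<^bsub>F\<^esub> g v w') | v w w'.
        v \<in> carrier V \<and> w \<in> carrier W \<and> w' \<in> carrier W} \<union>
    {g (c \<odot>\<^bsub>V\<^esub> v) w \<ominus>\<^bsub>F\<^esub> c \<odot>\<^bsub>F\<^esub> g v w | c v w.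
        c \<in> carrier K \<and> v \<in> carrier V \<and> w \<in> carrier W} \<union>
    {g v (c \<odot>\<^bsub>W\<^esub> w) \<ominus>\<^bsub>F\<^esub> c \<odot>\<^bsub>F\<^esub> g v w | c v w.
        c \<in> carrier K \<and> v \<in> carrier V \<and> w \<in> carrier W})"

definition tensor_null ::
    "'k ring \<Rightarrow> ('k, 'a, 'x) module_scheme \<Rightarrow> ('k, 'b, 'y) module_scheme \<Rightarrow> ('a \<times> 'b \<Rightarrow> 'k) set"
  where "tensor_null K V W =
    \<Inter>{S. submodule S K (free_pairs K V W) \<and> tensor_rels K V W \<subseteq> S}"

definition tensor ::
    "'k ring \<Rightarrow> ('k, 'a, 'x) module_scheme \<Rightarrow> ('k, 'b, 'y) module_scheme \<Rightarrow>
     ('k, ('k, 'a, 'b) tensor_elem) module"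
  where "tensor K V W = (let F = free_pairs K V W; I = tensor_null K V W in \<lparr>
    carrier = a_rcosets\<^bsub>F\<^esub> I,
    mult = (\<lambda>_ _. undefined), one = undefined,
    zero = I, add = (\<lambda>A B. A <+>\<^bsub>F\<^esub> B),
    smult = (\<lambda>c A. \<Union>a\<in>A. I +>\<^bsub>F\<^esub> (c \<odot>\<^bsub>F\<^esub> a))\<rparr>)"

definition pure ::
    "'k ring \<Rightarrow> ('k, 'a, 'x) module_scheme \<Rightarrow> ('k, 'b, 'y) module_scheme \<Rightarrow> 'a \<Rightarrow> 'b \<Rightarrow>
     ('k, 'a, 'b) tensor_elem"
  where "pure K V W v w = tensor_null K V W +>\<^bsub>free_pairs K V W\<^esub> pair_gen K v w"

text \<open>
  The linear map on V \<otimes> W induced by a bilinear map \<beta> into U, that is, the map sending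
  v \<otimes> w to \<beta> v w: extend \<beta> linearly to formal sums of pairs; for bilinear \<beta> the result
  is constant on cosets, and that constant value is taken.
\<close>

definition tensor_lift ::
    "'k ring \<Rightarrow> ('k, 'a, 'x) module_scheme \<Rightarrow> ('k, 'b, 'y) module_scheme \<Rightarrow>
     ('k, 'c, 'z) module_scheme \<Rightarrow> ('a \<Rightarrow> 'b \<Rightarrow> 'c) \<Rightarrow> ('k, 'a, 'b) tensor_elem \<Rightarrow> 'c"
  where "tensor_lift K V W U \<beta> = (\<lambda>A \<in> carrier (tensor K V W).
    the_elem ((\<lambda>a. \<Oplus>\<^bsub>U\<^esub> p \<in> {p. a p \<noteq> \<zero>\<^bsub>K\<^esub>}. a p \<odot>\<^bsub>U\<^esub> \<beta> (fst p) (snd p)) ` A))"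

definition tensor_map ::
    "'k ring \<Rightarrow> ('k, 'a, 'x) module_scheme \<Rightarrow> ('k, 'b, 'y) module_scheme \<Rightarrow>
     ('k, 'c, 'z) module_scheme \<Rightarrow> ('k, 'd, 'w) module_scheme \<Rightarrow> ('a \<Rightarrow> 'c) \<Rightarrow> ('b \<Rightarrow> 'd) \<Rightarrow>
     ('k, 'a, 'b) tensor_elem \<Rightarrow> ('k, 'c, 'd) tensor_elem"
  where "tensor_map K V W V' W' f g =
    tensor_lift K V W (tensor K V' W') (\<lambda>v w. pure K V' W' (f v) (g w))"

definition tensor_assoc ::
    "'k ring \<Rightarrow> ('k, 'a, 'x) module_scheme \<Rightarrow> ('k, 'b, 'y) module_scheme \<Rightarrow>
     ('k, 'c, 'z) module_scheme \<Rightarrow>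
     ('k, ('k, 'a, 'b) tensor_elem, 'c) tensor_elem \<Rightarrow>
     ('k, 'a, ('k, 'b, 'c) tensor_elem) tensor_elem"
  where "tensor_assoc K U V W = (let T = tensor K U (tensor K V W) in
    tensor_lift K (tensor K U V) W T (\<lambda>t w.
      tensor_lift K U V T (\<lambda>u v. pure K U (tensor K V W) u (pure K V W v w)) t))"


section \<open>Hopf algebras\<close>

record ('k, 'h) hopf = "('k, 'h) module" +
  comult :: "'h \<Rightarrow> ('k, 'h, 'h) tensor_elem"
  counit :: "'h \<Rightarrow> 'k"
  antipode :: "'h \<Rightarrow> 'h"

text \<open>
  For bilinear \<beta> from M \<times> N to P, the following is the bilinear map
  (M \<otimes> H) \<times> (N \<otimes> H) to P \<otimes> H with (m \<otimes> h, n \<otimes> k) sent to \<beta> m n \<otimes> h k. Applied to two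
  coactions it gives the sum of \<beta> m0 n0 \<otimes> m1 n1 in Sweedler notation.
\<close>

definition sweedler_prod ::
    "'k ring \<Rightarrow> ('k, 'h, 'w) module_scheme \<Rightarrow> ('k, 'm, 'x) module_scheme \<Rightarrow>
     ('k, 'n, 'y) module_scheme \<Rightarrow> ('k, 'p, 'z) module_scheme \<Rightarrow> ('m \<Rightarrow> 'n \<Rightarrow> 'p) \<Rightarrow>
     ('k, 'm, 'h) tensor_elem \<Rightarrow> ('k, 'n, 'h) tensor_elem \<Rightarrow> ('k, 'p, 'h) tensor_elem"
  where "sweedler_prod K H M N P \<beta> s t =
    tensor_lift K M H (tensor K P H) (\<lambda>m h.
      tensor_lift K N H (tensor K P H) (\<lambda>n k. pure K P H (\<beta> m n) (h \<otimes>\<^bsub>H\<^esub> k)) t) s"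

definition assoc_algebra :: "'k ring \<Rightarrow> ('k, 'h, 'x) module_scheme \<Rightarrow> bool"
  where "assoc_algebra K H \<longleftrightarrow> module K H \<and> ring H \<and>
    (\<forall>c\<in>carrier K. \<forall>a\<in>carrier H. \<forall>b\<in>carrier H.
      (c \<odot>\<^bsub>H\<^esub> a) \<otimes>\<^bsub>H\<^esub> b = c \<odot>\<^bsub>H\<^esub> (a \<otimes>\<^bsub>H\<^esub> b) \<and>
      a \<otimes>\<^bsub>H\<^esub> (c \<odot>\<^bsub>H\<^esub> b) = c \<odot>\<^bsub>H\<^esub> (a \<otimes>\<^bsub>H\<^esub> b))"

definition coalgebra :: "'k ring \<Rightarrow> ('k, 'h) hopf \<Rightarrow> bool"
  where "coalgebra K H \<longleftrightarrow> module K H \<and>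
    linear_map K H (tensor K H H) (comult H) \<and>
    counit H \<in> carrier H \<rightarrow> carrier K \<and>
    (\<forall>a\<in>carrier H. \<forall>b\<in>carrier H. counit H (a \<oplus>\<^bsub>H\<^esub> b) = counit H a \<oplus>\<^bsub>K\<^esub> counit H b) \<and>
    (\<forall>c\<in>carrier K. \<forall>a\<in>carrier H. counit H (c \<odot>\<^bsub>H\<^esub> a) = c \<otimes>\<^bsub>K\<^esub> counit H a) \<and>
    (\<forall>h\<in>carrier H.
      tensor_assoc K H H H (tensor_map K H H (tensor K H H) H (comult H) (\<lambda>x. x) (comult H h)) =
      tensor_map K H H H (tensor K H H) (\<lambda>x. x) (comult H) (comult H h)) \<and>
    (\<forall>h\<in>carrier H.
      tensor_lift K H H H (\<lambda>a b. counit H a \<odot>\<^bsub>H\<^esub> b) (comult H h) = h \<and>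
      tensor_lift K H H H (\<lambda>a b. counit H b \<odot>\<^bsub>H\<^esub> a) (comult H h) = h)"

definition bialgebra :: "'k ring \<Rightarrow> ('k, 'h) hopf \<Rightarrow> bool"
  where "bialgebra K H \<longleftrightarrow> assoc_algebra K H \<and> coalgebra K H \<and>
    (\<forall>a\<in>carrier H. \<forall>b\<in>carrier H.
      comult H (a \<otimes>\<^bsub>H\<^esub> b) = sweedler_prod K H H H H (\<lambda>x y. x \<otimes>\<^bsub>H\<^esub> y) (comult H a) (comult H b) \<and>
      counit H (a \<otimes>\<^bsub>H\<^esub> b) = counit H a \<otimes>\<^bsub>K\<^esub> counit H b) \<and>
    comult H \<one>\<^bsub>H\<^esub> = pure K H H \<one>\<^bsub>H\<^esub> \<one>\<^bsub>H\<^esub> \<and>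
    counit H \<one>\<^bsub>H\<^esub> = \<one>\<^bsub>K\<^esub>"

definition hopf_algebra :: "'k ring \<Rightarrow> ('k, 'h) hopf \<Rightarrow> bool"
  where "hopf_algebra K H \<longleftrightarrow> bialgebra K H \<and>
    linear_map K H H (antipode H) \<and>
    (\<forall>h\<in>carrier H.
      tensor_lift K H H H (\<lambda>a b. antipode H a \<otimes>\<^bsub>H\<^esub> b) (comult H h) = counit H h \<odot>\<^bsub>H\<^esub> \<one>\<^bsub>H\<^esub> \<and>
      tensor_lift K H H H (\<lambda>a b. a \<otimes>\<^bsub>H\<^esub> antipode H b) (comult H h) = counit H h \<odot>\<^bsub>H\<^esub> \<one>\<^bsub>H\<^esub>)"


section \<open>Right comodules\<close>

record ('k, 'h, 'm) comod = "('k, 'm) module" +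
  coact :: "'m \<Rightarrow> ('k, 'm, 'h) tensor_elem"

definition comodule :: "'k ring \<Rightarrow> ('k, 'h) hopf \<Rightarrow> ('k, 'h, 'm) comod \<Rightarrow> bool"
  where "comodule K H M \<longleftrightarrow> module K M \<and>
    linear_map K M (tensor K M H) (coact M) \<and>
    (\<forall>m\<in>carrier M.
      tensor_assoc K M H H (tensor_map K M H (tensor K M H) H (coact M) (\<lambda>x. x) (coact M m)) =
      tensor_map K M H M (tensor K H H) (\<lambda>x. x) (comult H) (coact M m) \<and>
      tensor_lift K M H M (\<lambda>n h. counit H h \<odot>\<^bsub>M\<^esub> n) (coact M m) = m)"

definition colinear ::
    "'k ring \<Rightarrow> ('k, 'h) hopf \<Rightarrow> ('k, 'h, 'm) comod \<Rightarrow> ('k, 'h, 'n) comod \<Rightarrow> ('m \<Rightarrow> 'n) \<Rightarrow> bool"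
  where "colinear K H M N f \<longleftrightarrow>
    (\<forall>m\<in>carrier M. coact N (f m) = tensor_map K M H N H f (\<lambda>h. h) (coact M m))"

definition comod_hom ::
    "'k ring \<Rightarrow> ('k, 'h) hopf \<Rightarrow> ('k, 'h, 'm) comod \<Rightarrow> ('k, 'h, 'n) comod \<Rightarrow> ('m \<Rightarrow> 'n) set"
  where "comod_hom K H M N = {f \<in> lin_hom K M N. colinear K H M N f}"

definition coinvariants ::
    "'k ring \<Rightarrow> ('k, 'h) hopf \<Rightarrow> ('k, 'h, 'm) comod \<Rightarrow> ('k, 'h, 'm) comod"
  where "coinvariants K H M =
    M\<lparr>carrier := {m \<in> carrier M. coact M m = pure K M H m \<one>\<^bsub>H\<^esub>}\<rparr>"

definition tensor_comod ::
    "'k ring \<Rightarrow> ('k, 'h) hopf \<Rightarrow> ('k, 'h, 'm) comod \<Rightarrow> ('k, 'h, 'n) comod \<Rightarrow>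
     ('k, 'h, ('k, 'm, 'n) tensor_elem) comod"
  where "tensor_comod K H M N = module.extend (tensor K M N)
    \<lparr>coact = tensor_lift K M N (tensor K (tensor K M N) H) (\<lambda>m n.
       sweedler_prod K H M N (tensor K M N) (pure K M N) (coact M m) (coact N n))\<rparr>"


section \<open>Co-H-categories and relative Hopf modules\<close>

text \<open>
  \<open>cocat_comp D X Y Z f g\<close> is the composite f g of g from X to Y and f from Y to Z.
  The morphism spaces are indexed by their source and target and need not be disjoint.
\<close>

record ('o, 'f, 'k, 'h) cocat =
  cocat_obj :: "'o set"
  cocat_hom :: "'o \<Rightarrow> 'o \<Rightarrow> ('k, 'h, 'f) comod"
  cocat_id :: "'o \<Rightarrow> 'f"
  cocat_comp :: "'o \<Rightarrow> 'o \<Rightarrow> 'o \<Rightarrow> 'f \<Rightarrow> 'f \<Rightarrow> 'f"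

definition linear_category :: "'k ring \<Rightarrow> ('o, 'f, 'k, 'h) cocat \<Rightarrow> bool"
  where "linear_category K D \<longleftrightarrow>
    (\<forall>X\<in>cocat_obj D. \<forall>Y\<in>cocat_obj D. module K (cocat_hom D X Y)) \<and>
    (\<forall>X\<in>cocat_obj D. cocat_id D X \<in> carrier (cocat_hom D X X)) \<and>
    (\<forall>X\<in>cocat_obj D. \<forall>Y\<in>cocat_obj D. \<forall>Z\<in>cocat_obj D.
      bilinear_map K (cocat_hom D Y Z) (cocat_hom D X Y) (cocat_hom D X Z) (cocat_comp D X Y Z)) \<and>
    (\<forall>X\<in>cocat_obj D. \<forall>Y\<in>cocat_obj D. \<forall>f\<in>carrier (cocat_hom D X Y).
      cocat_comp D X X Y f (cocat_id D X) = f \<and> cocat_comp D X Y Y (cocat_id D Y) f = f) \<and>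
    (\<forall>W\<in>cocat_obj D. \<forall>X\<in>cocat_obj D. \<forall>Y\<in>cocat_obj D. \<forall>Z\<in>cocat_obj D.
      \<forall>f\<in>carrier (cocat_hom D Y Z). \<forall>g\<in>carrier (cocat_hom D X Y). \<forall>h\<in>carrier (cocat_hom D W X).
        cocat_comp D W X Z (cocat_comp D X Y Z f g) h =
        cocat_comp D W Y Z f (cocat_comp D W X Y g h))"

definition co_H_category :: "'k ring \<Rightarrow> ('k, 'h) hopf \<Rightarrow> ('o, 'f, 'k, 'h) cocat \<Rightarrow> bool"
  where "co_H_category K H D \<longleftrightarrow> linear_category K D \<and>
    (\<forall>X\<in>cocat_obj D. \<forall>Y\<in>cocat_obj D. comodule K H (cocat_hom D X Y)) \<and>
    (\<forall>X\<in>cocat_obj D.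
      coact (cocat_hom D X X) (cocat_id D X) = pure K (cocat_hom D X X) H (cocat_id D X) \<one>\<^bsub>H\<^esub>) \<and>
    (\<forall>X\<in>cocat_obj D. \<forall>Y\<in>cocat_obj D. \<forall>Z\<in>cocat_obj D.
      \<forall>f\<in>carrier (cocat_hom D Y Z). \<forall>g\<in>carrier (cocat_hom D X Y).
        coact (cocat_hom D X Z) (cocat_comp D X Y Z f g) =
        sweedler_prod K H (cocat_hom D Y Z) (cocat_hom D X Y) (cocat_hom D X Z)
          (cocat_comp D X Y Z) (coact (cocat_hom D Y Z) f) (coact (cocat_hom D X Y) g))"

text \<open>\<open>rhm_act M X Y f\<close> is the value of the functor M on the morphism f from X to Y.\<close>

record ('o, 'f, 'k, 'h, 'm) rhm =
  rhm_obj :: "'o \<Rightarrow> ('k, 'h, 'm) comod"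
  rhm_act :: "'o \<Rightarrow> 'o \<Rightarrow> 'f \<Rightarrow> 'm \<Rightarrow> 'm"

definition left_D_module ::
    "'k ring \<Rightarrow> ('o, 'f, 'k, 'h) cocat \<Rightarrow> ('o, 'f, 'k, 'h, 'm) rhm \<Rightarrow> bool"
  where "left_D_module K D M \<longleftrightarrow>
    (\<forall>X\<in>cocat_obj D. module K (rhm_obj M X)) \<and>
    (\<forall>X\<in>cocat_obj D. \<forall>Y\<in>cocat_obj D.
      bilinear_map K (cocat_hom D X Y) (rhm_obj M X) (rhm_obj M Y) (rhm_act M X Y)) \<and>
    (\<forall>X\<in>cocat_obj D. \<forall>m\<in>carrier (rhm_obj M X). rhm_act M X X (cocat_id D X) m = m) \<and>
    (\<forall>X\<in>cocat_obj D. \<forall>Y\<in>cocat_obj D. \<forall>Z\<in>cocat_obj D.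
      \<forall>f\<in>carrier (cocat_hom D Y Z). \<forall>g\<in>carrier (cocat_hom D X Y). \<forall>m\<in>carrier (rhm_obj M X).
        rhm_act M X Z (cocat_comp D X Y Z f g) m = rhm_act M Y Z f (rhm_act M X Y g m))"

definition rel_hopf_module ::
    "'k ring \<Rightarrow> ('k, 'h) hopf \<Rightarrow> ('o, 'f, 'k, 'h) cocat \<Rightarrow> ('o, 'f, 'k, 'h, 'm) rhm \<Rightarrow> bool"
  where "rel_hopf_module K H D M \<longleftrightarrow> left_D_module K D M \<and>
    (\<forall>X\<in>cocat_obj D. comodule K H (rhm_obj M X)) \<and>
    (\<forall>X\<in>cocat_obj D. \<forall>Y\<in>cocat_obj D.
      \<forall>f\<in>carrier (cocat_hom D X Y). \<forall>m\<in>carrier (rhm_obj M X).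
        coact (rhm_obj M Y) (rhm_act M X Y f m) =
        sweedler_prod K H (cocat_hom D X Y) (rhm_obj M X) (rhm_obj M Y)
          (rhm_act M X Y) (coact (cocat_hom D X Y) f) (coact (rhm_obj M X) m))"

definition D_module_hom ::
    "'k ring \<Rightarrow> ('o, 'f, 'k, 'h) cocat \<Rightarrow> ('o, 'f, 'k, 'h, 'm) rhm \<Rightarrow> ('o, 'f, 'k, 'h, 'n) rhm \<Rightarrow>
     ('o \<Rightarrow> 'm \<Rightarrow> 'n) set"
  where "D_module_hom K D M N =
    {\<eta> \<in> (\<Pi>\<^sub>E X\<in>cocat_obj D. lin_hom K (rhm_obj M X) (rhm_obj N X)).
      \<forall>X\<in>cocat_obj D. \<forall>Y\<in>cocat_obj D.
        \<forall>f\<in>carrier (cocat_hom D X Y). \<forall>m\<in>carrier (rhm_obj M X).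
          \<eta> Y (rhm_act M X Y f m) = rhm_act N X Y f (\<eta> X m)}"

definition rhm_hom ::
    "'k ring \<Rightarrow> ('k, 'h) hopf \<Rightarrow> ('o, 'f, 'k, 'h) cocat \<Rightarrow> ('o, 'f, 'k, 'h, 'm) rhm \<Rightarrow>
     ('o, 'f, 'k, 'h, 'n) rhm \<Rightarrow> ('o \<Rightarrow> 'm \<Rightarrow> 'n) set"
  where "rhm_hom K H D M N =
    {\<eta> \<in> D_module_hom K D M N. \<forall>X\<in>cocat_obj D. colinear K H (rhm_obj M X) (rhm_obj N X) (\<eta> X)}"

definition rhm_hom_space ::
    "'k ring \<Rightarrow> ('k, 'h) hopf \<Rightarrow> ('o, 'f, 'k, 'h) cocat \<Rightarrow> ('o, 'f, 'k, 'h, 'm) rhm \<Rightarrow>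
     ('o, 'f, 'k, 'h, 'n) rhm \<Rightarrow> ('k, 'o \<Rightarrow> 'm \<Rightarrow> 'n) module"
  where "rhm_hom_space K H D M N = \<lparr>
    carrier = rhm_hom K H D M N,
    mult = (\<lambda>_ _. undefined), one = undefined,
    zero = (\<lambda>X\<in>cocat_obj D. \<lambda>m\<in>carrier (rhm_obj M X). \<zero>\<^bsub>rhm_obj N X\<^esub>),
    add = (\<lambda>\<eta> \<theta>. \<lambda>X\<in>cocat_obj D. \<lambda>m\<in>carrier (rhm_obj M X). \<eta> X m \<oplus>\<^bsub>rhm_obj N X\<^esub> \<theta> X m),
    smult = (\<lambda>c \<eta>. \<lambda>X\<in>cocat_obj D. \<lambda>m\<in>carrier (rhm_obj M X). c \<odot>\<^bsub>rhm_obj N X\<^esub> \<eta> X m)\<rparr>"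

definition rhm_id ::
    "('o, 'f, 'k, 'h) cocat \<Rightarrow> ('o, 'f, 'k, 'h, 'm) rhm \<Rightarrow> 'o \<Rightarrow> 'm \<Rightarrow> 'm"
  where "rhm_id D M = (\<lambda>X\<in>cocat_obj D. \<lambda>m\<in>carrier (rhm_obj M X). m)"

text \<open>\<open>rhm_comp D M \<theta> \<eta>\<close> is the composite \<theta> \<eta>, where M is the source of \<eta>.\<close>

definition rhm_comp ::
    "('o, 'f, 'k, 'h) cocat \<Rightarrow> ('o, 'f, 'k, 'h, 'm) rhm \<Rightarrow> ('o \<Rightarrow> 'n \<Rightarrow> 'p) \<Rightarrow> ('o \<Rightarrow> 'm \<Rightarrow> 'n) \<Rightarrow>
     'o \<Rightarrow> 'm \<Rightarrow> 'p"
  where "rhm_comp D M \<theta> \<eta> = (\<lambda>X\<in>cocat_obj D. compose (carrier (rhm_obj M X)) (\<theta> X) (\<eta> X))"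

definition rhm_tensor ::
    "'k ring \<Rightarrow> ('k, 'h) hopf \<Rightarrow> ('o, 'f, 'k, 'h, 'n) rhm \<Rightarrow> ('k, 'h, 'm) comod \<Rightarrow>
     ('o, 'f, 'k, 'h, ('k, 'n, 'm) tensor_elem) rhm"
  where "rhm_tensor K H N M = \<lparr>
    rhm_obj = (\<lambda>X. tensor_comod K H (rhm_obj N X) M),
    rhm_act = (\<lambda>X Y f.
      tensor_map K (rhm_obj N X) M (rhm_obj N Y) M (rhm_act N X Y f) (\<lambda>m. m))\<rparr>"

text \<open>\<open>rhm_tensor_map K D N M N' M' \<eta> u\<close> is \<eta> \<otimes> u from N \<otimes> M to N' \<otimes> M'.\<close>

definition rhm_tensor_map ::
    "'k ring \<Rightarrow> ('o, 'f, 'k, 'h) cocat \<Rightarrow> ('o, 'f, 'k, 'h, 'n) rhm \<Rightarrow> ('k, 'h, 'm) comod \<Rightarrow>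
     ('o, 'f, 'k, 'h, 'l) rhm \<Rightarrow> ('k, 'h, 'q) comod \<Rightarrow> ('o \<Rightarrow> 'n \<Rightarrow> 'l) \<Rightarrow> ('m \<Rightarrow> 'q) \<Rightarrow>
     'o \<Rightarrow> ('k, 'n, 'm) tensor_elem \<Rightarrow> ('k, 'l, 'q) tensor_elem"
  where "rhm_tensor_map K D N M N' M' \<eta> u =
    (\<lambda>X\<in>cocat_obj D. tensor_map K (rhm_obj N X) M (rhm_obj N' X) M' (\<eta> X) u)"


section \<open>The right adjoint of N \<otimes> (-)\<close>

text \<open>
  Data of a functor R from relative Hopf modules to comodules together with the bijections
  \<open>radj_transpose M P\<close> from the morphisms N \<otimes> M to P onto the colinear maps M to R P.

  HOL has no type of all comodules. The comodules range over those with carrier in a fixed but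
  arbitrary type 'm, which serves as the universe of Comod-H; the relative Hopf modules P
  likewise have carriers in 'p. For this to be meaningful 'm has to be large enough to hold
  a copy of the trivial comodule K, i.e. K must inject into 'm. A right adjoint embeds R P into
  the space of D-module morphisms N to P, so 'm = 'o \<Rightarrow> 'n \<Rightarrow> 'p is always large enough for it.
\<close>

record ('o, 'f, 'k, 'h, 'n, 'p, 'm) radj =
  radj_obj :: "('o, 'f, 'k, 'h, 'p) rhm \<Rightarrow> ('k, 'h, 'm) comod"
  radj_map :: "('o, 'f, 'k, 'h, 'p) rhm \<Rightarrow> ('o, 'f, 'k, 'h, 'p) rhm \<Rightarrow> ('o \<Rightarrow> 'p \<Rightarrow> 'p) \<Rightarrow> 'm \<Rightarrow> 'm"
  radj_transpose :: "('k, 'h, 'm) comod \<Rightarrow> ('o, 'f, 'k, 'h, 'p) rhm \<Rightarrow>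
    ('o \<Rightarrow> ('k, 'n, 'm) tensor_elem \<Rightarrow> 'p) \<Rightarrow> 'm \<Rightarrow> 'm"

definition radj_functor ::
    "'k ring \<Rightarrow> ('k, 'h) hopf \<Rightarrow> ('o, 'f, 'k, 'h) cocat \<Rightarrow>
     ('o, 'f, 'k, 'h, 'n, 'p, 'm) radj \<Rightarrow> bool"
  where "radj_functor K H D R \<longleftrightarrow>
    (\<forall>P. rel_hopf_module K H D P \<longrightarrow>
      comodule K H (radj_obj R P) \<and>
      radj_map R P P (rhm_id D P) = (\<lambda>r\<in>carrier (radj_obj R P). r)) \<and>
    (\<forall>P P' g. rel_hopf_module K H D P \<and> rel_hopf_module K H D P' \<and> g \<in> rhm_hom K H D P P' \<longrightarrow>
      radj_map R P P' g \<in> comod_hom K H (radj_obj R P) (radj_obj R P')) \<and>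
    (\<forall>P P' P'' g g'. rel_hopf_module K H D P \<and> rel_hopf_module K H D P' \<and>
      rel_hopf_module K H D P'' \<and> g \<in> rhm_hom K H D P P' \<and> g' \<in> rhm_hom K H D P' P'' \<longrightarrow>
      radj_map R P P'' (rhm_comp D P g' g) =
      compose (carrier (radj_obj R P)) (radj_map R P' P'' g') (radj_map R P P' g))"

definition right_adjoint ::
    "'k ring \<Rightarrow> ('k, 'h) hopf \<Rightarrow> ('o, 'f, 'k, 'h) cocat \<Rightarrow> ('o, 'f, 'k, 'h, 'n) rhm \<Rightarrow>
     ('o, 'f, 'k, 'h, 'n, 'p, 'm) radj \<Rightarrow> bool"
  where "right_adjoint K H D N R \<longleftrightarrow> radj_functor K H D R \<and>
    (\<forall>M P. comodule K H M \<and> rel_hopf_module K H D P \<longrightarrow>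
      bij_betw (radj_transpose R M P)
        (rhm_hom K H D (rhm_tensor K H N M) P) (comod_hom K H M (radj_obj R P))) \<and>
    (\<forall>M M' P u \<theta>. comodule K H M \<and> comodule K H M' \<and> rel_hopf_module K H D P \<and>
      u \<in> comod_hom K H M' M \<and> \<theta> \<in> rhm_hom K H D (rhm_tensor K H N M) P \<longrightarrow>
      radj_transpose R M' P
        (rhm_comp D (rhm_tensor K H N M') \<theta> (rhm_tensor_map K D N M' N M (rhm_id D N) u)) =
      compose (carrier M') (radj_transpose R M P \<theta>) u) \<and>
    (\<forall>M P P' g \<theta>. comodule K H M \<and> rel_hopf_module K H D P \<and> rel_hopf_module K H D P' \<and>
      g \<in> rhm_hom K H D P P' \<and> \<theta> \<in> rhm_hom K H D (rhm_tensor K H N M) P \<longrightarrow>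
      radj_transpose R M P' (rhm_comp D (rhm_tensor K H N M) g \<theta>) =
      compose (carrier M) (radj_map R P P' g) (radj_transpose R M P \<theta>))"

text \<open>The counit N \<otimes> R P to P of the adjunction: the transpose of the identity of R P.\<close>

definition radj_eval ::
    "'k ring \<Rightarrow> ('k, 'h) hopf \<Rightarrow> ('o, 'f, 'k, 'h) cocat \<Rightarrow> ('o, 'f, 'k, 'h, 'n) rhm \<Rightarrow>
     ('o, 'f, 'k, 'h, 'n, 'p, 'm) radj \<Rightarrow> ('o, 'f, 'k, 'h, 'p) rhm \<Rightarrow>
     'o \<Rightarrow> ('k, 'n, 'm) tensor_elem \<Rightarrow> 'p"
  where "radj_eval K H D N R P =
    inv_into (rhm_hom K H D (rhm_tensor K H N (radj_obj R P)) P)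
      (radj_transpose R (radj_obj R P) P) (\<lambda>r\<in>carrier (radj_obj R P). r)"

text \<open>
  The map induced by a morphism u from N' to N on right adjoints, R N P to R N' P (the functor
  HOM is contravariant in its first argument): the transpose of the composite
  N' \<otimes> R P to N \<otimes> R P to P of u \<otimes> id and the evaluation.
\<close>

definition radj_precomp ::
    "'k ring \<Rightarrow> ('k, 'h) hopf \<Rightarrow> ('o, 'f, 'k, 'h) cocat \<Rightarrow>
     ('o, 'f, 'k, 'h, 'n) rhm \<Rightarrow> ('o, 'f, 'k, 'h, 'n, 'p, 'm) radj \<Rightarrow>
     ('o, 'f, 'k, 'h, 'n) rhm \<Rightarrow> ('o, 'f, 'k, 'h, 'n, 'p, 'm) radj \<Rightarrow>
     ('o, 'f, 'k, 'h, 'p) rhm \<Rightarrow> ('o \<Rightarrow> 'n \<Rightarrow> 'n) \<Rightarrow> 'm \<Rightarrow> 'm"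
  where "radj_precomp K H D N R N' R' P u =
    radj_transpose R' (radj_obj R P) P
      (rhm_comp D (rhm_tensor K H N' (radj_obj R P)) (radj_eval K H D N R P)
        (rhm_tensor_map K D N' (radj_obj R P) N (radj_obj R P) u (\<lambda>r. r)))"

text \<open>
  The canonical map from coinvariants of HOM(N, P) to morphisms N to P: a coinvariant r is the
  colinear map K to R P with value r at 1, whose transpose N = N \<otimes> K to P is n sent to the
  evaluation of n \<otimes> r.
\<close>

definition coinv_to_hom ::
    "'k ring \<Rightarrow> ('k, 'h) hopf \<Rightarrow> ('o, 'f, 'k, 'h) cocat \<Rightarrow> ('o, 'f, 'k, 'h, 'n) rhm \<Rightarrow>
     ('o, 'f, 'k, 'h, 'n, 'p, 'm) radj \<Rightarrow> ('o, 'f, 'k, 'h, 'p) rhm \<Rightarrow> 'm \<Rightarrow> 'o \<Rightarrow> 'n \<Rightarrow> 'p"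
  where "coinv_to_hom K H D N R P =
    (\<lambda>r\<in>carrier (coinvariants K H (radj_obj R P)). \<lambda>X\<in>cocat_obj D. \<lambda>n\<in>carrier (rhm_obj N X).
       radj_eval K H D N R P X (pure K (rhm_obj N X) (radj_obj R P) n r))"

end

theory Submission
  imports Defs
begin

text \<open>
  A coinvariant r of R P is the same as a colinear map from the trivial comodule K to R P, namely
  c \<mapsto> c r. By adjunction such maps correspond to morphisms from N \<otimes> K to P, hence to morphisms from
  N to P. An adjoint pair \<theta> from N \<otimes> M to P and u from M to R P is characterised by
  \<theta> (n \<otimes> m) = ev (n \<otimes> u m), where ev is the counit of the adjunction. For M = K this gives
  injectivity and surjectivity of the canonical map; for M = R P it gives both naturality statements.
\<close>


section \<open>Linear maps\<close>

text \<open>\<open>R P\<close> is known only through its universal property: its elements are not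
  functions, and r in \<open>R P\<close> is accessible only through the counit values ev (n
  \<otimes> r). It is not shown directly that these values separate elements; instead, equal values
  are turned into equal colinear maps by the adjunction, and elements are recovered by evaluating
  such maps at 1 in K. Coinvariance of r makes n \<mapsto> n \<otimes> r colinear, because the
  coaction of n \<otimes> r is then the sum of n0 \<otimes> r \<otimes> n1. Most of the work lies
  below this argument. A tensor is a coset of formal sums, and a lifted map has a usable value only
  once the map being lifted is known to be bilinear. Hence an operation is recorded as a pair of
  facts, linearity and value on pure tensors, and an identity is proved by showing both sides linear
  and comparing them on pure tensors. Moreover, morphisms are extensional functions that follow the
  intended formula only on the carrier, so agreement on the carrier is the hypothesis of many
  auxiliary facts.\<close>

lemma linear_mapI:
  assumes "\<And>v. v \<in> carrier V \<Longrightarrow> f v \<in> carrier W"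
    and "\<And>u v. u \<in> carrier V \<Longrightarrow> v \<in> carrier V \<Longrightarrow> f (u \<oplus>\<^bsub>V\<^esub> v) = f u \<oplus>\<^bsub>W\<^esub> f v"
    and "\<And>c v. c \<in> carrier K \<Longrightarrow> v \<in> carrier V \<Longrightarrow> f (c \<odot>\<^bsub>V\<^esub> v) = c \<odot>\<^bsub>W\<^esub> f v"
  shows "linear_map K V W f"
  using assms by (auto simp: linear_map_def)

lemma linear_mapD:
  assumes "linear_map K V W f"
  shows "v \<in> carrier V \<Longrightarrow> f v \<in> carrier W"
    and "u \<in> carrier V \<Longrightarrow> v \<in> carrier V \<Longrightarrow> f (u \<oplus>\<^bsub>V\<^esub> v) = f u \<oplus>\<^bsub>W\<^esub> f v"
    and "c \<in> carrier K \<Longrightarrow> v \<in> carrier V \<Longrightarrow> f (c \<odot>\<^bsub>V\<^esub> v) = c \<odot>\<^bsub>W\<^esub> f v"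
  using assms by (auto simp: linear_map_def)

lemma linear_map_id: "linear_map K V V (\<lambda>v. v)"
  by (simp add: linear_map_def)

lemma linear_map_comp:
  assumes "linear_map K U V f" and "linear_map K V W g"
  shows "linear_map K U W (\<lambda>u. g (f u))"
  using assms by (auto simp: linear_map_def Pi_def)

text \<open>A restricted function obeys its formula only on the carrier. That V is a module keeps
  sums and multiples inside the carrier, where f and g agree.\<close>

lemma linear_map_cong:
  assumes "module K V" and "\<And>v. v \<in> carrier V \<Longrightarrow> f v = g v"
  shows "linear_map K V W f \<longleftrightarrow> linear_map K V W g"
proof -
  interpret V: module K V by fact
  show ?thesis using assms(2) by (simp add: linear_map_def Pi_def)
qed

lemma linear_map_add:
  assumes "module K V" and "module K W" and "linear_map K V W f" and "linear_map K V W g"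
  shows "linear_map K V W (\<lambda>v. f v \<oplus>\<^bsub>W\<^esub> g v)"
proof -
  interpret V: module K V by fact
  interpret W: module K W by fact
  note f = linear_mapD[OF assms(3)] and g = linear_mapD[OF assms(4)]
  show ?thesis
    by (rule linear_mapI) (simp_all add: f g W.smult_r_distr W.a_ac)
qed

text \<open>Commutativity of K enters here, in c (a w) = a (c w). With \<open>linear_map_add\<close>
  this supplies the right-hand sides when the dependence of a map on a parameter is tested on pure
  tensors.\<close>

lemma linear_map_smult:
  assumes "module K V" and "module K W" and "linear_map K V W f" and "c \<in> carrier K"
  shows "linear_map K V W (\<lambda>v. c \<odot>\<^bsub>W\<^esub> f v)"
proof -
  interpret V: module K V by fact
  interpret W: module K W by fact
  note f = linear_mapD[OF assms(3)]
  show ?thesis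
  proof (rule linear_mapI)
    fix a v assume "a \<in> carrier K" "v \<in> carrier V"
    then show "c \<odot>\<^bsub>W\<^esub> f (a \<odot>\<^bsub>V\<^esub> v) = a \<odot>\<^bsub>W\<^esub> (c \<odot>\<^bsub>W\<^esub> f v)"
      using f assms(4) by (metis W.smult_assoc1 V.R.m_comm)
  qed (use f assms(4) in \<open>simp_all add: W.smult_r_distr\<close>)
qed

lemma bilinear_mapI:
  assumes "\<And>u. u \<in> carrier U \<Longrightarrow> linear_map K V W (\<beta> u)"
    and "\<And>v. v \<in> carrier V \<Longrightarrow> linear_map K U W (\<lambda>u. \<beta> u v)"
  shows "bilinear_map K U V W \<beta>"
  using assms by (auto simp: bilinear_map_def)

lemma bilinear_mapD:
  assumes "bilinear_map K U V W \<beta>"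
  shows "u \<in> carrier U \<Longrightarrow> linear_map K V W (\<beta> u)"
    and "v \<in> carrier V \<Longrightarrow> linear_map K U W (\<lambda>u. \<beta> u v)"
    and "u \<in> carrier U \<Longrightarrow> v \<in> carrier V \<Longrightarrow> \<beta> u v \<in> carrier W"
  using assms by (auto simp: bilinear_map_def linear_map_def)

lemma bilinear_map_comp:
  assumes "bilinear_map K V' W' U \<beta>" and "linear_map K V V' f" and "linear_map K W W' g"
  shows "bilinear_map K V W U (\<lambda>v w. \<beta> (f v) (g w))"
proof (rule bilinear_mapI)
  fix v assume "v \<in> carrier V"
  then show "linear_map K W U (\<lambda>w. \<beta> (f v) (g w))"
    by (intro linear_map_comp[OF assms(3)] bilinear_mapD(1)[OF assms(1)] linear_mapD(1)[OF assms(2)])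
next
  fix w assume "w \<in> carrier W"
  then show "linear_map K V U (\<lambda>v. \<beta> (f v) (g w))"
    by (intro linear_map_comp[OF assms(2), of U "\<lambda>v. \<beta> v (g w)"] bilinear_mapD(2)[OF assms(1)]
        linear_mapD(1)[OF assms(3)])
qed

text \<open>The module axioms see only these four components, so extending a tensor product by a
  coaction does not affect them.\<close>

lemma module_cong:
  assumes "module K V" and "carrier V' = carrier V" and "\<zero>\<^bsub>V'\<^esub> = \<zero>\<^bsub>V\<^esub>"
    and "add V' = add V" and "smult V' = smult V"
  shows "module K V'"
proof -
  interpret V: module K V by fact
  show ?thesis
  proof (rule moduleI)
    show "abelian_group V'"
    proof (rule abelian_groupI)
      fix x assume "x \<in> carrier V'"
      then show "\<exists>y\<in>carrier V'. y \<oplus>\<^bsub>V'\<^esub> x = \<zero>\<^bsub>V'\<^esub>"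
        by (intro bexI[of _ "\<ominus>\<^bsub>V\<^esub> x"]) (simp_all add: assms(2-) V.l_neg)
    qed (simp_all add: assms(2-) V.a_ac)
  qed (simp_all add: assms(2-) V.R.is_cring V.smult_l_distr V.smult_r_distr V.smult_assoc1)
qed

text \<open>Meant for \<open>tensor_null\<close>, which is an intersection; the empty family is
  excluded because its intersection would be the whole type.\<close>

lemma submodule_Inter:
  assumes "module R M" and "\<And>S. S \<in> A \<Longrightarrow> submodule S R M" and "A \<noteq> {}"
  shows "submodule (\<Inter>A) R M"
proof -
  interpret module R M by fact
  show ?thesis
  proof (rule submoduleI)
    show "\<Inter>A \<subseteq> carrier M" using submoduleE(1)[OF assms(2)] assms(3) by fast
    show "\<zero>\<^bsub>M\<^esub> \<in> \<Inter>A"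
      using submodule.axioms(1)[OF assms(2)] subgroup.one_closed by fastforce
  qed (auto dest: submoduleE[OF assms(2)])
qed


section \<open>The tensor product\<close>

lemma mem_free_pairs:
  "a \<in> carrier (free_pairs K V W) \<longleftrightarrow>
    finite {p. a p \<noteq> \<zero>\<^bsub>K\<^esub>} \<and> (\<forall>p. a p \<noteq> \<zero>\<^bsub>K\<^esub> \<longrightarrow> p \<in> carrier V \<times> carrier W) \<and>
    (\<forall>p. a p \<in> carrier K)"
  by (auto simp: free_pairs_def)

lemma free_pairs_simps:
  "\<zero>\<^bsub>free_pairs K V W\<^esub> = (\<lambda>_. \<zero>\<^bsub>K\<^esub>)"
  "a \<oplus>\<^bsub>free_pairs K V W\<^esub> b = (\<lambda>p. a p \<oplus>\<^bsub>K\<^esub> b p)"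
  "c \<odot>\<^bsub>free_pairs K V W\<^esub> a = (\<lambda>p. c \<otimes>\<^bsub>K\<^esub> a p)"
  by (simp_all add: free_pairs_def)

lemma free_pairs_module:
  assumes "cring K"
  shows "module K (free_pairs K V W)"
proof -
  interpret K: cring K by fact
  let ?F = "free_pairs K V W"
  have add: "a \<oplus>\<^bsub>?F\<^esub> b \<in> carrier ?F" if "a \<in> carrier ?F" "b \<in> carrier ?F" for a b
  proof -
    have "{p. a p \<oplus>\<^bsub>K\<^esub> b p \<noteq> \<zero>\<^bsub>K\<^esub>} \<subseteq> {p. a p \<noteq> \<zero>\<^bsub>K\<^esub>} \<union> {p. b p \<noteq> \<zero>\<^bsub>K\<^esub>}"
      by auto
    moreover have "finite \<dots>" using that by (simp add: mem_free_pairs)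
    ultimately show ?thesis
      using that by (auto simp: mem_free_pairs free_pairs_simps intro: finite_subset)
  qed
  have smult: "c \<odot>\<^bsub>?F\<^esub> a \<in> carrier ?F" if "c \<in> carrier K" "a \<in> carrier ?F" for c a
  proof -
    have "{p. c \<otimes>\<^bsub>K\<^esub> a p \<noteq> \<zero>\<^bsub>K\<^esub>} \<subseteq> {p. a p \<noteq> \<zero>\<^bsub>K\<^esub>}"
      using that(1) by auto
    then show ?thesis
      using that by (auto simp: mem_free_pairs free_pairs_simps intro: finite_subset)
  qed
  have val: "a p \<in> carrier K" if "a \<in> carrier ?F" for a p
    using that by (cases p) (simp add: mem_free_pairs)
  \<comment> \<open>The inverse is taken to be (-1) a, so that its finite support follows from
    \<open>smult\<close>.\<close>
  have inv: "\<exists>b\<in>carrier ?F. b \<oplus>\<^bsub>?F\<^esub> a = \<zero>\<^bsub>?F\<^esub>" if "a \<in> carrier ?F" for a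
  proof (rule bexI)
    show "(\<ominus>\<^bsub>K\<^esub> \<one>\<^bsub>K\<^esub>) \<odot>\<^bsub>?F\<^esub> a \<in> carrier ?F" using that by (simp add: smult)
    show "(\<ominus>\<^bsub>K\<^esub> \<one>\<^bsub>K\<^esub>) \<odot>\<^bsub>?F\<^esub> a \<oplus>\<^bsub>?F\<^esub> a = \<zero>\<^bsub>?F\<^esub>"
      using val[OF that] by (simp add: free_pairs_simps K.l_minus K.l_neg)
  qed
  show ?thesis
  proof (rule moduleI)
    show "abelian_group ?F"
    proof (rule abelian_groupI)
      show "\<zero>\<^bsub>?F\<^esub> \<in> carrier ?F" by (simp add: mem_free_pairs free_pairs_simps)
      show "x \<oplus>\<^bsub>?F\<^esub> y = y \<oplus>\<^bsub>?F\<^esub> x" if "x \<in> carrier ?F" "y \<in> carrier ?F" for x y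
        using that by (simp add: free_pairs_simps val K.a_comm)
    qed (simp_all add: add inv, simp_all add: free_pairs_simps val K.a_assoc)
  qed (simp_all add: smult assms, simp_all add: free_pairs_simps val K.m_assoc K.l_distr K.r_distr)
qed

lemma pair_gen_closed:
  assumes "cring K" and "v \<in> carrier V" and "w \<in> carrier W"
  shows "pair_gen K v w \<in> carrier (free_pairs K V W)"
proof -
  interpret K: cring K by fact
  have "{p. pair_gen K v w p \<noteq> \<zero>\<^bsub>K\<^esub>} \<subseteq> {(v, w)}"
    by (auto simp: pair_gen_def)
  then show ?thesis
    using assms(2,3) by (auto simp: mem_free_pairs pair_gen_def intro: finite_subset)
qed

text \<open>A formal sum is taken apart one pair at a time; generators carry a coefficient because a
  point of the support does.\<close>

lemma free_pairs_induct [consumes 2, case_names zero gen add]: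
  assumes "cring K" and "a \<in> carrier (free_pairs K V W)"
    and zero: "Q \<zero>\<^bsub>free_pairs K V W\<^esub>"
    and gen: "\<And>c v w. c \<in> carrier K \<Longrightarrow> v \<in> carrier V \<Longrightarrow> w \<in> carrier W \<Longrightarrow>
      Q (c \<odot>\<^bsub>free_pairs K V W\<^esub> pair_gen K v w)"
    and add: "\<And>a b. a \<in> carrier (free_pairs K V W) \<Longrightarrow> b \<in> carrier (free_pairs K V W) \<Longrightarrow>
      Q a \<Longrightarrow> Q b \<Longrightarrow> Q (a \<oplus>\<^bsub>free_pairs K V W\<^esub> b)"
  shows "Q a"
proof -
  interpret K: cring K by fact
  let ?F = "free_pairs K V W"
  interpret F: module K ?F by (rule free_pairs_module) fact
  \<comment> \<open>Induction runs over a finite set containing the support, not over the support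
    itself, so a point where a vanishes is dropped without changing a.\<close>
  have "Q a" if "finite S" "a \<in> carrier ?F" "{p. a p \<noteq> \<zero>\<^bsub>K\<^esub>} \<subseteq> S" for S a
    using that
  proof (induction S arbitrary: a rule: finite_induct)
    case empty
    then have "a = \<zero>\<^bsub>?F\<^esub>" by (auto simp: free_pairs_simps)
    then show ?case using zero by simp
  next
    case (insert p S)
    show ?case
    proof (cases "a p = \<zero>\<^bsub>K\<^esub>")
      case True
      then show ?thesis using insert by (intro insert.IH) auto
    next
      case False
      obtain v w where p: "p = (v, w)" by fastforce
      then have vw: "v \<in> carrier V" "w \<in> carrier W"
        using False insert.prems(1) by (auto simp: mem_free_pairs)
      have ap: "a p \<in> carrier K" using insert.prems(1) by (simp add: mem_free_pairs p)
      \<comment> \<open>Erasing the value at p leaves a sum supported in S; a is recovered by adding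
        back \<open>a p\<close> times the generator at p.\<close>
      let ?a = "a(p := \<zero>\<^bsub>K\<^esub>)"
      have "{q. ?a q \<noteq> \<zero>\<^bsub>K\<^esub>} \<subseteq> {q. a q \<noteq> \<zero>\<^bsub>K\<^esub>}" by auto
      then have a': "?a \<in> carrier ?F"
        using insert.prems(1) by (auto simp: mem_free_pairs intro: finite_subset)
      have "{q. ?a q \<noteq> \<zero>\<^bsub>K\<^esub>} \<subseteq> S" using insert.prems(2) by auto
      then have "Q ?a" by (rule insert.IH[OF a'])
      moreover have "a = ?a \<oplus>\<^bsub>?F\<^esub> a p \<odot>\<^bsub>?F\<^esub> pair_gen K v w"
        using insert.prems(1) p by (auto simp: free_pairs_simps pair_gen_def mem_free_pairs)
      ultimately show ?thesis
        using add[OF a' F.smult_closed[OF ap pair_gen_closed[OF assms(1) vw]] _ gen[OF ap vw]]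
        by simp
    qed
  qed
  then show ?thesis using assms(2) by (auto simp: mem_free_pairs)
qed

section \<open>The subspace of relations and the quotient\<close>

lemma tensor_rels_subset:
  assumes "module K V" and "module K W"
  shows "tensor_rels K V W \<subseteq> carrier (free_pairs K V W)"
proof -
  interpret V: module K V by fact
  interpret W: module K W by fact
  interpret F: module K "free_pairs K V W" by (rule free_pairs_module[OF V.R.is_cring])
  note [simp] = pair_gen_closed[OF V.R.is_cring]
  show ?thesis
    by (auto simp: tensor_rels_def Let_def)
qed

text \<open>The intersected family is nonempty: the whole free space is a submodule and contains the
  relations.\<close>

lemma tensor_null_submodule:
  assumes "module K V" and "module K W"
  shows "submodule (tensor_null K V W) K (free_pairs K V W)"
proof -
  interpret V: module K V by fact
  interpret F: module K "free_pairs K V W" by (rule free_pairs_module[OF V.R.is_cring])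
  show ?thesis
    unfolding tensor_null_def using tensor_rels_subset[OF assms] F.carrier_is_submodule
    by (intro submodule_Inter) (auto intro: F.module_axioms)
qed

text \<open>The quotient map from formal sums to tensors; \<open>pure\<close> is its composite with
  the generators.\<close>

definition tensor_class ::
    "'k ring \<Rightarrow> ('k, 'a, 'x) module_scheme \<Rightarrow> ('k, 'b, 'y) module_scheme \<Rightarrow> ('a \<times> 'b \<Rightarrow> 'k) \<Rightarrow>
     ('k, 'a, 'b) tensor_elem"
  where "tensor_class K V W a = tensor_null K V W +>\<^bsub>free_pairs K V W\<^esub> a"

text \<open>The interface to the quotient, through which later proofs argue with representatives.
  The delicate point is the scalar multiple, which is defined as a union of cosets over all
  representatives.\<close>

lemma tensor_class_props:
  assumes "module K V" and "module K W"
  defines "F \<equiv> free_pairs K V W" and "T \<equiv> tensor K V W"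
  shows "carrier T = tensor_class K V W ` carrier F"
    and "\<zero>\<^bsub>T\<^esub> = tensor_class K V W \<zero>\<^bsub>F\<^esub>"
    and "a \<in> carrier F \<Longrightarrow> b \<in> carrier F \<Longrightarrow>
      tensor_class K V W a \<oplus>\<^bsub>T\<^esub> tensor_class K V W b = tensor_class K V W (a \<oplus>\<^bsub>F\<^esub> b)"
    and "c \<in> carrier K \<Longrightarrow> a \<in> carrier F \<Longrightarrow>
      c \<odot>\<^bsub>T\<^esub> tensor_class K V W a = tensor_class K V W (c \<odot>\<^bsub>F\<^esub> a)"
    and "a \<in> carrier F \<Longrightarrow> a \<in> tensor_class K V W a"
    and "a \<in> carrier F \<Longrightarrow> b \<in> tensor_class K V W a \<Longrightarrow>
      b \<in> carrier F \<and> b \<ominus>\<^bsub>F\<^esub> a \<in> tensor_null K V W"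
    and "a \<in> carrier F \<Longrightarrow> b \<in> carrier F \<Longrightarrow> a \<ominus>\<^bsub>F\<^esub> b \<in> tensor_null K V W \<Longrightarrow>
      tensor_class K V W a = tensor_class K V W b"
proof -
  interpret V: module K V by fact
  interpret F: module K F unfolding F_def by (rule free_pairs_module[OF V.R.is_cring])
  let ?I = "tensor_null K V W"
  interpret I: submodule ?I K F unfolding F_def by (rule tensor_null_submodule) fact+
  interpret A: abelian_subgroup ?I F
    by (rule abelian_subgroupI3[OF additive_subgroupI]) (auto intro: I.subgroup_axioms F.abelian_group_axioms)
  have sub: "?I \<subseteq> carrier F" by (rule A.a_subset)
  show "carrier T = tensor_class K V W ` carrier F"
    by (auto simp: T_def F_def tensor_def Let_def tensor_class_def A_RCOSETS_def')
  show "\<zero>\<^bsub>T\<^esub> = tensor_class K V W \<zero>\<^bsub>F\<^esub>"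
    using sub by (simp add: T_def tensor_def Let_def tensor_class_def flip: F_def)
  show "a \<in> carrier F \<Longrightarrow> b \<in> carrier F \<Longrightarrow>
      tensor_class K V W a \<oplus>\<^bsub>T\<^esub> tensor_class K V W b = tensor_class K V W (a \<oplus>\<^bsub>F\<^esub> b)"
    by (simp add: T_def tensor_def Let_def tensor_class_def A.a_rcos_sum flip: F_def)
  show self: "a \<in> carrier F \<Longrightarrow> a \<in> tensor_class K V W a" for a
    by (simp add: tensor_class_def A.a_rcos_self flip: F_def)
  show diff: "b \<in> carrier F \<and> b \<ominus>\<^bsub>F\<^esub> a \<in> ?I"
    if a: "a \<in> carrier F" and b: "b \<in> tensor_class K V W a" for a b
  proof -
    obtain i where i: "i \<in> ?I" "b = i \<oplus>\<^bsub>F\<^esub> a"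
      using b unfolding tensor_class_def a_r_coset_def' F_def by blast
    have iF: "i \<in> carrier F" using i(1) sub by blast
    have "b \<ominus>\<^bsub>F\<^esub> a = i"
      unfolding i(2) by (simp add: iF a F.minus_eq F.a_assoc F.r_neg)
    moreover have "b \<in> carrier F" unfolding i(2) using iF a by (rule F.a_closed)
    ultimately show ?thesis using i(1) by simp
  qed
  show eq: "tensor_class K V W a = tensor_class K V W b"
    if "a \<in> carrier F" "b \<in> carrier F" "a \<ominus>\<^bsub>F\<^esub> b \<in> ?I" for a b
    unfolding tensor_class_def F_def[symmetric] using that sub
    by (intro F.a_coset_add_inv1 F.a_coset_join2) (auto simp: F.minus_eq intro: I.subgroup_axioms)
  show "c \<odot>\<^bsub>T\<^esub> tensor_class K V W a = tensor_class K V W (c \<odot>\<^bsub>F\<^esub> a)"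
    if c: "c \<in> carrier K" and a: "a \<in> carrier F" for c a
  proof -
    \<comment> \<open>All cosets in that union coincide: if b - a is null, so is c b - c a = c (b -
      a).\<close>
    have "tensor_class K V W (c \<odot>\<^bsub>F\<^esub> b) = tensor_class K V W (c \<odot>\<^bsub>F\<^esub> a)"
      if "b \<in> tensor_class K V W a" for b
    proof (rule eq)
      have b: "b \<in> carrier F" "b \<ominus>\<^bsub>F\<^esub> a \<in> ?I" using diff[OF a that] by auto
      have "c \<odot>\<^bsub>F\<^esub> b \<ominus>\<^bsub>F\<^esub> c \<odot>\<^bsub>F\<^esub> a = c \<odot>\<^bsub>F\<^esub> (b \<ominus>\<^bsub>F\<^esub> a)"
        by (simp add: F.minus_eq F.smult_r_distr F.smult_r_minus a b(1) c)
      then show "c \<odot>\<^bsub>F\<^esub> b \<ominus>\<^bsub>F\<^esub> c \<odot>\<^bsub>F\<^esub> a \<in> ?I"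
        using I.smult_closed[OF c b(2)] by (simp only:)
      show "c \<odot>\<^bsub>F\<^esub> b \<in> carrier F" using b c by simp
    qed (use a c in simp)
    then have "(\<Union>b\<in>tensor_class K V W a. tensor_class K V W (c \<odot>\<^bsub>F\<^esub> b)) =
        tensor_class K V W (c \<odot>\<^bsub>F\<^esub> a)"
      using self[OF a] by blast
    moreover have "c \<odot>\<^bsub>T\<^esub> tensor_class K V W a =
        (\<Union>b\<in>tensor_class K V W a. tensor_class K V W (c \<odot>\<^bsub>F\<^esub> b))"
      by (simp add: T_def tensor_def Let_def tensor_class_def flip: F_def)
    ultimately show ?thesis by (rule trans[rotated])
  qed
qed

text \<open>The quotient map is surjective and respects the operations, so each axiom descends from
  the free space.\<close>

lemma tensor_module:
  assumes "module K V" and "module K W"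
  shows "module K (tensor K V W)"
proof -
  interpret V: module K V by fact
  let ?F = "free_pairs K V W" and ?T = "tensor K V W" and ?q = "tensor_class K V W"
  interpret F: module K ?F by (rule free_pairs_module[OF V.R.is_cring])
  note q = tensor_class_props[OF assms]
  have qI: "?q a \<in> carrier ?T" if "a \<in> carrier ?F" for a
    using that q(1) by auto
  have qE: "\<exists>a. a \<in> carrier ?F \<and> t = ?q a" if "t \<in> carrier ?T" for t
    using that q(1) by auto
  show ?thesis
  proof (rule moduleI)
    show "abelian_group ?T"
    proof (rule abelian_groupI)
      fix x assume "x \<in> carrier ?T"
      then obtain a where a: "a \<in> carrier ?F" "x = ?q a" using qE by blast
      then show "\<exists>y\<in>carrier ?T. y \<oplus>\<^bsub>?T\<^esub> x = \<zero>\<^bsub>?T\<^esub>"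
        by (intro bexI[of _ "?q (\<ominus>\<^bsub>?F\<^esub> a)"]) (auto simp: q(2,3) F.l_neg intro: qI F.a_inv_closed)
    qed (auto dest!: qE simp: q(2,3) F.a_ac intro!: qI F.a_closed F.zero_closed)
  qed (auto dest!: qE simp: q(2,3,4) F.smult_l_distr F.smult_r_distr F.smult_assoc1
        V.R.is_cring intro!: qI F.smult_closed)
qed

section \<open>Pure tensors and the universal property\<close>

lemma pure_class: "pure K V W v w = tensor_class K V W (pair_gen K v w)"
  by (simp add: pure_def tensor_class_def)

lemma tensor_relsI:
  "v \<in> carrier V \<Longrightarrow> v' \<in> carrier V \<Longrightarrow> w \<in> carrier W \<Longrightarrow>
    pair_gen K (v \<oplus>\<^bsub>V\<^esub> v') w \<ominus>\<^bsub>free_pairs K V W\<^esub>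
      (pair_gen K v w \<oplus>\<^bsub>free_pairs K V W\<^esub> pair_gen K v' w) \<in> tensor_rels K V W"
  "v \<in> carrier V \<Longrightarrow> w \<in> carrier W \<Longrightarrow> w' \<in> carrier W \<Longrightarrow>
    pair_gen K v (w \<oplus>\<^bsub>W\<^esub> w') \<ominus>\<^bsub>free_pairs K V W\<^esub>
      (pair_gen K v w \<oplus>\<^bsub>free_pairs K V W\<^esub> pair_gen K v w') \<in> tensor_rels K V W"
  "c \<in> carrier K \<Longrightarrow> v \<in> carrier V \<Longrightarrow> w \<in> carrier W \<Longrightarrow>
    pair_gen K (c \<odot>\<^bsub>V\<^esub> v) w \<ominus>\<^bsub>free_pairs K V W\<^esub>
      c \<odot>\<^bsub>free_pairs K V W\<^esub> pair_gen K v w \<in> tensor_rels K V W"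
  "c \<in> carrier K \<Longrightarrow> v \<in> carrier V \<Longrightarrow> w \<in> carrier W \<Longrightarrow>
    pair_gen K v (c \<odot>\<^bsub>W\<^esub> w) \<ominus>\<^bsub>free_pairs K V W\<^esub>
      c \<odot>\<^bsub>free_pairs K V W\<^esub> pair_gen K v w \<in> tensor_rels K V W"
  unfolding tensor_rels_def Let_def by blast+

text \<open>Each of the four laws says that two formal sums have the same class, and their
  difference is one of the generating relations.\<close>

lemma pure_bilinear:
  assumes "module K V" and "module K W"
  shows "bilinear_map K V W (tensor K V W) (pure K V W)"
proof -
  interpret V: module K V by fact
  interpret W: module K W by fact
  let ?F = "free_pairs K V W"
  interpret F: module K ?F by (rule free_pairs_module[OF V.R.is_cring])
  note q = tensor_class_props[OF assms]
  note g = pair_gen_closed[OF V.R.is_cring]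
  have "tensor_rels K V W \<subseteq> tensor_null K V W"
    by (auto simp: tensor_null_def)
  then have rels: "x \<in> tensor_null K V W" if "x \<in> tensor_rels K V W" for x
    using that by auto
  show ?thesis
  proof (intro bilinear_mapI linear_mapI)
    fix v w assume vw: "v \<in> carrier V" "w \<in> carrier W"
    show "pure K V W v w \<in> carrier (tensor K V W)" by (simp add: pure_class q(1) g vw)
    then show "pure K V W v w \<in> carrier (tensor K V W)" .
    {
      fix v' assume v': "v' \<in> carrier V"
      show "pure K V W (v \<oplus>\<^bsub>V\<^esub> v') w = pure K V W v w \<oplus>\<^bsub>tensor K V W\<^esub> pure K V W v' w"
        unfolding pure_class using vw v'
        by (subst q(3)) (simp_all add: g, intro q(7) rels tensor_relsI, simp_all add: g)
    next
      fix w' assume w': "w' \<in> carrier W"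
      show "pure K V W v (w \<oplus>\<^bsub>W\<^esub> w') = pure K V W v w \<oplus>\<^bsub>tensor K V W\<^esub> pure K V W v w'"
        unfolding pure_class using vw w'
        by (subst q(3)) (simp_all add: g, intro q(7) rels tensor_relsI, simp_all add: g)
    next
      fix c assume c: "c \<in> carrier K"
      show "pure K V W (c \<odot>\<^bsub>V\<^esub> v) w = c \<odot>\<^bsub>tensor K V W\<^esub> pure K V W v w"
        unfolding pure_class using vw c
        by (subst q(4)) (simp_all add: g, intro q(7) rels tensor_relsI, simp_all add: g)
      show "pure K V W v (c \<odot>\<^bsub>W\<^esub> w) = c \<odot>\<^bsub>tensor K V W\<^esub> pure K V W v w"
        unfolding pure_class using vw c
        by (subst q(4)) (simp_all add: g, intro q(7) rels tensor_relsI, simp_all add: g)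
    }
  qed
qed

lemmas pure_closed = bilinear_mapD(3)[OF pure_bilinear]

text \<open>Zero and scalar multiples are absorbed into the pure case: c (v \<otimes> w) is (c v)
  \<otimes> w, and zero is 0 (0 \<otimes> 0).\<close>

lemma tensor_induct [consumes 3, case_names pure add]:
  assumes "module K V" and "module K W" and "t \<in> carrier (tensor K V W)"
    and pure: "\<And>v w. v \<in> carrier V \<Longrightarrow> w \<in> carrier W \<Longrightarrow> Q (pure K V W v w)"
    and add: "\<And>s t. s \<in> carrier (tensor K V W) \<Longrightarrow> t \<in> carrier (tensor K V W) \<Longrightarrow>
      Q s \<Longrightarrow> Q t \<Longrightarrow> Q (s \<oplus>\<^bsub>tensor K V W\<^esub> t)"
  shows "Q t"
proof -
  interpret V: module K V by fact
  interpret W: module K W by fact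
  note q = tensor_class_props[OF assms(1,2)]
  note g = pair_gen_closed[OF V.R.is_cring]
  note lin = linear_mapD[OF bilinear_mapD(2)[OF pure_bilinear[OF assms(1,2)]]]
  interpret T: module K "tensor K V W" by (rule tensor_module) fact+
  have smult: "c \<odot>\<^bsub>tensor K V W\<^esub> pure K V W v w = pure K V W (c \<odot>\<^bsub>V\<^esub> v) w"
    if "c \<in> carrier K" "v \<in> carrier V" "w \<in> carrier W" for c v w
    using lin(3) that by metis
  obtain a where a: "a \<in> carrier (free_pairs K V W)" "t = tensor_class K V W a"
    using assms(3) q(1) by auto
  have "Q (tensor_class K V W a)"
    using V.R.is_cring a(1)
  proof (induction a rule: free_pairs_induct)
    case zero
    have "tensor_class K V W \<zero>\<^bsub>free_pairs K V W\<^esub> = \<zero>\<^bsub>K\<^esub> \<odot>\<^bsub>tensor K V W\<^esub> pure K V W \<zero>\<^bsub>V\<^esub> \<zero>\<^bsub>W\<^esub>"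
      by (simp add: pure_closed[OF assms(1,2)] flip: q(2))
    then show ?case using pure by (simp add: smult)
  next
    case (gen c v w)
    then show ?case by (simp add: g pure smult flip: q(4) pure_class)
  next
    case (add a b)
    then show ?case using q(1) by (auto intro!: assms(5) simp flip: q(3))
  qed
  then show ?thesis using a(2) by simp
qed

text \<open>The principal tool for identities between tensors below; the linearity of the two sides
  is its real premise and must be prepared beforehand.\<close>

lemma tensor_linear_eqI:
  assumes "module K V" and "module K W"
    and "linear_map K (tensor K V W) U f" and "linear_map K (tensor K V W) U g"
    and "\<And>v w. v \<in> carrier V \<Longrightarrow> w \<in> carrier W \<Longrightarrow> f (pure K V W v w) = g (pure K V W v w)"
    and "t \<in> carrier (tensor K V W)"
  shows "f t = g t"
  using assms(1,2,6)
  by (induction t rule: tensor_induct) (simp_all add: assms(5) linear_mapD[OF assms(3)] linear_mapD[OF assms(4)])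

text \<open>The universal property. The linear extension \<Phi> of \<beta> to formal sums kills the
  relations, and its kernel is a submodule, so the kernel contains \<open>tensor_null\<close>. Hence
  \<Phi> is constant on each coset, and \<open>the_elem\<close> is applied to a singleton.\<close>

lemma tensor_lift:
  assumes "module K V" and "module K W" and "module K U" and "bilinear_map K V W U \<beta>"
  shows "linear_map K (tensor K V W) U (tensor_lift K V W U \<beta>)" (is ?lin)
    and "v \<in> carrier V \<Longrightarrow> w \<in> carrier W \<Longrightarrow> tensor_lift K V W U \<beta> (pure K V W v w) = \<beta> v w"
proof -
  interpret V: module K V by fact
  interpret W: module K W by fact
  interpret U: module K U by fact
  let ?F = "free_pairs K V W"
  interpret F: module K ?F by (rule free_pairs_module[OF V.R.is_cring])
  note q = tensor_class_props[OF assms(1,2)]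
  note g = pair_gen_closed[OF V.R.is_cring]
  note \<beta> = bilinear_mapD[OF assms(4)]
  define \<Phi> where "\<Phi> a = (\<Oplus>\<^bsub>U\<^esub> p \<in> {p. a p \<noteq> \<zero>\<^bsub>K\<^esub>}. a p \<odot>\<^bsub>U\<^esub> \<beta> (fst p) (snd p))" for a
  \<comment> \<open>Sums over different supports, such as those of a, b and a + b, become comparable
    once taken over a common finite set.\<close>
  have \<Phi>_eq: "\<Phi> a = (\<Oplus>\<^bsub>U\<^esub> p \<in> S. a p \<odot>\<^bsub>U\<^esub> \<beta> (fst p) (snd p))"
    if "{p. a p \<noteq> \<zero>\<^bsub>K\<^esub>} \<subseteq> S" "finite S" "S \<subseteq> carrier V \<times> carrier W" "a \<in> carrier ?F" for a S
  proof -
    have "\<beta> (fst p) (snd p) \<in> carrier U" if "p \<in> S" for p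
      using that \<open>S \<subseteq> _\<close> by (intro \<beta>(3)) (auto simp: mem_Times_iff)
    moreover have "a p \<in> carrier K" for p
      using \<open>a \<in> _\<close> by (cases p) (simp add: mem_free_pairs)
    ultimately show ?thesis
      unfolding \<Phi>_def using that(1,2)
      by (intro U.add.finprod_mono_neutral_cong_left) auto
  qed
  have \<Phi>_closed: "\<Phi> a \<in> carrier U" if "a \<in> carrier ?F" for a
    unfolding \<Phi>_def using that by (intro U.finsum_closed) (auto simp: mem_free_pairs intro!: \<beta>(3))
  have \<Phi>_add: "\<Phi> (a \<oplus>\<^bsub>?F\<^esub> b) = \<Phi> a \<oplus>\<^bsub>U\<^esub> \<Phi> b" if ab: "a \<in> carrier ?F" "b \<in> carrier ?F" for a b
  proof -
    let ?S = "{p. a p \<noteq> \<zero>\<^bsub>K\<^esub>} \<union> {p. b p \<noteq> \<zero>\<^bsub>K\<^esub>}"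
    have S: "finite ?S" "?S \<subseteq> carrier V \<times> carrier W"
      using ab by (auto simp: mem_free_pairs)
    have "\<Phi> (a \<oplus>\<^bsub>?F\<^esub> b) = (\<Oplus>\<^bsub>U\<^esub> p \<in> ?S. (a \<oplus>\<^bsub>?F\<^esub> b) p \<odot>\<^bsub>U\<^esub> \<beta> (fst p) (snd p))"
      by (rule \<Phi>_eq[OF _ S]) (use ab in \<open>auto simp: free_pairs_simps intro: F.a_closed[unfolded free_pairs_simps]\<close>)
    also have "\<dots> = (\<Oplus>\<^bsub>U\<^esub> p \<in> ?S. a p \<odot>\<^bsub>U\<^esub> \<beta> (fst p) (snd p) \<oplus>\<^bsub>U\<^esub> b p \<odot>\<^bsub>U\<^esub> \<beta> (fst p) (snd p))"
      using ab S by (intro U.finsum_cong')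
        (auto simp: free_pairs_simps mem_free_pairs intro!: U.smult_l_distr \<beta>(3) U.smult_closed U.a_closed)
    also have "\<dots> = (\<Oplus>\<^bsub>U\<^esub> p \<in> ?S. a p \<odot>\<^bsub>U\<^esub> \<beta> (fst p) (snd p)) \<oplus>\<^bsub>U\<^esub>
        (\<Oplus>\<^bsub>U\<^esub> p \<in> ?S. b p \<odot>\<^bsub>U\<^esub> \<beta> (fst p) (snd p))"
      using ab S by (intro U.finsum_addf) (auto simp: mem_free_pairs intro!: \<beta>(3) U.smult_closed)
    also have "\<dots> = \<Phi> a \<oplus>\<^bsub>U\<^esub> \<Phi> b"
      using \<Phi>_eq[OF _ S ab(1)] \<Phi>_eq[OF _ S ab(2)] by auto
    finally show ?thesis .
  qed
  have \<Phi>_smult: "\<Phi> (c \<odot>\<^bsub>?F\<^esub> a) = c \<odot>\<^bsub>U\<^esub> \<Phi> a" if c: "c \<in> carrier K" and a: "a \<in> carrier ?F" for a c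
  proof -
    let ?S = "{p. a p \<noteq> \<zero>\<^bsub>K\<^esub>}"
    have S: "finite ?S" "?S \<subseteq> carrier V \<times> carrier W"
      using a by (auto simp: mem_free_pairs)
    have "\<Phi> (c \<odot>\<^bsub>?F\<^esub> a) = (\<Oplus>\<^bsub>U\<^esub> p \<in> ?S. (c \<odot>\<^bsub>?F\<^esub> a) p \<odot>\<^bsub>U\<^esub> \<beta> (fst p) (snd p))"
      by (rule \<Phi>_eq[OF _ S F.smult_closed[OF c a]]) (use c in \<open>auto simp: free_pairs_simps\<close>)
    also have "\<dots> = (\<Oplus>\<^bsub>U\<^esub> p \<in> ?S. c \<odot>\<^bsub>U\<^esub> (a p \<odot>\<^bsub>U\<^esub> \<beta> (fst p) (snd p)))"
      using a c S by (intro U.finsum_cong')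
        (auto simp: free_pairs_simps mem_free_pairs intro!: U.smult_assoc1 \<beta>(3) U.smult_closed)
    also have "\<dots> = c \<odot>\<^bsub>U\<^esub> \<Phi> a"
      unfolding \<Phi>_def using a c S
      by (intro U.finsum_smult_ldistr[symmetric]) (auto simp: mem_free_pairs intro!: \<beta>(3) U.smult_closed)
    finally show ?thesis .
  qed
  have \<Phi>_gen: "\<Phi> (pair_gen K v w) = \<beta> v w" if "v \<in> carrier V" "w \<in> carrier W" for v w
  proof -
    have "\<Phi> (pair_gen K v w) = (\<Oplus>\<^bsub>U\<^esub> p \<in> {(v, w)}. pair_gen K v w p \<odot>\<^bsub>U\<^esub> \<beta> (fst p) (snd p))"
      by (rule \<Phi>_eq) (use that g in \<open>auto simp: pair_gen_def\<close>)
    also have "\<dots> = \<beta> v w"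
      using \<beta>(3) that by (simp add: pair_gen_def)
    finally show ?thesis .
  qed
  \<comment> \<open>Relations are differences, so \<Phi> must respect subtraction. Homogeneity
    provides this, since - b = (-1) b.\<close>
  have \<Phi>_diff: "\<Phi> (a \<ominus>\<^bsub>?F\<^esub> b) = \<Phi> a \<ominus>\<^bsub>U\<^esub> \<Phi> b" if ab: "a \<in> carrier ?F" "b \<in> carrier ?F" for a b
  proof -
    have "\<ominus>\<^bsub>?F\<^esub> b = (\<ominus>\<^bsub>K\<^esub> \<one>\<^bsub>K\<^esub>) \<odot>\<^bsub>?F\<^esub> b" using ab by (simp add: F.smult_l_minus)
    then have "\<Phi> (\<ominus>\<^bsub>?F\<^esub> b) = \<ominus>\<^bsub>U\<^esub> \<Phi> b"
      using ab \<Phi>_closed by (simp add: \<Phi>_smult U.smult_l_minus)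
    then show ?thesis using ab by (simp add: F.minus_eq U.minus_eq \<Phi>_add)
  qed
  have \<Phi>_diff_zero: "\<Phi> (a \<ominus>\<^bsub>?F\<^esub> b) = \<zero>\<^bsub>U\<^esub>" if "a \<in> carrier ?F" "b \<in> carrier ?F" "\<Phi> a = \<Phi> b" for a b
    using that \<Phi>_closed by (simp add: \<Phi>_diff U.minus_eq U.r_neg)
  let ?Z = "{a \<in> carrier ?F. \<Phi> a = \<zero>\<^bsub>U\<^esub>}"
  have \<Phi>_zero: "\<Phi> \<zero>\<^bsub>?F\<^esub> = \<zero>\<^bsub>U\<^esub>"
    by (simp add: \<Phi>_def free_pairs_simps)
  have "submodule ?Z K ?F"
  proof (rule F.submoduleI)
    fix a assume a: "a \<in> ?Z"
    then have "\<Phi> (\<zero>\<^bsub>?F\<^esub> \<ominus>\<^bsub>?F\<^esub> a) = \<zero>\<^bsub>U\<^esub>" using \<Phi>_zero by (intro \<Phi>_diff_zero) auto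
    then show "\<ominus>\<^bsub>?F\<^esub> a \<in> ?Z" using a by (simp add: F.minus_eq)
  qed (use \<Phi>_zero \<Phi>_add \<Phi>_smult in auto)
  moreover have "tensor_rels K V W \<subseteq> ?Z"
  proof -
    have "x \<in> ?Z" if "x \<in> tensor_rels K V W" for x
    proof -
      \<comment> \<open>Each kind of relation is a difference of two sums on which \<Phi> agrees by
        one of the four bilinearity laws of \<beta>.\<close>
      have "\<Phi> x = \<zero>\<^bsub>U\<^esub>"
        using that unfolding tensor_rels_def Let_def
        by (elim UnE CollectE exE conjE; hypsubst; intro \<Phi>_diff_zero)
           (simp_all add: \<Phi>_add \<Phi>_smult \<Phi>_gen g linear_mapD[OF \<beta>(1)] linear_mapD[OF \<beta>(2)])
      then show ?thesis using tensor_rels_subset[OF assms(1,2)] that by auto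
    qed
    then show ?thesis by blast
  qed
  ultimately have null: "tensor_null K V W \<subseteq> ?Z"
    by (auto simp: tensor_null_def)
  have lift: "tensor_lift K V W U \<beta> (tensor_class K V W a) = \<Phi> a" if a: "a \<in> carrier ?F" for a
  proof -
    have "\<Phi> b = \<Phi> a" if "b \<in> tensor_class K V W a" for b
    proof -
      have b: "b \<in> carrier ?F" using q(6)[OF a that] by blast
      have "b \<ominus>\<^bsub>?F\<^esub> a \<in> ?Z" using q(6)[OF a that] null by blast
      then have "\<Phi> b \<ominus>\<^bsub>U\<^esub> \<Phi> a = \<zero>\<^bsub>U\<^esub>" using \<Phi>_diff[OF b a] by simp
      then show ?thesis using \<Phi>_closed[OF a] \<Phi>_closed[OF b]
        using U.minus_equality[of "\<Phi> b" "\<ominus>\<^bsub>U\<^esub> \<Phi> a"] by (simp add: U.minus_eq)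
    qed
    then have "\<Phi> ` tensor_class K V W a = (\<lambda>_. \<Phi> a) ` tensor_class K V W a"
      by (rule image_cong[OF refl])
    \<comment> \<open>The coset is nonempty, since it contains a; with constancy this makes the
      image a singleton.\<close>
    also have "\<dots> = {\<Phi> a}" using q(5)[OF a] by (rule image_constant)
    finally have "the_elem (\<Phi> ` tensor_class K V W a) = \<Phi> a" by simp
    moreover have "tensor_lift K V W U \<beta> (tensor_class K V W a) = the_elem (\<Phi> ` tensor_class K V W a)"
      using a by (simp add: tensor_lift_def q(1) \<Phi>_def[abs_def])
    ultimately show ?thesis by simp
  qed
  show ?lin
    by (rule linear_mapI) (auto simp: q(1,3,4) lift \<Phi>_closed \<Phi>_add \<Phi>_smult)
  show "v \<in> carrier V \<Longrightarrow> w \<in> carrier W \<Longrightarrow> tensor_lift K V W U \<beta> (pure K V W v w) = \<beta> v w"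
    by (simp add: pure_class lift g \<Phi>_gen)
qed

lemma tensor_lift_extensional: "tensor_lift K V W U \<beta> \<in> extensional (carrier (tensor K V W))"
  by (simp add: tensor_lift_def)

text \<open>The construction depends on its first factor only through these three fields. A comodule
  and its underlying space therefore give literally the same tensor product, although they are
  different records.\<close>

lemma tensor_cong:
  assumes "carrier V = carrier V'" and "add V = add V'" and "smult V = smult V'"
  shows "tensor K V W = tensor K V' W" and "pure K V W = pure K V' W"
proof -
  have F: "free_pairs K V W = free_pairs K V' W" by (simp add: free_pairs_def assms)
  have "tensor_rels K V W = tensor_rels K V' W" by (simp add: tensor_rels_def F assms)
  then have N: "tensor_null K V W = tensor_null K V' W" by (simp add: tensor_null_def F)
  show "tensor K V W = tensor K V' W" by (simp add: tensor_def F N)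
  show "pure K V W = pure K V' W" by (simp add: pure_def fun_eq_iff F N)
qed

section \<open>Functoriality and associativity\<close>

lemma tensor_map:
  assumes "module K V" and "module K W" and "module K V'" and "module K W'"
    and "linear_map K V V' f" and "linear_map K W W' g"
  shows "linear_map K (tensor K V W) (tensor K V' W') (tensor_map K V W V' W' f g)"
    and "v \<in> carrier V \<Longrightarrow> w \<in> carrier W \<Longrightarrow>
      tensor_map K V W V' W' f g (pure K V W v w) = pure K V' W' (f v) (g w)"
  unfolding tensor_map_def
  by (rule tensor_lift[OF assms(1,2) tensor_module[OF assms(3,4)]
        bilinear_map_comp[OF pure_bilinear[OF assms(3,4)] assms(5,6)]])+

text \<open>The condition on f is restricted to the carrier in order to cover restricted
  identities.\<close>

lemma tensor_map_id:
  assumes "module K V" and "module K W" and "t \<in> carrier (tensor K V W)"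
    and "\<And>v. v \<in> carrier V \<Longrightarrow> f v = v"
  shows "tensor_map K V W V W f (\<lambda>w. w) t = t"
proof (rule tensor_linear_eqI[OF assms(1,2) _ linear_map_id _ assms(3)])
  have f: "linear_map K V V f"
    using linear_map_cong[OF assms(1), of f "\<lambda>v. v"] assms(4) linear_map_id by blast
  show "linear_map K (tensor K V W) (tensor K V W) (tensor_map K V W V W f (\<lambda>w. w))"
    by (rule tensor_map(1)[OF assms(1,2,1,2) f linear_map_id])
  show "tensor_map K V W V W f (\<lambda>w. w) (pure K V W v w) = pure K V W v w"
    if "v \<in> carrier V" "w \<in> carrier W" for v w
    using tensor_map(2)[OF assms(1,2,1,2) f linear_map_id that] assms(4) that(1) by simp
qed

text \<open>The composite enters as a function h known on the carrier, since composites of morphisms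
  are restricted functions.\<close>

lemma tensor_map_comp:
  assumes "module K V" and "module K V'" and "module K V''" and "module K W"
    and "linear_map K V V' f" and "linear_map K V' V'' g" and "t \<in> carrier (tensor K V W)"
    and h: "\<And>v. v \<in> carrier V \<Longrightarrow> h v = g (f v)"
  shows "tensor_map K V' W V'' W g (\<lambda>w. w) (tensor_map K V W V' W f (\<lambda>w. w) t) =
    tensor_map K V W V'' W h (\<lambda>w. w) t"
proof -
  have hl: "linear_map K V V'' h"
    using linear_map_cong[OF assms(1), of h "\<lambda>v. g (f v)"] h linear_map_comp[OF assms(5,6)] by blast
  note tf = tensor_map[OF assms(1,4,2,4,5) linear_map_id]
  note tg = tensor_map[OF assms(2,4,3,4,6) linear_map_id]
  note th = tensor_map[OF assms(1,4,3,4) hl linear_map_id]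
  show ?thesis
  proof (rule tensor_linear_eqI[OF assms(1,4) linear_map_comp[OF tf(1) tg(1)] th(1) _ assms(7)])
    fix v w assume v: "v \<in> carrier V" and w: "w \<in> carrier W"
    then have "f v \<in> carrier V'" using linear_mapD(1)[OF assms(5)] by blast
    then show "tensor_map K V' W V'' W g (\<lambda>w. w) (tensor_map K V W V' W f (\<lambda>w. w) (pure K V W v w)) =
        tensor_map K V W V'' W h (\<lambda>w. w) (pure K V W v w)"
      using v w by (simp add: tf(2) tg(2) th(2) h)
  qed
qed

lemma tensor_map_smult:
  assumes "module K V" and "module K W" and "c \<in> carrier K" and "t \<in> carrier (tensor K V W)"
  shows "tensor_map K V W V W (\<lambda>v. c \<odot>\<^bsub>V\<^esub> v) (\<lambda>w. w) t = c \<odot>\<^bsub>tensor K V W\<^esub> t"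
proof -
  note T = tensor_module[OF assms(1,2)]
  note l = linear_map_smult[OF assms(1,1) linear_map_id assms(3)]
  note m = tensor_map[OF assms(1,2,1,2) l linear_map_id]
  note p = linear_mapD(3)[OF bilinear_mapD(2)[OF pure_bilinear[OF assms(1,2)]]]
  show ?thesis
    by (rule tensor_linear_eqI[OF assms(1,2) m(1) linear_map_smult[OF T T linear_map_id assms(3)] _ assms(4)])
       (simp add: m(2) p assms(3))
qed

text \<open>The inner lift \<gamma> has w as a parameter, and the outer lift can be evaluated only
  if it is bilinear in t and w. Linearity in w is an identity between linear maps in t, hence is
  tested on pure t.\<close>

lemma tensor_assoc_pure:
  assumes "module K U" and "module K V" and "module K W"
    and "u \<in> carrier U" and "v \<in> carrier V" and "w \<in> carrier W"
  shows "tensor_assoc K U V W (pure K (tensor K U V) W (pure K U V u v) w) =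
    pure K U (tensor K V W) u (pure K V W v w)"
proof -
  let ?T = "tensor K U (tensor K V W)"
  define \<gamma> where "\<gamma> w = tensor_lift K U V ?T (\<lambda>u v. pure K U (tensor K V W) u (pure K V W v w))" for w
  note VW = tensor_module[OF assms(2,3)] and UV = tensor_module[OF assms(1,2)]
  note T = tensor_module[OF assms(1) VW]
  note pVW = pure_bilinear[OF assms(2,3)] and pT = pure_bilinear[OF assms(1) VW]
  have bil: "bilinear_map K U V ?T (\<lambda>u v. pure K U (tensor K V W) u (pure K V W v w))"
    if "w \<in> carrier W" for w
    by (rule bilinear_map_comp[OF pT linear_map_id bilinear_mapD(2)[OF pVW that]])
  note \<gamma> = tensor_lift[OF assms(1,2) T bil, folded \<gamma>_def]
  interpret W: module K W by fact
  have "bilinear_map K (tensor K U V) W ?T (\<lambda>t w. \<gamma> w t)"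
  proof (rule bilinear_mapI)
    show "linear_map K (tensor K U V) ?T (\<gamma> w)" if "w \<in> carrier W" for w
      using \<gamma>(1)[OF that] .
    fix t assume t: "t \<in> carrier (tensor K U V)"
    show "linear_map K W ?T (\<lambda>w. \<gamma> w t)"
    proof (rule linear_mapI)
      show "\<gamma> w t \<in> carrier ?T" if "w \<in> carrier W" for w
        using linear_mapD(1)[OF \<gamma>(1)[OF that] t] .
      show "\<gamma> (w \<oplus>\<^bsub>W\<^esub> w') t = \<gamma> w t \<oplus>\<^bsub>?T\<^esub> \<gamma> w' t" if "w \<in> carrier W" "w' \<in> carrier W" for w w'
        by (rule tensor_linear_eqI[OF assms(1,2) \<gamma>(1) linear_map_add[OF UV T \<gamma>(1) \<gamma>(1)] _ t])
           (simp_all add: that \<gamma>(2) linear_mapD[OF bilinear_mapD(1)[OF pVW]]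
              linear_mapD[OF bilinear_mapD(1)[OF pT]] pure_closed[OF assms(2,3)])
      show "\<gamma> (c \<odot>\<^bsub>W\<^esub> w) t = c \<odot>\<^bsub>?T\<^esub> \<gamma> w t" if "c \<in> carrier K" "w \<in> carrier W" for c w
        by (rule tensor_linear_eqI[OF assms(1,2) \<gamma>(1) linear_map_smult[OF UV T \<gamma>(1)] _ t])
           (simp_all add: that \<gamma>(2) linear_mapD[OF bilinear_mapD(1)[OF pVW]]
              linear_mapD[OF bilinear_mapD(1)[OF pT]] pure_closed[OF assms(2,3)])
    qed
  qed
  from tensor_lift(2)[OF UV assms(3) T this pure_closed[OF assms(1,2,4,5)] assms(6)]
  show ?thesis
    using \<gamma>(2)[OF assms(6,4,5)] by (simp add: tensor_assoc_def Let_def \<gamma>_def)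
qed

section \<open>Products in Sweedler notation\<close>

lemma assoc_algebraD:
  assumes "assoc_algebra K H"
  shows "module K H" and "ring H" and "bilinear_map K H H H (\<lambda>x y. x \<otimes>\<^bsub>H\<^esub> y)"
proof -
  show "module K H" "ring H" using assms by (auto simp: assoc_algebra_def)
  then interpret ring H by simp
  show "bilinear_map K H H H (\<lambda>x y. x \<otimes>\<^bsub>H\<^esub> y)"
    using assms by (intro bilinear_mapI linear_mapI) (auto simp: assoc_algebra_def l_distr r_distr)
qed

text \<open>Two lifts are nested: the inner one in t with parameters m and h, the outer one in s
  with parameter t. Bilinearity in m and h is tested on pure t; linearity in t is then tested on
  pure s.\<close>

lemma sweedler_prod:
  assumes "assoc_algebra K H" and "module K M" and "module K N" and "module K P"
    and "bilinear_map K M N P \<beta>"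
  shows "bilinear_map K (tensor K M H) (tensor K N H) (tensor K P H) (sweedler_prod K H M N P \<beta>)"
    and "m \<in> carrier M \<Longrightarrow> h \<in> carrier H \<Longrightarrow> n \<in> carrier N \<Longrightarrow> k \<in> carrier H \<Longrightarrow>
      sweedler_prod K H M N P \<beta> (pure K M H m h) (pure K N H n k) =
        pure K P H (\<beta> m n) (h \<otimes>\<^bsub>H\<^esub> k)"
proof -
  note H = assoc_algebraD[OF assms(1)]
  let ?T = "tensor K P H"
  note T = tensor_module[OF assms(4) H(1)] and MH = tensor_module[OF assms(2) H(1)]
    and NH = tensor_module[OF assms(3) H(1)]
  note p = pure_bilinear[OF assms(4) H(1)]
  interpret M: module K M by fact
  interpret H: module K H by (rule H(1))
  define \<gamma> where "\<gamma> m h = tensor_lift K N H ?T (\<lambda>n k. pure K P H (\<beta> m n) (h \<otimes>\<^bsub>H\<^esub> k))" for m h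
  have bil: "bilinear_map K N H ?T (\<lambda>n k. pure K P H (\<beta> m n) (h \<otimes>\<^bsub>H\<^esub> k))"
    if "m \<in> carrier M" "h \<in> carrier H" for m h
    using that by (intro bilinear_map_comp[OF p] bilinear_mapD(1)[OF assms(5)] bilinear_mapD(1)[OF H(3)])
  note \<gamma> = tensor_lift[OF assms(3) H(1) T bil, folded \<gamma>_def]
  note simps = \<gamma>(2) linear_mapD[OF bilinear_mapD(2)[OF assms(5)]] linear_mapD[OF bilinear_mapD(2)[OF H(3)]]
    linear_mapD[OF bilinear_mapD(1)[OF p]] linear_mapD[OF bilinear_mapD(2)[OF p]]
  have outer: "bilinear_map K M H ?T (\<lambda>m h. \<gamma> m h t)" if t: "t \<in> carrier (tensor K N H)" for t
  proof (intro bilinear_mapI linear_mapI)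
    fix m h assume m: "m \<in> carrier M" and h: "h \<in> carrier H"
    show "\<gamma> m h t \<in> carrier ?T" using linear_mapD(1)[OF \<gamma>(1)[OF m h] t] .
    then show "\<gamma> m h t \<in> carrier ?T" .
    show "\<gamma> (m \<oplus>\<^bsub>M\<^esub> m') h t = \<gamma> m h t \<oplus>\<^bsub>?T\<^esub> \<gamma> m' h t" if m': "m' \<in> carrier M" for m'
      by (rule tensor_linear_eqI[OF assms(3) H(1) \<gamma>(1) linear_map_add[OF NH T \<gamma>(1) \<gamma>(1)] _ t])
         (simp_all add: m m' h simps)
    show "\<gamma> m (h \<oplus>\<^bsub>H\<^esub> h') t = \<gamma> m h t \<oplus>\<^bsub>?T\<^esub> \<gamma> m h' t" if h': "h' \<in> carrier H" for h'
      by (rule tensor_linear_eqI[OF assms(3) H(1) \<gamma>(1) linear_map_add[OF NH T \<gamma>(1) \<gamma>(1)] _ t])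
         (simp_all add: m h' h simps)
    show "\<gamma> (c \<odot>\<^bsub>M\<^esub> m) h t = c \<odot>\<^bsub>?T\<^esub> \<gamma> m h t" if c: "c \<in> carrier K" for c
      by (rule tensor_linear_eqI[OF assms(3) H(1) \<gamma>(1) linear_map_smult[OF NH T \<gamma>(1)] _ t])
         (simp_all add: m c h simps)
    show "\<gamma> m (c \<odot>\<^bsub>H\<^esub> h) t = c \<odot>\<^bsub>?T\<^esub> \<gamma> m h t" if c: "c \<in> carrier K" for c
      by (rule tensor_linear_eqI[OF assms(3) H(1) \<gamma>(1) linear_map_smult[OF NH T \<gamma>(1)] _ t])
         (simp_all add: m c h simps)
  qed
  have S: "sweedler_prod K H M N P \<beta> s t = tensor_lift K M H ?T (\<lambda>m h. \<gamma> m h t) s" for s t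
    by (simp add: sweedler_prod_def \<gamma>_def)
  note S1 = tensor_lift[OF assms(2) H(1) T outer, folded S]
  show "sweedler_prod K H M N P \<beta> (pure K M H m h) (pure K N H n k) = pure K P H (\<beta> m n) (h \<otimes>\<^bsub>H\<^esub> k)"
    if "m \<in> carrier M" "h \<in> carrier H" "n \<in> carrier N" "k \<in> carrier H" for m h n k
    using that by (simp add: S1(2) pure_closed[OF assms(3) H(1)] \<gamma>(2))
  show "bilinear_map K (tensor K M H) (tensor K N H) ?T (sweedler_prod K H M N P \<beta>)"
  proof (rule bilinear_mapI)
    show l: "linear_map K (tensor K M H) ?T (\<lambda>s. sweedler_prod K H M N P \<beta> s t)"
      if "t \<in> carrier (tensor K N H)" for t
      using S1(1)[OF that] by (simp add: S)
    fix s assume s: "s \<in> carrier (tensor K M H)"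
    show "linear_map K (tensor K N H) ?T (sweedler_prod K H M N P \<beta> s)"
    proof (rule linear_mapI)
      interpret NH: module K "tensor K N H" by (rule NH)
      fix t assume t: "t \<in> carrier (tensor K N H)"
      show "sweedler_prod K H M N P \<beta> s t \<in> carrier ?T" using linear_mapD(1)[OF l[OF t] s] .
      show "sweedler_prod K H M N P \<beta> s (c \<odot>\<^bsub>tensor K N H\<^esub> t) =
          c \<odot>\<^bsub>?T\<^esub> sweedler_prod K H M N P \<beta> s t" if c: "c \<in> carrier K" for c
        by (rule tensor_linear_eqI[OF assms(2) H(1) l linear_map_smult[OF MH T l] _ s])
           (simp_all add: S1(2) t c linear_mapD[OF \<gamma>(1)])
      fix t' assume t': "t' \<in> carrier (tensor K N H)"
      show "sweedler_prod K H M N P \<beta> s (t \<oplus>\<^bsub>tensor K N H\<^esub> t') =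
          sweedler_prod K H M N P \<beta> s t \<oplus>\<^bsub>?T\<^esub> sweedler_prod K H M N P \<beta> s t'"
        by (rule tensor_linear_eqI[OF assms(2) H(1) l linear_map_add[OF MH T l l] _ s])
           (simp_all add: S1(2) t t' linear_mapD[OF \<gamma>(1)])
    qed
  qed
qed

text \<open>Both sides are bilinear in s and t, so one variable after the other is made pure; what
  remains is e (\<beta> m n) \<otimes> h k = \<beta>' (f m) (g n) \<otimes> h k. This is the source
  of colinearity for tensor products of colinear maps.\<close>

lemma sweedler_prod_natural:
  assumes "assoc_algebra K H" and "module K M" and "module K N" and "module K P"
    and "module K M'" and "module K N'" and "module K P'"
    and "bilinear_map K M N P \<beta>" and "bilinear_map K M' N' P' \<beta>'"
    and "linear_map K M M' f" and "linear_map K N N' g" and "linear_map K P P' e"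
    and e: "\<And>m n. m \<in> carrier M \<Longrightarrow> n \<in> carrier N \<Longrightarrow> e (\<beta> m n) = \<beta>' (f m) (g n)"
    and s: "s \<in> carrier (tensor K M H)" and t: "t \<in> carrier (tensor K N H)"
  shows "tensor_map K P H P' H e (\<lambda>h. h) (sweedler_prod K H M N P \<beta> s t) =
    sweedler_prod K H M' N' P' \<beta>' (tensor_map K M H M' H f (\<lambda>h. h) s)
      (tensor_map K N H N' H g (\<lambda>h. h) t)"
proof -
  note H = assoc_algebraD[OF assms(1)]
  note S = sweedler_prod[OF assms(1,2,3,4,8)] and S' = sweedler_prod[OF assms(1,5,6,7,9)]
  note tf = tensor_map[OF assms(2) H(1) assms(5) H(1) assms(10) linear_map_id]
  note tg = tensor_map[OF assms(3) H(1) assms(6) H(1) assms(11) linear_map_id]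
  note te = tensor_map[OF assms(4) H(1) assms(7) H(1) assms(12) linear_map_id]
  note fl = linear_mapD(1)[OF assms(10)] and gl = linear_mapD(1)[OF assms(11)]
  note B = bilinear_map_comp[OF S'(1) tf(1) tg(1)]
  show ?thesis
  proof (rule tensor_linear_eqI[OF assms(2) H(1)
        linear_map_comp[OF bilinear_mapD(2)[OF S(1) t] te(1)] bilinear_mapD(2)[OF B t] _ s])
    fix m h assume m: "m \<in> carrier M" and h: "h \<in> carrier H"
    note p = pure_closed[OF assms(2) H(1) m h]
    show "tensor_map K P H P' H e (\<lambda>h. h) (sweedler_prod K H M N P \<beta> (pure K M H m h) t) =
      sweedler_prod K H M' N' P' \<beta>' (tensor_map K M H M' H f (\<lambda>h. h) (pure K M H m h))
        (tensor_map K N H N' H g (\<lambda>h. h) t)"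
    proof (rule tensor_linear_eqI[OF assms(3) H(1)
        linear_map_comp[OF bilinear_mapD(1)[OF S(1) p] te(1)] bilinear_mapD(1)[OF B p] _ t])
      fix n k assume n: "n \<in> carrier N" and k: "k \<in> carrier H"
      then show "tensor_map K P H P' H e (\<lambda>h. h)
          (sweedler_prod K H M N P \<beta> (pure K M H m h) (pure K N H n k)) =
        sweedler_prod K H M' N' P' \<beta>' (tensor_map K M H M' H f (\<lambda>h. h) (pure K M H m h))
          (tensor_map K N H N' H g (\<lambda>h. h) (pure K N H n k))"
        using m h by (simp add: S(2) S'(2) tf(2) tg(2) te(2) fl gl e bilinear_mapD(3)[OF assms(8)]
            bilinear_mapD(3)[OF H(3)])
    qed
  qed
qed


section \<open>Comodules\<close>

lemma comoduleD:
  assumes "comodule K H M"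
  shows "module K M" and "linear_map K M (tensor K M H) (coact M)"
  using assms unfolding comodule_def by blast+

lemma hopf_algebraD:
  assumes "hopf_algebra K H"
  shows "assoc_algebra K H" and "bialgebra K H"
  using assms unfolding hopf_algebra_def bialgebra_def by blast+

text \<open>Coassociativity reads m \<otimes> (1 \<otimes> 1) on both sides because \<Delta> 1 = 1
  \<otimes> 1, and the counit law holds because \<epsilon> 1 = 1. Its purpose is to make K a
  comodule.\<close>

lemma comodule_trivial:
  assumes "bialgebra K H" and "module K M"
    and M: "\<And>m. m \<in> carrier M \<Longrightarrow> coact M m = pure K M H m \<one>\<^bsub>H\<^esub>"
  shows "comodule K H M"
proof -
  have alg: "assoc_algebra K H" and coalg: "coalgebra K H"
    and one: "comult H \<one>\<^bsub>H\<^esub> = pure K H H \<one>\<^bsub>H\<^esub> \<one>\<^bsub>H\<^esub>" "counit H \<one>\<^bsub>H\<^esub> = \<one>\<^bsub>K\<^esub>"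
    using assms(1) unfolding bialgebra_def by blast+
  have \<Delta>: "linear_map K H (tensor K H H) (comult H)"
    using coalg unfolding coalgebra_def by blast
  note H = assoc_algebraD[OF alg]
  interpret H: ring H by (rule H(2))
  interpret M: module K M by fact
  have c: "linear_map K M (tensor K M H) (coact M)"
    using bilinear_mapD(2)[OF pure_bilinear[OF assms(2) H(1)] H.one_closed]
    by (simp add: linear_map_cong[OF assms(2), of "coact M" "\<lambda>m. pure K M H m \<one>\<^bsub>H\<^esub>"] M)
  have \<epsilon>_lin: "\<And>a. a \<in> carrier H \<Longrightarrow> counit H a \<in> carrier K"
    "\<And>a b. a \<in> carrier H \<Longrightarrow> b \<in> carrier H \<Longrightarrow> counit H (a \<oplus>\<^bsub>H\<^esub> b) = counit H a \<oplus>\<^bsub>K\<^esub> counit H b"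
    "\<And>c a. c \<in> carrier K \<Longrightarrow> a \<in> carrier H \<Longrightarrow> counit H (c \<odot>\<^bsub>H\<^esub> a) = c \<otimes>\<^bsub>K\<^esub> counit H a"
    using coalg unfolding coalgebra_def by blast+
  \<comment> \<open>The counit law is phrased through \<open>tensor_lift\<close>, whose value on
    pure tensors is available only for a bilinear map.\<close>
  have \<epsilon>: "bilinear_map K M H M (\<lambda>n h. counit H h \<odot>\<^bsub>M\<^esub> n)"
  proof (rule bilinear_mapI)
    fix m assume m: "m \<in> carrier M"
    show "linear_map K H M (\<lambda>h. counit H h \<odot>\<^bsub>M\<^esub> m)"
      using m by (intro linear_mapI) (simp_all add: \<epsilon>_lin M.smult_l_distr M.smult_assoc1)
  next
    fix h assume "h \<in> carrier H"
    then have "counit H h \<in> carrier K" by (rule \<epsilon>_lin)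
    then show "linear_map K M M (\<lambda>n. counit H h \<odot>\<^bsub>M\<^esub> n)"
      by (rule linear_map_smult[OF assms(2,2) linear_map_id])
  qed
  show ?thesis
    unfolding comodule_def
  proof (intro conjI ballI)
    fix m assume m: "m \<in> carrier M"
    show "tensor_lift K M H M (\<lambda>n h. counit H h \<odot>\<^bsub>M\<^esub> n) (coact M m) = m"
      using m by (simp add: M tensor_lift(2)[OF assms(2) H(1) assms(2) \<epsilon>] one)
    have "tensor_map K M H (tensor K M H) H (coact M) (\<lambda>x. x) (coact M m) =
        pure K (tensor K M H) H (pure K M H m \<one>\<^bsub>H\<^esub>) \<one>\<^bsub>H\<^esub>"
      using m by (simp add: M tensor_map(2)[OF assms(2) H(1) tensor_module[OF assms(2) H(1)] H(1) c linear_map_id])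
    moreover have "tensor_map K M H M (tensor K H H) (\<lambda>x. x) (comult H) (coact M m) =
        pure K M (tensor K H H) m (pure K H H \<one>\<^bsub>H\<^esub> \<one>\<^bsub>H\<^esub>)"
      using m by (simp add: M one tensor_map(2)[OF assms(2) H(1) assms(2) tensor_module[OF H(1,1)] linear_map_id \<Delta>])
    ultimately show "tensor_assoc K M H H (tensor_map K M H (tensor K M H) H (coact M) (\<lambda>x. x) (coact M m)) =
        tensor_map K M H M (tensor K H H) (\<lambda>x. x) (comult H) (coact M m)"
      using m by (simp add: tensor_assoc_pure[OF assms(2) H(1) H(1)])
  qed (use assms(2) c in auto)
qed

section \<open>The tensor product of comodules\<close>

lemma tensor_comod_simps:
  "carrier (tensor_comod K H M N) = carrier (tensor K M N)"
  "\<zero>\<^bsub>tensor_comod K H M N\<^esub> = \<zero>\<^bsub>tensor K M N\<^esub>"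
  "add (tensor_comod K H M N) = add (tensor K M N)"
  "smult (tensor_comod K H M N) = smult (tensor K M N)"
  by (simp_all add: tensor_comod_def module.defs)

lemma linear_map_tensor_comod:
  "linear_map K (tensor_comod K H M N) U f \<longleftrightarrow> linear_map K (tensor K M N) U f"
  "linear_map K V (tensor_comod K H M N) g \<longleftrightarrow> linear_map K V (tensor K M N) g"
  by (simp_all add: linear_map_def tensor_comod_simps)

lemma tensor_comod_module:
  assumes "module K M" and "module K N"
  shows "module K (tensor_comod K H M N)"
  by (rule module_cong[OF tensor_module[OF assms] tensor_comod_simps])

lemma bilinear_pure_tensor_comod:
  assumes "module K M" and "module K N"
  shows "bilinear_map K M N (tensor_comod K H M N) (pure K M N)"
  using pure_bilinear[OF assms] by (simp add: bilinear_map_def linear_map_tensor_comod)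

lemma coact_tensor_comod:
  assumes "assoc_algebra K H" and "comodule K H M" and "comodule K H N"
  defines "T \<equiv> tensor_comod K H M N"
  shows "linear_map K T (tensor K T H) (coact T)"
    and "m \<in> carrier M \<Longrightarrow> n \<in> carrier N \<Longrightarrow>
      coact T (pure K M N m n) = sweedler_prod K H M N T (pure K M N) (coact M m) (coact N n)"
proof -
  note H = assoc_algebraD[OF assms(1)]
  note M = comoduleD[OF assms(2)] and N = comoduleD[OF assms(3)]
  have T: "module K T" unfolding T_def by (rule tensor_comod_module[OF M(1) N(1)])
  \<comment> \<open>The defining lift takes values over the bare space M \<otimes> N, whereas T
    carries a coaction field as well; both give the same tensor product with H.\<close>
  have cong: "tensor K T H = tensor K (tensor K M N) H" "pure K T H = pure K (tensor K M N) H"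
    unfolding T_def by (intro tensor_cong tensor_comod_simps)+
  have p: "bilinear_map K M N T (pure K M N)"
    unfolding T_def by (rule bilinear_pure_tensor_comod[OF M(1) N(1)])
  note S = sweedler_prod(1)[OF assms(1) M(1) N(1) T p]
  have c: "coact T = tensor_lift K M N (tensor K T H) (\<lambda>m n.
      sweedler_prod K H M N T (pure K M N) (coact M m) (coact N n))"
    by (simp add: sweedler_prod_def cong) (simp add: T_def tensor_comod_def module.defs sweedler_prod_def)
  note l = tensor_lift[OF M(1) N(1) tensor_module[OF T H(1)] bilinear_map_comp[OF S M(2) N(2)], folded c]
  show "linear_map K T (tensor K T H) (coact T)"
    using l(1) by (simp add: T_def linear_map_tensor_comod)
  show "m \<in> carrier M \<Longrightarrow> n \<in> carrier N \<Longrightarrow>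
      coact T (pure K M N m n) = sweedler_prod K H M N T (pure K M N) (coact M m) (coact N n)"
    by (rule l(2))
qed

text \<open>For coinvariant r the product n1 r1 is n1 times 1, so the coaction affects only the
  factor n. This is why n \<mapsto> n \<otimes> r is colinear.\<close>

lemma coact_tensor_coinvariant:
  assumes "assoc_algebra K H" and "comodule K H N" and "comodule K H M"
    and "n \<in> carrier N" and "r \<in> carrier M" and "coact M r = pure K M H r \<one>\<^bsub>H\<^esub>"
  shows "coact (tensor_comod K H N M) (pure K N M n r) =
    tensor_map K N H (tensor_comod K H N M) H (\<lambda>n. pure K N M n r) (\<lambda>h. h) (coact N n)"
proof -
  let ?T = "tensor_comod K H N M"
  note H = assoc_algebraD[OF assms(1)]
  interpret H: ring H by (rule H(2))
  note N = comoduleD[OF assms(2)] and M = comoduleD[OF assms(3)]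
  note T = tensor_comod_module[OF N(1) M(1), of H]
  note p = bilinear_pure_tensor_comod[OF N(1) M(1), of H]
  note S = sweedler_prod[OF assms(1) N(1) M(1) T p]
  note tm = tensor_map[OF N(1) H(1) T H(1) bilinear_mapD(2)[OF p assms(5)] linear_map_id]
  \<comment> \<open>Both sides are linear in the coaction of n, which may therefore be replaced by a
    pure tensor with H-component h; there the equation is h 1 = h.\<close>
  have "sweedler_prod K H N M ?T (pure K N M) (coact N n) (pure K M H r \<one>\<^bsub>H\<^esub>) =
    tensor_map K N H ?T H (\<lambda>n. pure K N M n r) (\<lambda>h. h) (coact N n)"
    by (rule tensor_linear_eqI[OF N(1) H(1) bilinear_mapD(2)[OF S(1) pure_closed[OF M(1) H(1) assms(5) H.one_closed]]
          tm(1) _ linear_mapD(1)[OF N(2) assms(4)]])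
       (simp add: S(2) tm(2) assms(5))
  then show ?thesis
    unfolding coact_tensor_comod(2)[OF assms(1,2,3,4,5)] assms(6) .
qed

section \<open>Coinvariants and colinear maps\<close>

lemma coinvariants_carrier:
  "r \<in> carrier (coinvariants K H M) \<longleftrightarrow> r \<in> carrier M \<and> coact M r = pure K M H r \<one>\<^bsub>H\<^esub>"
  by (simp add: coinvariants_def)

text \<open>This is (u \<otimes> id) (r \<otimes> 1) = u r \<otimes> 1. For a map out of K it
  produces coinvariants of \<open>R P\<close>; for \<open>radj_map\<close> and
  \<open>radj_precomp\<close> it ensures that the canonical map can be applied to the image of a
  coinvariant.\<close>

lemma coinvariant_image:
  assumes "assoc_algebra K H" and "module K M" and "module K M'" and "u \<in> comod_hom K H M M'"
    and "r \<in> carrier (coinvariants K H M)"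
  shows "u r \<in> carrier (coinvariants K H M')"
proof -
  note H = assoc_algebraD[OF assms(1)]
  interpret H: ring H by (rule H(2))
  have u: "linear_map K M M' u" "colinear K H M M' u"
    using assms(4) unfolding comod_hom_def lin_hom_def by blast+
  have r: "r \<in> carrier M" "coact M r = pure K M H r \<one>\<^bsub>H\<^esub>"
    using assms(5) unfolding coinvariants_carrier by blast+
  have "coact M' (u r) = tensor_map K M H M' H u (\<lambda>h. h) (coact M r)"
    using u(2) r(1) unfolding colinear_def by blast
  also have "\<dots> = pure K M' H (u r) \<one>\<^bsub>H\<^esub>"
    unfolding r(2)
    by (rule tensor_map(2)[OF assms(2) H(1) assms(3) H(1) u(1) linear_map_id r(1) H.one_closed])
  finally show ?thesis
    using linear_mapD(1)[OF u(1) r(1)] unfolding coinvariants_carrier by blast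
qed

text \<open>The counit is the preimage of this map under the transpose; the identity is restricted
  to fit the extensional morphism sets.\<close>

lemma comod_hom_id:
  assumes "assoc_algebra K H" and "comodule K H M"
  shows "(\<lambda>m\<in>carrier M. m) \<in> comod_hom K H M M"
proof -
  note H = assoc_algebraD[OF assms(1)] and M = comoduleD[OF assms(2)]
  have "linear_map K M M (\<lambda>m\<in>carrier M. m)"
    by (simp add: linear_map_cong[OF M(1), of "\<lambda>m\<in>carrier M. m" "\<lambda>m. m"] linear_map_id)
  moreover have "tensor_map K M H M H (\<lambda>m\<in>carrier M. m) (\<lambda>h. h) (coact M m) = coact M m"
    if "m \<in> carrier M" for m
    using that linear_mapD(1)[OF M(2)] by (intro tensor_map_id[OF M(1) H(1)]) auto
  ultimately show ?thesis
    by (simp add: comod_hom_def lin_hom_def colinear_def)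
qed


section \<open>Relative Hopf modules\<close>

text \<open>
  The part of the structure of a relative Hopf module on which morphisms depend. Working with it
  makes it unnecessary to verify the axioms of a relative Hopf module for N \<otimes> M.
\<close>

definition rhm_data ::
    "'k ring \<Rightarrow> ('k, 'h) hopf \<Rightarrow> ('o, 'f, 'k, 'h) cocat \<Rightarrow> ('o, 'f, 'k, 'h, 'm) rhm \<Rightarrow> bool"
  where "rhm_data K H D M \<longleftrightarrow> (\<forall>X\<in>cocat_obj D.
    module K (rhm_obj M X) \<and>
    linear_map K (rhm_obj M X) (tensor K (rhm_obj M X) H) (coact (rhm_obj M X)) \<and>
    (\<forall>Y\<in>cocat_obj D. \<forall>f\<in>carrier (cocat_hom D X Y).
      linear_map K (rhm_obj M X) (rhm_obj M Y) (rhm_act M X Y f)))"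

lemma rhm_dataD:
  assumes "rhm_data K H D M" and "X \<in> cocat_obj D"
  shows "module K (rhm_obj M X)"
    and "linear_map K (rhm_obj M X) (tensor K (rhm_obj M X) H) (coact (rhm_obj M X))"
    and "Y \<in> cocat_obj D \<Longrightarrow> f \<in> carrier (cocat_hom D X Y) \<Longrightarrow>
      linear_map K (rhm_obj M X) (rhm_obj M Y) (rhm_act M X Y f)"
  using assms unfolding rhm_data_def by blast+

lemma rel_hopf_moduleD:
  assumes "rel_hopf_module K H D M"
  shows "rhm_data K H D M" and "X \<in> cocat_obj D \<Longrightarrow> comodule K H (rhm_obj M X)"
proof -
  show com: "X \<in> cocat_obj D \<Longrightarrow> comodule K H (rhm_obj M X)" for X
    using assms by (simp add: rel_hopf_module_def)
  have act: "bilinear_map K (cocat_hom D X Y) (rhm_obj M X) (rhm_obj M Y) (rhm_act M X Y)"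
    if "X \<in> cocat_obj D" "Y \<in> cocat_obj D" for X Y
    using assms that by (simp add: rel_hopf_module_def left_D_module_def)
  show "rhm_data K H D M"
    unfolding rhm_data_def
    by (intro ballI conjI) (assumption | rule comoduleD[OF com] bilinear_mapD(1)[OF act])+
qed

section \<open>Morphisms of relative Hopf modules\<close>

lemma rhm_homI:
  assumes "\<eta> \<in> extensional (cocat_obj D)"
    and "\<And>X. X \<in> cocat_obj D \<Longrightarrow> \<eta> X \<in> extensional (carrier (rhm_obj M X))"
    and "\<And>X. X \<in> cocat_obj D \<Longrightarrow> linear_map K (rhm_obj M X) (rhm_obj N X) (\<eta> X)"
    and "\<And>X Y f m. X \<in> cocat_obj D \<Longrightarrow> Y \<in> cocat_obj D \<Longrightarrow> f \<in> carrier (cocat_hom D X Y) \<Longrightarrow>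
      m \<in> carrier (rhm_obj M X) \<Longrightarrow> \<eta> Y (rhm_act M X Y f m) = rhm_act N X Y f (\<eta> X m)"
    and "\<And>X. X \<in> cocat_obj D \<Longrightarrow> colinear K H (rhm_obj M X) (rhm_obj N X) (\<eta> X)"
  shows "\<eta> \<in> rhm_hom K H D M N"
  using assms unfolding rhm_hom_def D_module_hom_def lin_hom_def PiE_def by blast

lemma rhm_homD:
  assumes "\<eta> \<in> rhm_hom K H D M N"
  shows "\<eta> \<in> extensional (cocat_obj D)"
    and "X \<in> cocat_obj D \<Longrightarrow> \<eta> X \<in> extensional (carrier (rhm_obj M X))"
    and "X \<in> cocat_obj D \<Longrightarrow> linear_map K (rhm_obj M X) (rhm_obj N X) (\<eta> X)"
    and "X \<in> cocat_obj D \<Longrightarrow> Y \<in> cocat_obj D \<Longrightarrow> f \<in> carrier (cocat_hom D X Y) \<Longrightarrow>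
      m \<in> carrier (rhm_obj M X) \<Longrightarrow> \<eta> Y (rhm_act M X Y f m) = rhm_act N X Y f (\<eta> X m)"
    and "X \<in> cocat_obj D \<Longrightarrow> colinear K H (rhm_obj M X) (rhm_obj N X) (\<eta> X)"
  using assms unfolding rhm_hom_def D_module_hom_def lin_hom_def PiE_def by blast+

text \<open>Extensionality acts on two levels, for the family indexed by objects and for each of its
  components.\<close>

lemma rhm_hom_eqI:
  assumes "\<eta> \<in> rhm_hom K H D M N" and "\<theta> \<in> rhm_hom K H D M N"
    and "\<And>X m. X \<in> cocat_obj D \<Longrightarrow> m \<in> carrier (rhm_obj M X) \<Longrightarrow> \<eta> X m = \<theta> X m"
  shows "\<eta> = \<theta>"
proof (rule extensionalityI)
  show "\<eta> \<in> extensional (cocat_obj D)" "\<theta> \<in> extensional (cocat_obj D)"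
    by (rule rhm_homD(1)[OF assms(1)], rule rhm_homD(1)[OF assms(2)])
  show "\<eta> X = \<theta> X" if X: "X \<in> cocat_obj D" for X
    by (rule extensionalityI[OF rhm_homD(2)[OF assms(1) X] rhm_homD(2)[OF assms(2) X]])
       (rule assms(3)[OF X])
qed

lemma rhm_comp_apply:
  "X \<in> cocat_obj D \<Longrightarrow> m \<in> carrier (rhm_obj M X) \<Longrightarrow> rhm_comp D M \<theta> \<eta> X m = \<theta> X (\<eta> X m)"
  by (simp add: rhm_comp_def compose_def)

text \<open>Stated for \<open>rhm_data\<close> because N \<otimes> M occurs both as source and as
  middle object.\<close>

lemma rhm_comp_hom:
  assumes "assoc_algebra K H" and "rhm_data K H D M" and "rhm_data K H D N" and "rhm_data K H D P"
    and "\<eta> \<in> rhm_hom K H D M N" and "\<theta> \<in> rhm_hom K H D N P"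
  shows "rhm_comp D M \<theta> \<eta> \<in> rhm_hom K H D M P"
proof (rule rhm_homI)
  note H = assoc_algebraD[OF assms(1)]
  note M = rhm_dataD[OF assms(2)] and N = rhm_dataD[OF assms(3)] and P = rhm_dataD[OF assms(4)]
  note \<eta> = rhm_homD[OF assms(5)] and \<theta> = rhm_homD[OF assms(6)]
  let ?\<kappa> = "rhm_comp D M \<theta> \<eta>"
  show "?\<kappa> \<in> extensional (cocat_obj D)" by (simp add: rhm_comp_def)
  fix X assume X: "X \<in> cocat_obj D"
  show "?\<kappa> X \<in> extensional (carrier (rhm_obj M X))" using X by (simp add: rhm_comp_def)
  note app = rhm_comp_apply[where \<eta> = \<eta> and \<theta> = \<theta>]
  show lin: "linear_map K (rhm_obj M X) (rhm_obj P X) (?\<kappa> X)"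
    using linear_map_comp[OF \<eta>(3)[OF X] \<theta>(3)[OF X]]
    by (simp add: linear_map_cong[OF M(1)[OF X], of "?\<kappa> X" "\<lambda>m. \<theta> X (\<eta> X m)"] app X)
  show "?\<kappa> Y (rhm_act M X Y f m) = rhm_act P X Y f (?\<kappa> X m)"
    if Y: "Y \<in> cocat_obj D" and f: "f \<in> carrier (cocat_hom D X Y)" and m: "m \<in> carrier (rhm_obj M X)"
    for Y f m
    using linear_mapD(1)[OF M(3)[OF X Y f] m] linear_mapD(1)[OF \<eta>(3)[OF X] m]
    by (simp add: app X Y m \<eta>(4)[OF X Y f m] \<theta>(4)[OF X Y f])
  show "colinear K H (rhm_obj M X) (rhm_obj P X) (?\<kappa> X)"
    unfolding colinear_def
  proof
    fix m assume m: "m \<in> carrier (rhm_obj M X)"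
    have "coact (rhm_obj P X) (?\<kappa> X m) = coact (rhm_obj P X) (\<theta> X (\<eta> X m))"
      by (simp add: app X m)
    also have "\<dots> = tensor_map K (rhm_obj N X) H (rhm_obj P X) H (\<theta> X) (\<lambda>h. h)
        (coact (rhm_obj N X) (\<eta> X m))"
      using \<theta>(5)[OF X] linear_mapD(1)[OF \<eta>(3)[OF X] m] unfolding colinear_def by blast
    also have "coact (rhm_obj N X) (\<eta> X m) =
        tensor_map K (rhm_obj M X) H (rhm_obj N X) H (\<eta> X) (\<lambda>h. h) (coact (rhm_obj M X) m)"
      using \<eta>(5)[OF X] m unfolding colinear_def by blast
    also have "tensor_map K (rhm_obj N X) H (rhm_obj P X) H (\<theta> X) (\<lambda>h. h) \<dots> =
        tensor_map K (rhm_obj M X) H (rhm_obj P X) H (?\<kappa> X) (\<lambda>h. h) (coact (rhm_obj M X) m)"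
      by (rule tensor_map_comp[OF M(1)[OF X] N(1)[OF X] P(1)[OF X] H(1) \<eta>(3)[OF X] \<theta>(3)[OF X]
            linear_mapD(1)[OF M(2)[OF X] m]]) (rule app[OF X])
    finally show "coact (rhm_obj P X) (?\<kappa> X m) =
        tensor_map K (rhm_obj M X) H (rhm_obj P X) H (?\<kappa> X) (\<lambda>h. h) (coact (rhm_obj M X) m)" .
  qed
qed

lemma rhm_id_hom:
  assumes "assoc_algebra K H" and "rhm_data K H D M"
  shows "rhm_id D M \<in> rhm_hom K H D M M"
proof (rule rhm_homI)
  note H = assoc_algebraD[OF assms(1)] and M = rhm_dataD[OF assms(2)]
  show "rhm_id D M \<in> extensional (cocat_obj D)" by (simp add: rhm_id_def)
  fix X assume X: "X \<in> cocat_obj D"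
  show "rhm_id D M X \<in> extensional (carrier (rhm_obj M X))" using X by (simp add: rhm_id_def)
  have app: "rhm_id D M X m = m" if "X \<in> cocat_obj D" "m \<in> carrier (rhm_obj M X)" for X m
    using that by (simp add: rhm_id_def)
  show "linear_map K (rhm_obj M X) (rhm_obj M X) (rhm_id D M X)"
    by (simp add: linear_map_cong[OF M(1)[OF X], of "rhm_id D M X" "\<lambda>m. m"] app X linear_map_id)
  show "rhm_id D M Y (rhm_act M X Y f m) = rhm_act M X Y f (rhm_id D M X m)"
    if Y: "Y \<in> cocat_obj D" and f: "f \<in> carrier (cocat_hom D X Y)" and m: "m \<in> carrier (rhm_obj M X)"
    for Y f m
    using linear_mapD(1)[OF M(3)[OF X Y f] m] by (simp add: app X Y m)
  show "colinear K H (rhm_obj M X) (rhm_obj M X) (rhm_id D M X)"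
    unfolding colinear_def
  proof
    fix m assume m: "m \<in> carrier (rhm_obj M X)"
    show "coact (rhm_obj M X) (rhm_id D M X m) =
        tensor_map K (rhm_obj M X) H (rhm_obj M X) H (rhm_id D M X) (\<lambda>h. h) (coact (rhm_obj M X) m)"
      unfolding app[OF X m]
      by (rule tensor_map_id[OF M(1)[OF X] H(1) linear_mapD(1)[OF M(2)[OF X] m], symmetric])
         (rule app[OF X])
  qed
qed

section \<open>Morphisms into and out of N \<otimes> M\<close>

lemma rhm_tensor_simps:
  "rhm_obj (rhm_tensor K H N M) X = tensor_comod K H (rhm_obj N X) M"
  "rhm_act (rhm_tensor K H N M) X Y f =
    tensor_map K (rhm_obj N X) M (rhm_obj N Y) M (rhm_act N X Y f) (\<lambda>m. m)"
  by (simp_all add: rhm_tensor_def)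

lemma rhm_data_tensor:
  assumes "assoc_algebra K H" and "rel_hopf_module K H D N" and "comodule K H M"
  shows "rhm_data K H D (rhm_tensor K H N M)"
  unfolding rhm_data_def rhm_tensor_simps
proof (intro ballI conjI)
  note N = rel_hopf_moduleD(2)[OF assms(2)] and act = rhm_dataD(3)[OF rel_hopf_moduleD(1)[OF assms(2)]]
  note M = comoduleD[OF assms(3)]
  fix X assume X: "X \<in> cocat_obj D"
  note NX = comoduleD[OF N[OF X]]
  show "module K (tensor_comod K H (rhm_obj N X) M)"
    by (rule tensor_comod_module[OF NX(1) M(1)])
  show "linear_map K (tensor_comod K H (rhm_obj N X) M) (tensor K (tensor_comod K H (rhm_obj N X) M) H)
      (coact (tensor_comod K H (rhm_obj N X) M))"
    by (rule coact_tensor_comod(1)[OF assms(1) N[OF X] assms(3)])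
  fix Y f assume Y: "Y \<in> cocat_obj D" and f: "f \<in> carrier (cocat_hom D X Y)"
  show "linear_map K (tensor_comod K H (rhm_obj N X) M) (tensor_comod K H (rhm_obj N Y) M)
      (tensor_map K (rhm_obj N X) M (rhm_obj N Y) M (rhm_act N X Y f) (\<lambda>m. m))"
    unfolding linear_map_tensor_comod
    by (rule tensor_map(1)[OF NX(1) M(1) comoduleD(1)[OF N[OF Y]] M(1) act[OF X Y f] linear_map_id])
qed

text \<open>Naturality and colinearity are equations between linear maps out of N(X) \<otimes> M, so
  pure tensors decide them. It is applied to maps into N' \<otimes> M' and to the map from N
  \<otimes> K to N.\<close>

lemma rhm_hom_tensorI:
  assumes alg: "assoc_algebra K H" and N: "rel_hopf_module K H D N" and M: "comodule K H M"
    and P: "rhm_data K H D P"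
    and ext: "\<theta> \<in> extensional (cocat_obj D)"
      "\<And>X. X \<in> cocat_obj D \<Longrightarrow> \<theta> X \<in> extensional (carrier (tensor K (rhm_obj N X) M))"
    and lin: "\<And>X. X \<in> cocat_obj D \<Longrightarrow> linear_map K (tensor K (rhm_obj N X) M) (rhm_obj P X) (\<theta> X)"
    and nat: "\<And>X Y f n m. X \<in> cocat_obj D \<Longrightarrow> Y \<in> cocat_obj D \<Longrightarrow> f \<in> carrier (cocat_hom D X Y) \<Longrightarrow>
      n \<in> carrier (rhm_obj N X) \<Longrightarrow> m \<in> carrier M \<Longrightarrow>
      \<theta> Y (pure K (rhm_obj N Y) M (rhm_act N X Y f n) m) =
        rhm_act P X Y f (\<theta> X (pure K (rhm_obj N X) M n m))"
    and col: "\<And>X n m. X \<in> cocat_obj D \<Longrightarrow> n \<in> carrier (rhm_obj N X) \<Longrightarrow> m \<in> carrier M \<Longrightarrow>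
      coact (rhm_obj P X) (\<theta> X (pure K (rhm_obj N X) M n m)) =
        tensor_map K (tensor_comod K H (rhm_obj N X) M) H (rhm_obj P X) H (\<theta> X) (\<lambda>h. h)
          (coact (tensor_comod K H (rhm_obj N X) M) (pure K (rhm_obj N X) M n m))"
  shows "\<theta> \<in> rhm_hom K H D (rhm_tensor K H N M) P"
proof (rule rhm_homI; (unfold rhm_tensor_simps)?)
  note H = assoc_algebraD[OF alg]
  note NX = rel_hopf_moduleD(2)[OF N] and act = rhm_dataD(3)[OF rel_hopf_moduleD(1)[OF N]]
  note M' = comoduleD[OF M] and P' = rhm_dataD[OF P]
  show "\<theta> \<in> extensional (cocat_obj D)" by (rule ext)
  fix X assume X: "X \<in> cocat_obj D"
  note NX' = comoduleD[OF NX[OF X]]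
  show "\<theta> X \<in> extensional (carrier (tensor_comod K H (rhm_obj N X) M))"
    unfolding tensor_comod_simps by (rule ext(2)[OF X])
  show lin': "linear_map K (tensor_comod K H (rhm_obj N X) M) (rhm_obj P X) (\<theta> X)"
    unfolding linear_map_tensor_comod by (rule lin[OF X])
  show "\<theta> Y (tensor_map K (rhm_obj N X) M (rhm_obj N Y) M (rhm_act N X Y f) (\<lambda>m. m) t) =
      rhm_act P X Y f (\<theta> X t)"
    if Y: "Y \<in> cocat_obj D" and f: "f \<in> carrier (cocat_hom D X Y)"
      and t: "t \<in> carrier (tensor_comod K H (rhm_obj N X) M)" for Y f t
  proof (rule tensor_linear_eqI[OF NX'(1) M'(1)])
    note tm = tensor_map[OF NX'(1) M'(1) comoduleD(1)[OF NX[OF Y]] M'(1) act[OF X Y f] linear_map_id]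
    show "linear_map K (tensor K (rhm_obj N X) M) (rhm_obj P Y)
        (\<lambda>t. \<theta> Y (tensor_map K (rhm_obj N X) M (rhm_obj N Y) M (rhm_act N X Y f) (\<lambda>m. m) t))"
      by (rule linear_map_comp[OF tm(1) lin[OF Y]])
    show "linear_map K (tensor K (rhm_obj N X) M) (rhm_obj P Y) (\<lambda>t. rhm_act P X Y f (\<theta> X t))"
      by (rule linear_map_comp[OF lin[OF X] P'(3)[OF X Y f]])
    show "\<theta> Y (tensor_map K (rhm_obj N X) M (rhm_obj N Y) M (rhm_act N X Y f) (\<lambda>m. m)
        (pure K (rhm_obj N X) M n m)) = rhm_act P X Y f (\<theta> X (pure K (rhm_obj N X) M n m))"
      if n: "n \<in> carrier (rhm_obj N X)" and m: "m \<in> carrier M" for n m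
      unfolding tm(2)[OF n m] by (rule nat[OF X Y f n m])
    show "t \<in> carrier (tensor K (rhm_obj N X) M)" using t unfolding tensor_comod_simps .
  qed
  show "colinear K H (tensor_comod K H (rhm_obj N X) M) (rhm_obj P X) (\<theta> X)"
    unfolding colinear_def tensor_comod_simps
  proof
    fix t assume t: "t \<in> carrier (tensor K (rhm_obj N X) M)"
    let ?T = "tensor_comod K H (rhm_obj N X) M"
    note T = tensor_comod_module[OF NX'(1) M'(1), of H]
    show "coact (rhm_obj P X) (\<theta> X t) =
        tensor_map K ?T H (rhm_obj P X) H (\<theta> X) (\<lambda>h. h) (coact ?T t)"
    proof (rule tensor_linear_eqI[OF NX'(1) M'(1) _ _ _ t])
      show "linear_map K (tensor K (rhm_obj N X) M) (tensor K (rhm_obj P X) H)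
          (\<lambda>t. coact (rhm_obj P X) (\<theta> X t))"
        by (rule linear_map_comp[OF lin[OF X] P'(2)[OF X]])
      show "linear_map K (tensor K (rhm_obj N X) M) (tensor K (rhm_obj P X) H)
          (\<lambda>t. tensor_map K ?T H (rhm_obj P X) H (\<theta> X) (\<lambda>h. h) (coact ?T t))"
        by (rule linear_map_comp[OF
              coact_tensor_comod(1)[OF alg NX[OF X] M, unfolded linear_map_tensor_comod]
              tensor_map(1)[OF T H(1) P'(1)[OF X] H(1) lin' linear_map_id]])
    qed (rule col[OF X])
  qed
qed

lemma rhm_hom_tensor_eqI:
  assumes "rel_hopf_module K H D N" and "comodule K H M"
    and "\<eta> \<in> rhm_hom K H D (rhm_tensor K H N M) P" and "\<theta> \<in> rhm_hom K H D (rhm_tensor K H N M) P"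
    and "\<And>X n m. X \<in> cocat_obj D \<Longrightarrow> n \<in> carrier (rhm_obj N X) \<Longrightarrow> m \<in> carrier M \<Longrightarrow>
      \<eta> X (pure K (rhm_obj N X) M n m) = \<theta> X (pure K (rhm_obj N X) M n m)"
  shows "\<eta> = \<theta>"
proof (rule rhm_hom_eqI[OF assms(3,4)])
  fix X t assume X: "X \<in> cocat_obj D" and t: "t \<in> carrier (rhm_obj (rhm_tensor K H N M) X)"
  note NX = comoduleD(1)[OF rel_hopf_moduleD(2)[OF assms(1) X]] and M = comoduleD(1)[OF assms(2)]
  show "\<eta> X t = \<theta> X t"
    by (rule tensor_linear_eqI[OF NX M
          rhm_homD(3)[OF assms(3) X, unfolded rhm_tensor_simps linear_map_tensor_comod]
          rhm_homD(3)[OF assms(4) X, unfolded rhm_tensor_simps linear_map_tensor_comod]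
          assms(5)[OF X] t[unfolded rhm_tensor_simps tensor_comod_simps]])
qed

text \<open>Colinearity is \<open>sweedler_prod_natural\<close> with \<eta> \<otimes> u as the map
  e, which intertwines the two maps \<open>pure\<close>. The conditions on u are separate from
  \<open>comod_hom\<close>, so that the unrestricted identity qualifies too.\<close>

lemma rhm_tensor_map_hom:
  assumes "assoc_algebra K H" and "rel_hopf_module K H D N" and "rel_hopf_module K H D N'"
    and "comodule K H M" and "comodule K H M'"
    and "\<eta> \<in> rhm_hom K H D N N'" and "linear_map K M M' u" and "colinear K H M M' u"
  shows "rhm_tensor_map K D N M N' M' \<eta> u \<in>
      rhm_hom K H D (rhm_tensor K H N M) (rhm_tensor K H N' M')" (is "?\<theta> \<in> _")
    and "X \<in> cocat_obj D \<Longrightarrow> n \<in> carrier (rhm_obj N X) \<Longrightarrow> m \<in> carrier M \<Longrightarrow>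
      rhm_tensor_map K D N M N' M' \<eta> u X (pure K (rhm_obj N X) M n m) =
        pure K (rhm_obj N' X) M' (\<eta> X n) (u m)"
proof -
  note H = assoc_algebraD[OF assms(1)]
  note N = rel_hopf_moduleD(2)[OF assms(2)] and N' = rel_hopf_moduleD(2)[OF assms(3)]
  note M = comoduleD[OF assms(4)] and M' = comoduleD[OF assms(5)]
  note act = rhm_dataD(3)[OF rel_hopf_moduleD(1)[OF assms(2)]]
    and act' = rhm_dataD(3)[OF rel_hopf_moduleD(1)[OF assms(3)]]
  note \<eta> = rhm_homD[OF assms(6)]
  have \<theta>: "?\<theta> X = tensor_map K (rhm_obj N X) M (rhm_obj N' X) M' (\<eta> X) u" if "X \<in> cocat_obj D" for X
    using that by (simp add: rhm_tensor_map_def)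
  note tm = tensor_map[OF comoduleD(1)[OF N] M(1) comoduleD(1)[OF N'] M'(1) \<eta>(3) assms(7)]
  show pure: "?\<theta> X (pure K (rhm_obj N X) M n m) = pure K (rhm_obj N' X) M' (\<eta> X n) (u m)"
    if "X \<in> cocat_obj D" "n \<in> carrier (rhm_obj N X)" "m \<in> carrier M" for X n m
    unfolding \<theta>[OF that(1)] by (rule tm(2)[OF that(1,1,1,2,3)])
  show "?\<theta> \<in> rhm_hom K H D (rhm_tensor K H N M) (rhm_tensor K H N' M')"
  proof (rule rhm_hom_tensorI[OF assms(1,2,4) rhm_data_tensor[OF assms(1,3,5)]];
      (unfold rhm_tensor_simps)?)
    show "?\<theta> \<in> extensional (cocat_obj D)" by (simp add: rhm_tensor_map_def)
    fix X assume X: "X \<in> cocat_obj D"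
    note NX = comoduleD[OF N[OF X]] and NX' = comoduleD[OF N'[OF X]]
    show "?\<theta> X \<in> extensional (carrier (tensor K (rhm_obj N X) M))"
      unfolding \<theta>[OF X] tensor_map_def by (rule tensor_lift_extensional)
    show lin: "linear_map K (tensor K (rhm_obj N X) M) (tensor_comod K H (rhm_obj N' X) M') (?\<theta> X)"
      unfolding \<theta>[OF X] linear_map_tensor_comod by (rule tm(1)[OF X X X])
    fix n m assume n: "n \<in> carrier (rhm_obj N X)" and m: "m \<in> carrier M"
    show "?\<theta> Y (pure K (rhm_obj N Y) M (rhm_act N X Y f n) m) =
        tensor_map K (rhm_obj N' X) M' (rhm_obj N' Y) M' (rhm_act N' X Y f) (\<lambda>m. m)
          (?\<theta> X (pure K (rhm_obj N X) M n m))"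
      if Y: "Y \<in> cocat_obj D" and f: "f \<in> carrier (cocat_hom D X Y)" for Y f
      unfolding pure[OF X n m] pure[OF Y linear_mapD(1)[OF act[OF X Y f] n] m]
        \<eta>(4)[OF X Y f n]
        tensor_map(2)[OF NX'(1) M'(1) comoduleD(1)[OF N'[OF Y]] M'(1) act'[OF X Y f] linear_map_id
          linear_mapD(1)[OF \<eta>(3)[OF X] n] linear_mapD(1)[OF assms(7) m]]
      by (rule refl)
    let ?T = "tensor_comod K H (rhm_obj N X) M" and ?T' = "tensor_comod K H (rhm_obj N' X) M'"
    have "coact ?T' (pure K (rhm_obj N' X) M' (\<eta> X n) (u m)) =
        sweedler_prod K H (rhm_obj N' X) M' ?T' (pure K (rhm_obj N' X) M')
          (coact (rhm_obj N' X) (\<eta> X n)) (coact M' (u m))"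
      by (rule coact_tensor_comod(2)[OF assms(1) N'[OF X] assms(5)
            linear_mapD(1)[OF \<eta>(3)[OF X] n] linear_mapD(1)[OF assms(7) m]])
    also have "coact (rhm_obj N' X) (\<eta> X n) =
        tensor_map K (rhm_obj N X) H (rhm_obj N' X) H (\<eta> X) (\<lambda>h. h) (coact (rhm_obj N X) n)"
      using \<eta>(5)[OF X] n unfolding colinear_def by blast
    also have "coact M' (u m) = tensor_map K M H M' H u (\<lambda>h. h) (coact M m)"
      using assms(8) m unfolding colinear_def by blast
    also have "sweedler_prod K H (rhm_obj N' X) M' ?T' (pure K (rhm_obj N' X) M')
        (tensor_map K (rhm_obj N X) H (rhm_obj N' X) H (\<eta> X) (\<lambda>h. h) (coact (rhm_obj N X) n))
        (tensor_map K M H M' H u (\<lambda>h. h) (coact M m)) =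
      tensor_map K ?T H ?T' H (?\<theta> X) (\<lambda>h. h)
        (sweedler_prod K H (rhm_obj N X) M ?T (pure K (rhm_obj N X) M) (coact (rhm_obj N X) n) (coact M m))"
      by (rule sweedler_prod_natural[OF assms(1) NX(1) M(1) tensor_comod_module[OF NX(1) M(1)]
            NX'(1) M'(1) tensor_comod_module[OF NX'(1) M'(1)]
            bilinear_pure_tensor_comod[OF NX(1) M(1)] bilinear_pure_tensor_comod[OF NX'(1) M'(1)]
            \<eta>(3)[OF X] assms(7) lin[folded linear_map_tensor_comod(1)[where H = H]] pure[OF X]
            linear_mapD(1)[OF NX(2) n] linear_mapD(1)[OF M(2) m], symmetric])
    finally show "coact ?T' (?\<theta> X (pure K (rhm_obj N X) M n m)) =
        tensor_map K ?T H ?T' H (?\<theta> X) (\<lambda>h. h) (coact ?T (pure K (rhm_obj N X) M n m))"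
      unfolding pure[OF X n m] coact_tensor_comod(2)[OF assms(1) N[OF X] assms(4) n m] .
  qed
qed

text \<open>This is N = N \<otimes> K to N \<otimes> M, induced by the colinear map from K to M with
  value r at 1, but written without K. Coinvariance of r is what colinearity rests on.\<close>

lemma rhm_tensor_coinvariant_hom:
  assumes "assoc_algebra K H" and "rel_hopf_module K H D N" and "comodule K H M"
    and "r \<in> carrier (coinvariants K H M)"
  shows "(\<lambda>X\<in>cocat_obj D. \<lambda>n\<in>carrier (rhm_obj N X). pure K (rhm_obj N X) M n r) \<in>
    rhm_hom K H D N (rhm_tensor K H N M)" (is "?\<theta> \<in> _")
proof (rule rhm_homI; (unfold rhm_tensor_simps)?)
  note H = assoc_algebraD[OF assms(1)]
  have r: "r \<in> carrier M" "coact M r = pure K M H r \<one>\<^bsub>H\<^esub>"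
    using assms(4) unfolding coinvariants_carrier by blast+
  note N = rel_hopf_moduleD(2)[OF assms(2)] and M = comoduleD[OF assms(3)]
  note act = rhm_dataD(3)[OF rel_hopf_moduleD(1)[OF assms(2)]]
  have app: "?\<theta> X n = pure K (rhm_obj N X) M n r"
    if "X \<in> cocat_obj D" "n \<in> carrier (rhm_obj N X)" for X n
    using that by simp
  show "?\<theta> \<in> extensional (cocat_obj D)" by simp
  fix X assume X: "X \<in> cocat_obj D"
  note NX = comoduleD[OF N[OF X]]
  let ?T = "tensor_comod K H (rhm_obj N X) M"
  have lin: "linear_map K (rhm_obj N X) ?T (\<lambda>n. pure K (rhm_obj N X) M n r)"
    by (rule bilinear_mapD(2)[OF bilinear_pure_tensor_comod[OF NX(1) M(1)] r(1)])
  show "?\<theta> X \<in> extensional (carrier (rhm_obj N X))" using X by simp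
  show lin': "linear_map K (rhm_obj N X) ?T (?\<theta> X)"
    using lin X by (simp add: linear_map_cong[OF NX(1), of "\<lambda>n\<in>carrier (rhm_obj N X). pure K (rhm_obj N X) M n r"
          "\<lambda>n. pure K (rhm_obj N X) M n r"])
  show "?\<theta> Y (rhm_act N X Y f n) =
      tensor_map K (rhm_obj N X) M (rhm_obj N Y) M (rhm_act N X Y f) (\<lambda>m. m) (?\<theta> X n)"
    if Y: "Y \<in> cocat_obj D" and f: "f \<in> carrier (cocat_hom D X Y)" and n: "n \<in> carrier (rhm_obj N X)"
    for Y f n
    unfolding app[OF X n] app[OF Y linear_mapD(1)[OF act[OF X Y f] n]]
    by (rule tensor_map(2)[OF NX(1) M(1) comoduleD(1)[OF N[OF Y]] M(1) act[OF X Y f] linear_map_id n r(1),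
          symmetric])
  show "colinear K H (rhm_obj N X) ?T (?\<theta> X)"
    unfolding colinear_def
  proof
    fix n assume n: "n \<in> carrier (rhm_obj N X)"
    note T = tensor_comod_module[OF NX(1) M(1), of H]
    \<comment> \<open>The coaction formula contains the unrestricted map n \<mapsto> n \<otimes> r,
      the morphism its restriction; \<open>tm\<close> and \<open>tm'\<close> allow the two to be
      compared on pure tensors.\<close>
    note tm = tensor_map[OF NX(1) H(1) T H(1) lin linear_map_id]
      and tm' = tensor_map[OF NX(1) H(1) T H(1) lin' linear_map_id]
    show "coact ?T (?\<theta> X n) = tensor_map K (rhm_obj N X) H ?T H (?\<theta> X) (\<lambda>h. h) (coact (rhm_obj N X) n)"
      unfolding app[OF X n] coact_tensor_coinvariant[OF assms(1) N[OF X] assms(3) n r]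
    proof (rule tensor_linear_eqI[OF NX(1) H(1) tm(1) tm'(1) _ linear_mapD(1)[OF NX(2) n]])
      fix n h assume n: "n \<in> carrier (rhm_obj N X)" and h: "h \<in> carrier H"
      show "tensor_map K (rhm_obj N X) H ?T H (\<lambda>n. pure K (rhm_obj N X) M n r) (\<lambda>h. h) (pure K (rhm_obj N X) H n h) =
        tensor_map K (rhm_obj N X) H ?T H (?\<theta> X) (\<lambda>h. h) (pure K (rhm_obj N X) H n h)"
        unfolding tm(2)[OF n h] tm'(2)[OF n h] app[OF X n] by (rule refl)
    qed
  qed
qed


section \<open>The trivial comodule K\<close>

text \<open>The carrier type of comodules is arbitrary, so K is transported into it along \<iota>.\<close>

definition scalar_module :: "'k ring \<Rightarrow> ('k \<Rightarrow> 'm) \<Rightarrow> ('k, 'm) module"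
  where "scalar_module K \<iota> = \<lparr>
    carrier = \<iota> ` carrier K, mult = (\<lambda>_ _. undefined), one = undefined, zero = \<iota> \<zero>\<^bsub>K\<^esub>,
    add = (\<lambda>x y. \<iota> (inv_into (carrier K) \<iota> x \<oplus>\<^bsub>K\<^esub> inv_into (carrier K) \<iota> y)),
    smult = (\<lambda>c x. \<iota> (c \<otimes>\<^bsub>K\<^esub> inv_into (carrier K) \<iota> x))\<rparr>"

text \<open>The trivial coaction x \<mapsto> x \<otimes> 1, with the tensor product formed over
  \<open>scalar_module\<close> because the comodule is only being defined.\<close>

definition scalar_comod :: "'k ring \<Rightarrow> ('k, 'h) hopf \<Rightarrow> ('k \<Rightarrow> 'm) \<Rightarrow> ('k, 'h, 'm) comod"
  where "scalar_comod K H \<iota> = module.extend (scalar_module K \<iota>)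
    \<lparr>coact = (\<lambda>x. pure K (scalar_module K \<iota>) H x \<one>\<^bsub>H\<^esub>)\<rparr>"

text \<open>Elements are presented as \<iota> a, which keeps \<open>inv_into\<close> out of the
  module axioms; the coaction is re-expressed over the comodule itself by
  \<open>tensor_cong\<close>.\<close>

lemma scalar_comod_simps:
  assumes "inj_on \<iota> (carrier K)"
  shows "carrier (scalar_comod K H \<iota>) = \<iota> ` carrier K"
    and "\<zero>\<^bsub>scalar_comod K H \<iota>\<^esub> = \<iota> \<zero>\<^bsub>K\<^esub>"
    and "a \<in> carrier K \<Longrightarrow> b \<in> carrier K \<Longrightarrow> \<iota> a \<oplus>\<^bsub>scalar_comod K H \<iota>\<^esub> \<iota> b = \<iota> (a \<oplus>\<^bsub>K\<^esub> b)"
    and "a \<in> carrier K \<Longrightarrow> c \<odot>\<^bsub>scalar_comod K H \<iota>\<^esub> \<iota> a = \<iota> (c \<otimes>\<^bsub>K\<^esub> a)"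
    and "coact (scalar_comod K H \<iota>) x = pure K (scalar_comod K H \<iota>) H x \<one>\<^bsub>H\<^esub>"
proof -
  have ext: "carrier (scalar_comod K H \<iota>) = carrier (scalar_module K \<iota>)"
    "\<zero>\<^bsub>scalar_comod K H \<iota>\<^esub> = \<zero>\<^bsub>scalar_module K \<iota>\<^esub>"
    "add (scalar_comod K H \<iota>) = add (scalar_module K \<iota>)"
    "smult (scalar_comod K H \<iota>) = smult (scalar_module K \<iota>)"
    by (simp_all add: scalar_comod_def module.defs)
  show "carrier (scalar_comod K H \<iota>) = \<iota> ` carrier K"
    and "\<zero>\<^bsub>scalar_comod K H \<iota>\<^esub> = \<iota> \<zero>\<^bsub>K\<^esub>"
    and "a \<in> carrier K \<Longrightarrow> b \<in> carrier K \<Longrightarrow> \<iota> a \<oplus>\<^bsub>scalar_comod K H \<iota>\<^esub> \<iota> b = \<iota> (a \<oplus>\<^bsub>K\<^esub> b)"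
    and "a \<in> carrier K \<Longrightarrow> c \<odot>\<^bsub>scalar_comod K H \<iota>\<^esub> \<iota> a = \<iota> (c \<otimes>\<^bsub>K\<^esub> a)"
    unfolding ext using assms by (simp_all add: scalar_module_def)
  have "pure K (scalar_comod K H \<iota>) H = pure K (scalar_module K \<iota>) H"
    by (rule tensor_cong(2)[OF ext(1,3,4)])
  then show "coact (scalar_comod K H \<iota>) x = pure K (scalar_comod K H \<iota>) H x \<one>\<^bsub>H\<^esub>"
    by (simp only:) (simp add: scalar_comod_def module.defs)
qed

lemma scalar_comod:
  assumes "bialgebra K H" and "cring K" and "inj_on \<iota> (carrier K)"
  shows "comodule K H (scalar_comod K H \<iota>)"
proof (rule comodule_trivial[OF assms(1)])
  interpret K: cring K by fact
  note simps = scalar_comod_simps[OF assms(3), where H = H]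
  let ?U = "scalar_comod K H \<iota>"
  show "module K ?U"
  proof (rule moduleI)
    show "abelian_group ?U"
    proof (rule abelian_groupI)
      fix x assume "x \<in> carrier ?U"
      then obtain a where a: "a \<in> carrier K" "x = \<iota> a" unfolding simps by blast
      then show "\<exists>y\<in>carrier ?U. y \<oplus>\<^bsub>?U\<^esub> x = \<zero>\<^bsub>?U\<^esub>"
        by (intro bexI[of _ "\<iota> (\<ominus>\<^bsub>K\<^esub> a)"]) (simp_all add: simps K.l_neg)
    qed (auto simp: simps K.a_ac)
  qed (auto simp: simps assms(2) K.l_distr K.r_distr K.m_assoc)
qed (rule scalar_comod_simps(5)[OF assms(3)])

text \<open>The scalar action read along \<iota>. Its lift is the map from N \<otimes> K to N; with
  the vector fixed at r it is the map c \<mapsto> c r.\<close>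

lemma scalar_comod_action:
  assumes "cring K" and "inj_on \<iota> (carrier K)" and "module K V"
  shows "bilinear_map K V (scalar_comod K H \<iota>) V (\<lambda>v x. inv_into (carrier K) \<iota> x \<odot>\<^bsub>V\<^esub> v)"
proof (rule bilinear_mapI)
  interpret V: module K V by fact
  note simps = scalar_comod_simps[OF assms(2), where H = H]
  show "linear_map K (scalar_comod K H \<iota>) V (\<lambda>x. inv_into (carrier K) \<iota> x \<odot>\<^bsub>V\<^esub> v)"
    if "v \<in> carrier V" for v
    using that assms(2) by (intro linear_mapI) (auto simp: simps V.smult_l_distr V.smult_assoc1)
  show "linear_map K V V (\<lambda>v. inv_into (carrier K) \<iota> x \<odot>\<^bsub>V\<^esub> v)"
    if "x \<in> carrier (scalar_comod K H \<iota>)" for x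
    using that assms(2) by (intro linear_map_smult[OF assms(3,3) linear_map_id]) (auto simp: simps)
qed

text \<open>Linearity of the coaction gives \<rho> (c r) = c (r \<otimes> 1) = (c r) \<otimes> 1,
  which matches the trivial coaction of K.\<close>

lemma scalar_comod_hom:
  assumes "bialgebra K H" and "cring K" and "inj_on \<iota> (carrier K)" and "comodule K H M"
    and "r \<in> carrier (coinvariants K H M)"
  shows "(\<lambda>x\<in>carrier (scalar_comod K H \<iota>). inv_into (carrier K) \<iota> x \<odot>\<^bsub>M\<^esub> r) \<in>
    comod_hom K H (scalar_comod K H \<iota>) M" (is "?u \<in> _")
proof -
  let ?U = "scalar_comod K H \<iota>" and ?s = "inv_into (carrier K) \<iota>"
  have alg: "assoc_algebra K H" using assms(1) by (simp add: bialgebra_def)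
  note H = assoc_algebraD[OF alg]
  interpret H: ring H by (rule H(2))
  note M = comoduleD[OF assms(4)] and U = comoduleD[OF scalar_comod[OF assms(1,2,3)]]
  have r: "r \<in> carrier M" "coact M r = pure K M H r \<one>\<^bsub>H\<^esub>"
    using assms(5) unfolding coinvariants_carrier by blast+
  have lin: "linear_map K ?U M ?u"
    using bilinear_mapD(1)[OF scalar_comod_action[OF assms(2,3) M(1)] r(1)]
    by (simp add: linear_map_cong[OF U(1), of ?u "\<lambda>x. ?s x \<odot>\<^bsub>M\<^esub> r"])
  have "colinear K H ?U M ?u"
    unfolding colinear_def
  proof
    fix x assume x: "x \<in> carrier ?U"
    then have sx: "?s x \<in> carrier K"
      unfolding scalar_comod_simps(1)[OF assms(3)] by (rule inv_into_into)
    have "coact M (?u x) = coact M (?s x \<odot>\<^bsub>M\<^esub> r)" using x by simp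
    also have "\<dots> = pure K M H (?s x \<odot>\<^bsub>M\<^esub> r) \<one>\<^bsub>H\<^esub>"
      by (simp add: linear_mapD(3)[OF M(2) sx r(1)] r(2)
          linear_mapD(3)[OF bilinear_mapD(2)[OF pure_bilinear[OF M(1) H(1)] H.one_closed] sx r(1)])
    also have "\<dots> = pure K M H (?u x) \<one>\<^bsub>H\<^esub>" using x by simp
    also have "\<dots> = tensor_map K ?U H M H ?u (\<lambda>h. h) (pure K ?U H x \<one>\<^bsub>H\<^esub>)"
      by (rule tensor_map(2)[OF U(1) H(1) M(1) H(1) lin linear_map_id x H.one_closed, symmetric])
    finally show "coact M (?u x) = tensor_map K ?U H M H ?u (\<lambda>h. h) (coact ?U x)"
      unfolding scalar_comod_simps(5)[OF assms(3)] .
  qed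
  then show ?thesis
    unfolding comod_hom_def lin_hom_def using lin by simp
qed

text \<open>The canonical map from N \<otimes> K to N, through which a morphism from N to P becomes
  one that can be transposed. As K coacts trivially, colinearity amounts to \<rho> (c n) = c \<rho>
  n.\<close>

lemma rhm_tensor_scalar_hom:
  assumes "bialgebra K H" and "cring K" and "inj_on \<iota> (carrier K)" and "rel_hopf_module K H D N"
  defines "U \<equiv> scalar_comod K H \<iota>" and "s \<equiv> inv_into (carrier K) \<iota>"
  shows "(\<lambda>X\<in>cocat_obj D. tensor_lift K (rhm_obj N X) U (rhm_obj N X) (\<lambda>n x. s x \<odot>\<^bsub>rhm_obj N X\<^esub> n)) \<in>
      rhm_hom K H D (rhm_tensor K H N U) N" (is "?\<theta> \<in> _")
    and "X \<in> cocat_obj D \<Longrightarrow> n \<in> carrier (rhm_obj N X) \<Longrightarrow> x \<in> carrier U \<Longrightarrow>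
      tensor_lift K (rhm_obj N X) U (rhm_obj N X) (\<lambda>n x. s x \<odot>\<^bsub>rhm_obj N X\<^esub> n)
        (pure K (rhm_obj N X) U n x) = s x \<odot>\<^bsub>rhm_obj N X\<^esub> n"
proof -
  have alg: "assoc_algebra K H" using assms(1) by (simp add: bialgebra_def)
  note H = assoc_algebraD[OF alg]
  interpret H: ring H by (rule H(2))
  have comU: "comodule K H U" unfolding U_def by (rule scalar_comod[OF assms(1,2,3)])
  note U = comoduleD[OF comU]
  have Ux: "coact U x = pure K U H x \<one>\<^bsub>H\<^esub>" for x
    unfolding U_def by (rule scalar_comod_simps(5)[OF assms(3)])
  note N = rel_hopf_moduleD(2)[OF assms(4)]
  note act = rhm_dataD(3)[OF rel_hopf_moduleD(1)[OF assms(4)]]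
  have s: "s x \<in> carrier K" if "x \<in> carrier U" for x
    using that unfolding U_def s_def scalar_comod_simps(1)[OF assms(3)] by (rule inv_into_into)
  note bil = scalar_comod_action[OF assms(2,3), where H = H, folded U_def s_def]
  note lift = tensor_lift[OF comoduleD(1)[OF N] U(1) comoduleD(1)[OF N] bil[OF comoduleD(1)[OF N]]]
  show "tensor_lift K (rhm_obj N X) U (rhm_obj N X) (\<lambda>n x. s x \<odot>\<^bsub>rhm_obj N X\<^esub> n)
        (pure K (rhm_obj N X) U n x) = s x \<odot>\<^bsub>rhm_obj N X\<^esub> n"
    if X: "X \<in> cocat_obj D" and "n \<in> carrier (rhm_obj N X)" "x \<in> carrier U" for X n x
    using lift(2)[OF X X X that(2,3)] .
  then have app: "?\<theta> X (pure K (rhm_obj N X) U n x) = s x \<odot>\<^bsub>rhm_obj N X\<^esub> n"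
    if "X \<in> cocat_obj D" "n \<in> carrier (rhm_obj N X)" "x \<in> carrier U" for X n x
    using that by simp
  show "?\<theta> \<in> rhm_hom K H D (rhm_tensor K H N U) N"
  proof (rule rhm_hom_tensorI[OF alg assms(4) comU rel_hopf_moduleD(1)[OF assms(4)]])
    show "?\<theta> \<in> extensional (cocat_obj D)" by simp
    fix X assume X: "X \<in> cocat_obj D"
    note NX = comoduleD[OF N[OF X]]
    have \<theta>: "?\<theta> X = tensor_lift K (rhm_obj N X) U (rhm_obj N X) (\<lambda>n x. s x \<odot>\<^bsub>rhm_obj N X\<^esub> n)"
      using X by simp
    show "?\<theta> X \<in> extensional (carrier (tensor K (rhm_obj N X) U))"
      unfolding \<theta> by (rule tensor_lift_extensional)
    show lin: "linear_map K (tensor K (rhm_obj N X) U) (rhm_obj N X) (?\<theta> X)"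
      unfolding \<theta> by (rule lift(1)[OF X X X])
    fix n x assume n: "n \<in> carrier (rhm_obj N X)" and x: "x \<in> carrier U"
    show "?\<theta> Y (pure K (rhm_obj N Y) U (rhm_act N X Y f n) x) =
        rhm_act N X Y f (?\<theta> X (pure K (rhm_obj N X) U n x))"
      if Y: "Y \<in> cocat_obj D" and f: "f \<in> carrier (cocat_hom D X Y)" for Y f
      unfolding app[OF X n x] app[OF Y linear_mapD(1)[OF act[OF X Y f] n] x]
        linear_mapD(3)[OF act[OF X Y f] s[OF x] n] by (rule refl)
    let ?T = "tensor_comod K H (rhm_obj N X) U"
    have xco: "x \<in> carrier (coinvariants K H U)"
      unfolding coinvariants_carrier using x Ux by simp
    \<comment> \<open>As x is coinvariant, the coaction of n \<otimes> x affects only n; applying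
      \<theta> afterwards scales the first factor of \<rho> n by \<open>s x\<close>.\<close>
    have "tensor_map K ?T H (rhm_obj N X) H (?\<theta> X) (\<lambda>h. h) (coact ?T (pure K (rhm_obj N X) U n x)) =
      tensor_map K ?T H (rhm_obj N X) H (?\<theta> X) (\<lambda>h. h)
        (tensor_map K (rhm_obj N X) H ?T H (\<lambda>n. pure K (rhm_obj N X) U n x) (\<lambda>h. h) (coact (rhm_obj N X) n))"
      unfolding coact_tensor_coinvariant[OF alg N[OF X] comU n x Ux] by (rule refl)
    also have "\<dots> = tensor_map K (rhm_obj N X) H (rhm_obj N X) H (\<lambda>n. s x \<odot>\<^bsub>rhm_obj N X\<^esub> n) (\<lambda>h. h)
        (coact (rhm_obj N X) n)"
      by (rule tensor_map_comp[OF NX(1) tensor_comod_module[OF NX(1) U(1)] NX(1) H(1)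
            bilinear_mapD(2)[OF bilinear_pure_tensor_comod[OF NX(1) U(1)] x]
            lin[folded linear_map_tensor_comod(1)[where H = H]] linear_mapD(1)[OF NX(2) n]])
         (rule app[OF X _ x, symmetric])
    also have "\<dots> = s x \<odot>\<^bsub>tensor K (rhm_obj N X) H\<^esub> coact (rhm_obj N X) n"
      by (rule tensor_map_smult[OF NX(1) H(1) s[OF x] linear_mapD(1)[OF NX(2) n]])
    also have "\<dots> = coact (rhm_obj N X) (s x \<odot>\<^bsub>rhm_obj N X\<^esub> n)"
      by (rule linear_mapD(3)[OF NX(2) s[OF x] n, symmetric])
    finally show "coact (rhm_obj N X) (?\<theta> X (pure K (rhm_obj N X) U n x)) =
        tensor_map K ?T H (rhm_obj N X) H (?\<theta> X) (\<lambda>h. h) (coact ?T (pure K (rhm_obj N X) U n x))"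
      unfolding app[OF X n x] by (rule sym)
  qed
qed


section \<open>Coinvariants of the right adjoint\<close>

lemma right_adjointD:
  assumes "right_adjoint K H D N R" and "rel_hopf_module K H D P"
  shows "comodule K H (radj_obj R P)"
    and "rel_hopf_module K H D P' \<Longrightarrow> g \<in> rhm_hom K H D P P' \<Longrightarrow>
      radj_map R P P' g \<in> comod_hom K H (radj_obj R P) (radj_obj R P')"
    and "comodule K H M \<Longrightarrow> bij_betw (radj_transpose R M P)
      (rhm_hom K H D (rhm_tensor K H N M) P) (comod_hom K H M (radj_obj R P))"
    and "comodule K H M \<Longrightarrow> comodule K H M' \<Longrightarrow> u \<in> comod_hom K H M' M \<Longrightarrow>
      \<theta> \<in> rhm_hom K H D (rhm_tensor K H N M) P \<Longrightarrow>
      radj_transpose R M' P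
        (rhm_comp D (rhm_tensor K H N M') \<theta> (rhm_tensor_map K D N M' N M (rhm_id D N) u)) =
      compose (carrier M') (radj_transpose R M P \<theta>) u"
    and "comodule K H M \<Longrightarrow> rel_hopf_module K H D P' \<Longrightarrow> g \<in> rhm_hom K H D P P' \<Longrightarrow>
      \<theta> \<in> rhm_hom K H D (rhm_tensor K H N M) P \<Longrightarrow>
      radj_transpose R M P' (rhm_comp D (rhm_tensor K H N M) g \<theta>) =
      compose (carrier M) (radj_map R P P' g) (radj_transpose R M P \<theta>)"
  using assms by (simp_all add: right_adjoint_def radj_functor_def)

text \<open>The identity of \<open>R P\<close> is colinear, hence in the range of the transpose
  bijection, and the \<open>inv_into\<close> that defines the counit is a true preimage.\<close>

lemma radj_eval:
  assumes "assoc_algebra K H" and "right_adjoint K H D N R" and "rel_hopf_module K H D P"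
  shows "radj_eval K H D N R P \<in> rhm_hom K H D (rhm_tensor K H N (radj_obj R P)) P"
    and "radj_transpose R (radj_obj R P) P (radj_eval K H D N R P) = (\<lambda>r\<in>carrier (radj_obj R P). r)"
proof -
  note RP = right_adjointD(1)[OF assms(2,3)]
  have "(\<lambda>r\<in>carrier (radj_obj R P). r) \<in> radj_transpose R (radj_obj R P) P `
      rhm_hom K H D (rhm_tensor K H N (radj_obj R P)) P"
    using comod_hom_id[OF assms(1) RP] bij_betw_imp_surj_on[OF right_adjointD(3)[OF assms(2,3) RP]]
    by simp
  then show "radj_eval K H D N R P \<in> rhm_hom K H D (rhm_tensor K H N (radj_obj R P)) P"
    and "radj_transpose R (radj_obj R P) P (radj_eval K H D N R P) = (\<lambda>r\<in>carrier (radj_obj R P). r)"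
    unfolding radj_eval_def by (rule inv_into_into, rule f_inv_into_f)
qed

text \<open>The Yoneda argument: naturality in the comodule, applied to the counit and u, shows that
  ev after N \<otimes> u has transpose u. As the transpose is injective, \<theta> has transpose u
  iff it is that composite, and pure tensors decide this.\<close>

lemma radj_transpose_eq_iff:
  assumes "assoc_algebra K H" and "rel_hopf_module K H D N" and "right_adjoint K H D N R"
    and "rel_hopf_module K H D P" and "comodule K H M"
    and "\<theta> \<in> rhm_hom K H D (rhm_tensor K H N M) P" and "u \<in> comod_hom K H M (radj_obj R P)"
  shows "radj_transpose R M P \<theta> = u \<longleftrightarrow>
    (\<forall>X\<in>cocat_obj D. \<forall>n\<in>carrier (rhm_obj N X). \<forall>m\<in>carrier M.
      \<theta> X (pure K (rhm_obj N X) M n m) =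
        radj_eval K H D N R P X (pure K (rhm_obj N X) (radj_obj R P) n (u m)))"
proof -
  let ?E = "radj_eval K H D N R P" and ?RP = "radj_obj R P"
  note RP = right_adjointD(1)[OF assms(3,4)]
  note E = radj_eval[OF assms(1,3,4)]
  have u: "linear_map K M ?RP u" "colinear K H M ?RP u" "u \<in> extensional (carrier M)"
    using assms(7) unfolding comod_hom_def lin_hom_def by simp_all
  note tm = rhm_tensor_map_hom[OF assms(1,2,2,5) RP rhm_id_hom[OF assms(1) rel_hopf_moduleD(1)[OF assms(2)]] u(1,2)]
  define \<theta>' where "\<theta>' = rhm_comp D (rhm_tensor K H N M) ?E (rhm_tensor_map K D N M N ?RP (rhm_id D N) u)"
  have \<theta>': "\<theta>' \<in> rhm_hom K H D (rhm_tensor K H N M) P"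
    unfolding \<theta>'_def
    by (rule rhm_comp_hom[OF assms(1) rhm_data_tensor[OF assms(1,2,5)] rhm_data_tensor[OF assms(1,2) RP]
          rel_hopf_moduleD(1)[OF assms(4)] tm(1) E(1)])
  have app: "\<theta>' X (pure K (rhm_obj N X) M n m) = ?E X (pure K (rhm_obj N X) ?RP n (u m))"
    if X: "X \<in> cocat_obj D" and n: "n \<in> carrier (rhm_obj N X)" and m: "m \<in> carrier M" for X n m
  proof -
    note NX = comoduleD(1)[OF rel_hopf_moduleD(2)[OF assms(2) X]]
    have "pure K (rhm_obj N X) M n m \<in> carrier (rhm_obj (rhm_tensor K H N M) X)"
      unfolding rhm_tensor_simps tensor_comod_simps
      by (rule pure_closed[OF NX comoduleD(1)[OF assms(5)] n m])
    moreover have "rhm_id D N X n = n" using X n by (simp add: rhm_id_def)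
    ultimately show ?thesis
      by (simp add: \<theta>'_def rhm_comp_apply[OF X] tm(2)[OF X n m])
  qed
  \<comment> \<open>The restricted identity is rewritten as the transpose of the counit, so that
    naturality in the comodule applies.\<close>
  have "radj_transpose R M P \<theta>' = compose (carrier M) (\<lambda>r\<in>carrier ?RP. r) u"
    unfolding \<theta>'_def E(2)[symmetric] by (rule right_adjointD(4)[OF assms(3,4) RP assms(5,7) E(1)])
  also have "\<dots> = u"
    by (rule extensionalityI[OF compose_extensional u(3)]) (simp add: compose_def linear_mapD(1)[OF u(1)])
  finally have T: "radj_transpose R M P \<theta>' = u" .
  have "radj_transpose R M P \<theta> = u \<longleftrightarrow> \<theta> = \<theta>'"
    unfolding T[symmetric]
    by (rule inj_on_eq_iff[OF bij_betw_imp_inj_on[OF right_adjointD(3)[OF assms(3,4,5)]] assms(6) \<theta>'])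
  also have "\<dots> \<longleftrightarrow> (\<forall>X\<in>cocat_obj D. \<forall>n\<in>carrier (rhm_obj N X). \<forall>m\<in>carrier M.
      \<theta> X (pure K (rhm_obj N X) M n m) = \<theta>' X (pure K (rhm_obj N X) M n m))"
    using rhm_hom_tensor_eqI[OF assms(2,5,6) \<theta>'] by blast
  finally show ?thesis by (simp add: app)
qed

section \<open>The canonical map from coinvariants to morphisms\<close>

lemma coinv_to_hom_apply:
  assumes "r \<in> carrier (coinvariants K H (radj_obj R P))" and "X \<in> cocat_obj D"
    and "n \<in> carrier (rhm_obj N X)"
  shows "coinv_to_hom K H D N R P r X n = radj_eval K H D N R P X (pure K (rhm_obj N X) (radj_obj R P) n r)"
  using assms by (simp add: coinv_to_hom_def)

text \<open>The image of r is the counit after n \<mapsto> n \<otimes> r, a composite of two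
  morphisms.\<close>

lemma coinv_to_hom_closed:
  assumes "assoc_algebra K H" and "rel_hopf_module K H D N" and "right_adjoint K H D N R"
    and "rel_hopf_module K H D P" and "r \<in> carrier (coinvariants K H (radj_obj R P))"
  shows "coinv_to_hom K H D N R P r \<in> rhm_hom K H D N P"
proof -
  note RP = right_adjointD(1)[OF assms(3,4)]
  let ?c = "\<lambda>X\<in>cocat_obj D. \<lambda>n\<in>carrier (rhm_obj N X). pure K (rhm_obj N X) (radj_obj R P) n r"
  have "coinv_to_hom K H D N R P r = rhm_comp D N (radj_eval K H D N R P) ?c"
    using assms(5) by (simp add: coinv_to_hom_def rhm_comp_def compose_def cong: restrict_cong)
  also have "\<dots> \<in> rhm_hom K H D N P"
    by (rule rhm_comp_hom[OF assms(1) rel_hopf_moduleD(1)[OF assms(2)] rhm_data_tensor[OF assms(1,2) RP]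
          rel_hopf_moduleD(1)[OF assms(4)] rhm_tensor_coinvariant_hom[OF assms(1,2) RP assms(5)]
          radj_eval(1)[OF assms(1,3,4)]])
  finally show ?thesis .
qed

text \<open>The element r enters through r \<mapsto> ev (n \<otimes> r), which is linear. Since
  \<open>coinv_to_hom\<close> is restricted to coinvariants, sums and multiples must be seen to be
  coinvariant again; they are, because both \<rho> and r \<mapsto> r \<otimes> 1 are linear.\<close>

lemma coinv_to_hom_linear:
  assumes "assoc_algebra K H" and "rel_hopf_module K H D N" and "right_adjoint K H D N R"
    and "rel_hopf_module K H D P"
  shows "linear_map K (coinvariants K H (radj_obj R P)) (rhm_hom_space K H D N P)
    (coinv_to_hom K H D N R P)"
proof -
  let ?RP = "radj_obj R P"
  let ?C = "coinvariants K H ?RP" and ?S = "rhm_hom_space K H D N P" and ?F = "coinv_to_hom K H D N R P"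
  note H = assoc_algebraD[OF assms(1)]
  interpret H: ring H by (rule H(2))
  note RP = comoduleD[OF right_adjointD(1)[OF assms(3,4)]]
  interpret RP: module K ?RP by (rule RP(1))
  note N = rel_hopf_moduleD(2)[OF assms(2)]
  have C: "carrier ?S = rhm_hom K H D N P" "add ?C = add ?RP" "smult ?C = smult ?RP"
    by (simp_all add: rhm_hom_space_def coinvariants_def)
  have Cr: "r \<in> carrier ?RP" "coact ?RP r = pure K ?RP H r \<one>\<^bsub>H\<^esub>" if "r \<in> carrier ?C" for r
    using that unfolding coinvariants_carrier by blast+
  note p1 = linear_mapD[OF bilinear_mapD(2)[OF pure_bilinear[OF RP(1) H(1)] H.one_closed]]
  have add: "r \<oplus>\<^bsub>?RP\<^esub> r' \<in> carrier ?C" if "r \<in> carrier ?C" "r' \<in> carrier ?C" for r r'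
    unfolding coinvariants_carrier using Cr[OF that(1)] Cr[OF that(2)]
    by (simp add: linear_mapD(2)[OF RP(2)] p1)
  have smult: "c \<odot>\<^bsub>?RP\<^esub> r \<in> carrier ?C" if "c \<in> carrier K" "r \<in> carrier ?C" for c r
    unfolding coinvariants_carrier using that(1) Cr[OF that(2)]
    by (simp add: linear_mapD(3)[OF RP(2)] p1)
  have lin: "linear_map K ?RP (rhm_obj P X)
      (\<lambda>r. radj_eval K H D N R P X (pure K (rhm_obj N X) ?RP n r))"
    if X: "X \<in> cocat_obj D" and n: "n \<in> carrier (rhm_obj N X)" for X n
    by (rule linear_map_comp[OF bilinear_mapD(1)[OF pure_bilinear[OF comoduleD(1)[OF N[OF X]] RP(1)] n]
          rhm_homD(3)[OF radj_eval(1)[OF assms(1,3,4)] X, unfolded rhm_tensor_simps linear_map_tensor_comod]])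
  have ext: "?F r \<in> extensional (cocat_obj D)"
    "X \<in> cocat_obj D \<Longrightarrow> ?F r X \<in> extensional (carrier (rhm_obj N X))" if "r \<in> carrier ?C" for r X
    using that by (simp_all add: coinv_to_hom_def)
  show ?thesis
  proof (rule linear_mapI; (unfold C)?)
    show "?F r \<in> rhm_hom K H D N P" if "r \<in> carrier ?C" for r
      by (rule coinv_to_hom_closed[OF assms that])
    fix r assume r: "r \<in> carrier ?C"
    show "?F (r \<oplus>\<^bsub>?RP\<^esub> r') = ?F r \<oplus>\<^bsub>?S\<^esub> ?F r'" if r': "r' \<in> carrier ?C" for r'
    proof -
      have "?F (r \<oplus>\<^bsub>?RP\<^esub> r') X n = ?F r X n \<oplus>\<^bsub>rhm_obj P X\<^esub> ?F r' X n"
        if "X \<in> cocat_obj D" "n \<in> carrier (rhm_obj N X)" for X n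
        by (simp add: coinv_to_hom_apply add r r' that linear_mapD(2)[OF lin[OF that]] Cr)
      then show ?thesis
        by (simp add: rhm_hom_space_def, intro extensionalityI[OF ext(1)[OF add[OF r r']]])
           (simp_all add: extensionalityI[OF ext(2)[OF add[OF r r']]])
    qed
    show "?F (c \<odot>\<^bsub>?RP\<^esub> r) = c \<odot>\<^bsub>?S\<^esub> ?F r" if c: "c \<in> carrier K" for c
    proof -
      have "?F (c \<odot>\<^bsub>?RP\<^esub> r) X n = c \<odot>\<^bsub>rhm_obj P X\<^esub> ?F r X n"
        if "X \<in> cocat_obj D" "n \<in> carrier (rhm_obj N X)" for X n
        by (simp add: coinv_to_hom_apply smult c r that linear_mapD(3)[OF lin[OF that]] Cr)
      then show ?thesis
        by (simp add: rhm_hom_space_def, intro extensionalityI[OF ext(1)[OF smult[OF c r]]])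
           (simp_all add: extensionalityI[OF ext(2)[OF smult[OF c r]]])
    qed
  qed
qed

text \<open>Here \<open>u r\<close> is the map c \<mapsto> c r on the copy U of K. For injectivity,
  ev (n \<otimes> u r x) is \<open>?s x\<close> times the image of r at n, so equal images of r and
  r' force \<open>u r = u r'\<close>. For surjectivity, a morphism is pulled back to N \<otimes> K
  and transposed.\<close>

lemma coinv_to_hom_bij:
  assumes "bialgebra K H" and "cring K" and "rel_hopf_module K H D N"
    and "right_adjoint K H D N (R :: ('o, 'f, 'k, 'h, 'n, 'p, 'm) radj)"
    and "rel_hopf_module K H D P" and "inj_on (\<iota> :: 'k \<Rightarrow> 'm) (carrier K)"
  shows "bij_betw (coinv_to_hom K H D N R P) (carrier (coinvariants K H (radj_obj R P)))
    (rhm_hom K H D N P)"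
proof -
  let ?RP = "radj_obj R P" and ?s = "inv_into (carrier K) \<iota>" and ?E = "radj_eval K H D N R P"
  let ?C = "coinvariants K H ?RP" and ?F = "coinv_to_hom K H D N R P"
  define U :: "('k, 'h, 'm) comod" where "U = scalar_comod K H \<iota>"
  interpret K: cring K by fact
  have alg: "assoc_algebra K H" using assms(1) by (simp add: bialgebra_def)
  note H = assoc_algebraD[OF alg]
  note RP = right_adjointD(1)[OF assms(4,5)]
  interpret RP: module K ?RP by (rule comoduleD(1)[OF RP])
  have comU: "comodule K H U" unfolding U_def by (rule scalar_comod[OF assms(1,2,6)])
  have one: "\<iota> \<one>\<^bsub>K\<^esub> \<in> carrier U" "?s (\<iota> \<one>\<^bsub>K\<^esub>) = \<one>\<^bsub>K\<^esub>"
    using assms(6) by (simp_all add: U_def scalar_comod_simps(1)[OF assms(6)])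
  have sU: "?s x \<in> carrier K" if "x \<in> carrier U" for x
    using that unfolding U_def scalar_comod_simps(1)[OF assms(6)] by (rule inv_into_into)
  have oneU: "\<iota> \<one>\<^bsub>K\<^esub> \<in> carrier (coinvariants K H U)"
    unfolding coinvariants_carrier using one(1) scalar_comod_simps(5)[OF assms(6)] unfolding U_def by blast
  define u where "u r = (\<lambda>x\<in>carrier U. ?s x \<odot>\<^bsub>?RP\<^esub> r)" for r
  have u: "u r \<in> comod_hom K H U ?RP" if "r \<in> carrier ?C" for r
    unfolding u_def U_def by (rule scalar_comod_hom[OF assms(1,2,6) RP that])
  have Cr: "r \<in> carrier ?RP" if "r \<in> carrier ?C" for r
    using that unfolding coinvariants_carrier by blast
  have u_one: "u r (\<iota> \<one>\<^bsub>K\<^esub>) = r" if "r \<in> carrier ?C" for r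
    using one Cr[OF that] by (simp add: u_def)
  note bij = right_adjointD(3)[OF assms(4,5) comU]
  note iff = radj_transpose_eq_iff[OF alg assms(3,4,5) comU]
  have lin: "linear_map K ?RP (rhm_obj P X) (\<lambda>r. ?E X (pure K (rhm_obj N X) ?RP n r))"
    if X: "X \<in> cocat_obj D" and n: "n \<in> carrier (rhm_obj N X)" for X n
    by (rule linear_map_comp[OF bilinear_mapD(1)[OF pure_bilinear[OF
            comoduleD(1)[OF rel_hopf_moduleD(2)[OF assms(3) X]] comoduleD(1)[OF RP]] n]
          rhm_homD(3)[OF radj_eval(1)[OF alg assms(4,5)] X, unfolded rhm_tensor_simps linear_map_tensor_comod]])
  show ?thesis
  proof (rule bij_betwI')
    show "?F r \<in> rhm_hom K H D N P" if "r \<in> carrier ?C" for r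
      by (rule coinv_to_hom_closed[OF alg assms(3,4,5) that])
    show "?F r = ?F r' \<longleftrightarrow> r = r'" if r: "r \<in> carrier ?C" and r': "r' \<in> carrier ?C" for r r'
    proof
      assume eq: "?F r = ?F r'"
      \<comment> \<open>One \<theta> serves both coinvariants: chosen with transpose
        \<open>u r\<close>, it will be seen to have transpose \<open>u r'\<close> as well.\<close>
      obtain \<theta> where \<theta>: "\<theta> \<in> rhm_hom K H D (rhm_tensor K H N U) P" "radj_transpose R U P \<theta> = u r"
        using bij_betw_imp_surj_on[OF bij] u[OF r] by (metis imageE)
      have vals: "\<theta> X (pure K (rhm_obj N X) U n x) = ?E X (pure K (rhm_obj N X) ?RP n (u r' x))"
        if X: "X \<in> cocat_obj D" and n: "n \<in> carrier (rhm_obj N X)" and x: "x \<in> carrier U" for X n x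
      proof -
        have E: "?E X (pure K (rhm_obj N X) ?RP n (u r x)) = ?s x \<odot>\<^bsub>rhm_obj P X\<^esub> ?F r X n"
          if "r \<in> carrier ?C" for r
          using x by (simp add: u_def coinv_to_hom_apply[OF that X n]
              linear_mapD(3)[OF lin[OF X n] sU[OF x] Cr[OF that]])
        have "\<theta> X (pure K (rhm_obj N X) U n x) = ?E X (pure K (rhm_obj N X) ?RP n (u r x))"
          using \<theta>(2) X n x unfolding iff[OF \<theta>(1) u[OF r]] by blast
        then show ?thesis unfolding E[OF r] E[OF r'] eq .
      qed
      have "radj_transpose R U P \<theta> = u r'"
        unfolding iff[OF \<theta>(1) u[OF r']] by (intro ballI vals)
      then have "u r = u r'" unfolding \<theta>(2) .
      \<comment> \<open>Evaluation at the unit of K recovers a coinvariant from its colinear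
        map.\<close>
      then have "u r (\<iota> \<one>\<^bsub>K\<^esub>) = u r' (\<iota> \<one>\<^bsub>K\<^esub>)" by (rule fun_cong)
      then show "r = r'" unfolding u_one[OF r] u_one[OF r'] .
    qed simp
    fix \<phi> assume \<phi>: "\<phi> \<in> rhm_hom K H D N P"
    note sc = rhm_tensor_scalar_hom[OF assms(1,2,6,3), folded U_def]
    let ?\<sigma> = "\<lambda>X\<in>cocat_obj D. tensor_lift K (rhm_obj N X) U (rhm_obj N X) (\<lambda>n x. ?s x \<odot>\<^bsub>rhm_obj N X\<^esub> n)"
    \<comment> \<open>On n \<otimes> c this is \<phi> (c n). Its transpose w is a colinear map from
      U, and the value of w at the unit is the sought preimage of \<phi>.\<close>
    define \<theta> where "\<theta> = rhm_comp D (rhm_tensor K H N U) \<phi> ?\<sigma>"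
    have \<theta>: "\<theta> \<in> rhm_hom K H D (rhm_tensor K H N U) P"
      unfolding \<theta>_def by (rule rhm_comp_hom[OF alg rhm_data_tensor[OF alg assms(3) comU]
            rel_hopf_moduleD(1)[OF assms(3)] rel_hopf_moduleD(1)[OF assms(5)] sc(1) \<phi>])
    define w where "w = radj_transpose R U P \<theta>"
    have w: "w \<in> comod_hom K H U ?RP"
      unfolding w_def by (rule bij_betwE[OF bij, rule_format, OF \<theta>])
    let ?r = "w (\<iota> \<one>\<^bsub>K\<^esub>)"
    have r: "?r \<in> carrier ?C"
      by (rule coinvariant_image[OF alg comoduleD(1)[OF comU] comoduleD(1)[OF RP] w oneU])
    have "\<phi> = ?F ?r"
    proof (rule rhm_hom_eqI[OF \<phi> coinv_to_hom_closed[OF alg assms(3,4,5) r]])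
      fix X n assume X: "X \<in> cocat_obj D" and n: "n \<in> carrier (rhm_obj N X)"
      note NX = comoduleD(1)[OF rel_hopf_moduleD(2)[OF assms(3) X]]
      interpret NX: module K "rhm_obj N X" by (rule NX)
      have p: "pure K (rhm_obj N X) U n (\<iota> \<one>\<^bsub>K\<^esub>) \<in> carrier (rhm_obj (rhm_tensor K H N U) X)"
        unfolding rhm_tensor_simps tensor_comod_simps
        by (rule pure_closed[OF NX comoduleD(1)[OF comU] n one(1)])
      \<comment> \<open>Writing n as the image of n \<otimes> 1 moves the claim to N \<otimes> K,
        where \<theta> is expressed through the counit.\<close>
      have "\<phi> X n = \<theta> X (pure K (rhm_obj N X) U n (\<iota> \<one>\<^bsub>K\<^esub>))"
        unfolding \<theta>_def rhm_comp_apply[OF X p] using X sc(2)[OF X n one(1)] one(2) n by simp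
      also have "\<dots> = ?E X (pure K (rhm_obj N X) ?RP n ?r)"
        using w_def[symmetric] X n one(1) unfolding iff[OF \<theta> w] by blast
      finally show "\<phi> X n = ?F ?r X n" unfolding coinv_to_hom_apply[OF r X n] .
    qed
    then show "\<exists>r\<in>carrier ?C. \<phi> = ?F r" using r by blast
  qed
qed

text \<open>For \<theta> = g after ev, naturality in P identifies the transpose with
  \<open>radj_map R P P' g\<close>. The criterion at n \<otimes> r then reads g (ev (n \<otimes> r))
  = ev' (n \<otimes> r'), where r' is the image of r and ev' the counit at P'.\<close>

lemma coinv_to_hom_natural:
  assumes "assoc_algebra K H" and "rel_hopf_module K H D N" and "right_adjoint K H D N R"
    and "rel_hopf_module K H D P" and "rel_hopf_module K H D P'" and "g \<in> rhm_hom K H D P P'"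
    and "r \<in> carrier (coinvariants K H (radj_obj R P))"
  shows "radj_map R P P' g r \<in> carrier (coinvariants K H (radj_obj R P'))"
    and "coinv_to_hom K H D N R P' (radj_map R P P' g r) = rhm_comp D N g (coinv_to_hom K H D N R P r)"
proof -
  let ?RP = "radj_obj R P" and ?E = "radj_eval K H D N R P"
  note RP = right_adjointD(1)[OF assms(3,4)] and RP' = right_adjointD(1)[OF assms(3,5)]
  note Rg = right_adjointD(2)[OF assms(3,4,5,6)]
  note E = radj_eval[OF assms(1,3,4)]
  have r: "r \<in> carrier ?RP" using assms(7) unfolding coinvariants_carrier by blast
  show r': "radj_map R P P' g r \<in> carrier (coinvariants K H (radj_obj R P'))"
    by (rule coinvariant_image[OF assms(1) comoduleD(1)[OF RP] comoduleD(1)[OF RP'] Rg assms(7)])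
  define \<theta> where "\<theta> = rhm_comp D (rhm_tensor K H N ?RP) g ?E"
  have \<theta>: "\<theta> \<in> rhm_hom K H D (rhm_tensor K H N ?RP) P'"
    unfolding \<theta>_def by (rule rhm_comp_hom[OF assms(1) rhm_data_tensor[OF assms(1,2) RP]
          rel_hopf_moduleD(1)[OF assms(4)] rel_hopf_moduleD(1)[OF assms(5)] E(1) assms(6)])
  have "radj_transpose R ?RP P' \<theta> = compose (carrier ?RP) (radj_map R P P' g) (\<lambda>r\<in>carrier ?RP. r)"
    unfolding \<theta>_def E(2)[symmetric] by (rule right_adjointD(5)[OF assms(3,4) RP assms(5,6) E(1)])
  also have "\<dots> = radj_map R P P' g"
    using Rg by (intro extensionalityI[OF compose_extensional]) (simp_all add: comod_hom_def lin_hom_def compose_def)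
  finally have T: "radj_transpose R ?RP P' \<theta> = radj_map R P P' g" .
  note homs = coinv_to_hom_closed[OF assms(1,2,3,5) r'] coinv_to_hom_closed[OF assms(1,2,3,4,7)]
  show "coinv_to_hom K H D N R P' (radj_map R P P' g r) = rhm_comp D N g (coinv_to_hom K H D N R P r)"
  proof (rule rhm_hom_eqI[OF homs(1) rhm_comp_hom[OF assms(1) rel_hopf_moduleD(1)[OF assms(2)]
          rel_hopf_moduleD(1)[OF assms(4)] rel_hopf_moduleD(1)[OF assms(5)] homs(2) assms(6)]])
    fix X n assume X: "X \<in> cocat_obj D" and n: "n \<in> carrier (rhm_obj N X)"
    note NX = comoduleD(1)[OF rel_hopf_moduleD(2)[OF assms(2) X]]
    have p: "pure K (rhm_obj N X) ?RP n r \<in> carrier (rhm_obj (rhm_tensor K H N ?RP) X)"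
      unfolding rhm_tensor_simps tensor_comod_simps by (rule pure_closed[OF NX comoduleD(1)[OF RP] n r])
    have "\<theta> X (pure K (rhm_obj N X) ?RP n r) =
        radj_eval K H D N R P' X (pure K (rhm_obj N X) (radj_obj R P') n (radj_map R P P' g r))"
      using T X n r unfolding radj_transpose_eq_iff[OF assms(1,2,3,5) RP \<theta> Rg] by blast
    then show "coinv_to_hom K H D N R P' (radj_map R P P' g r) X n =
        rhm_comp D N g (coinv_to_hom K H D N R P r) X n"
      unfolding \<theta>_def rhm_comp_apply[OF X p] rhm_comp_apply[OF X n] coinv_to_hom_apply[OF r' X n]
        coinv_to_hom_apply[OF assms(7) X n] by (rule sym)
  qed
qed

text \<open>By definition \<open>radj_precomp\<close> is the transpose, for the adjunction of N', of
  ev after u \<otimes> id. The criterion for N' at n \<otimes> r gives ev (u n \<otimes> r) = ev' (n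
  \<otimes> r'), where r' is the image of r and ev' the counit for N'.\<close>

lemma coinv_to_hom_natural_source:
  assumes "assoc_algebra K H" and "rel_hopf_module K H D N" and "right_adjoint K H D N R"
    and "rel_hopf_module K H D N'" and "right_adjoint K H D N' R'"
    and "rel_hopf_module K H D P" and "u \<in> rhm_hom K H D N' N"
    and "r \<in> carrier (coinvariants K H (radj_obj R P))"
  shows "radj_precomp K H D N R N' R' P u r \<in> carrier (coinvariants K H (radj_obj R' P))"
    and "coinv_to_hom K H D N' R' P (radj_precomp K H D N R N' R' P u r) =
      rhm_comp D N' (coinv_to_hom K H D N R P r) u"
proof -
  let ?RP = "radj_obj R P" and ?E = "radj_eval K H D N R P"
  note H = assoc_algebraD[OF assms(1)]
  note RP = right_adjointD(1)[OF assms(3,6)] and RP' = right_adjointD(1)[OF assms(5,6)]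
  note E = radj_eval[OF assms(1,3,6)]
  have r: "r \<in> carrier ?RP" using assms(8) unfolding coinvariants_carrier by blast
  \<comment> \<open>\<open>radj_precomp\<close> is built with the unrestricted identity, so
    colinearity is established for that function rather than taken from
    \<open>comod_hom_id\<close>.\<close>
  have "colinear K H ?RP ?RP (\<lambda>r. r)"
    using linear_mapD(1)[OF comoduleD(2)[OF RP]]
    by (simp add: colinear_def tensor_map_id[OF comoduleD(1)[OF RP] H(1)])
  note tm = rhm_tensor_map_hom[OF assms(1,4,2) RP RP assms(7) linear_map_id this]
  define \<theta> where "\<theta> = rhm_comp D (rhm_tensor K H N' ?RP) ?E (rhm_tensor_map K D N' ?RP N ?RP u (\<lambda>r. r))"
  have \<theta>: "\<theta> \<in> rhm_hom K H D (rhm_tensor K H N' ?RP) P"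
    unfolding \<theta>_def by (rule rhm_comp_hom[OF assms(1) rhm_data_tensor[OF assms(1,4) RP]
          rhm_data_tensor[OF assms(1,2) RP] rel_hopf_moduleD(1)[OF assms(6)] tm(1) E(1)])
  define w where "w = radj_precomp K H D N R N' R' P u"
  have w_eq: "radj_transpose R' ?RP P \<theta> = w" by (simp add: w_def \<theta>_def radj_precomp_def)
  have w: "w \<in> comod_hom K H ?RP (radj_obj R' P)"
    unfolding w_eq[symmetric] by (rule bij_betwE[OF right_adjointD(3)[OF assms(5,6) RP], rule_format, OF \<theta>])
  have r': "w r \<in> carrier (coinvariants K H (radj_obj R' P))"
    by (rule coinvariant_image[OF assms(1) comoduleD(1)[OF RP] comoduleD(1)[OF RP'] w assms(8)])
  then show "radj_precomp K H D N R N' R' P u r \<in> carrier (coinvariants K H (radj_obj R' P))"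
    unfolding w_def .
  note homs = coinv_to_hom_closed[OF assms(1,4,5,6) r'] coinv_to_hom_closed[OF assms(1,2,3,6,8)]
  have "coinv_to_hom K H D N' R' P (w r) = rhm_comp D N' (coinv_to_hom K H D N R P r) u"
  proof (rule rhm_hom_eqI[OF homs(1) rhm_comp_hom[OF assms(1) rel_hopf_moduleD(1)[OF assms(4)]
          rel_hopf_moduleD(1)[OF assms(2)] rel_hopf_moduleD(1)[OF assms(6)] assms(7) homs(2)]])
    fix X n assume X: "X \<in> cocat_obj D" and n: "n \<in> carrier (rhm_obj N' X)"
    note NX = comoduleD(1)[OF rel_hopf_moduleD(2)[OF assms(4) X]]
    have un: "u X n \<in> carrier (rhm_obj N X)" by (rule linear_mapD(1)[OF rhm_homD(3)[OF assms(7) X] n])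
    have p: "pure K (rhm_obj N' X) ?RP n r \<in> carrier (rhm_obj (rhm_tensor K H N' ?RP) X)"
      unfolding rhm_tensor_simps tensor_comod_simps by (rule pure_closed[OF NX comoduleD(1)[OF RP] n r])
    have "\<theta> X (pure K (rhm_obj N' X) ?RP n r) =
        radj_eval K H D N' R' P X (pure K (rhm_obj N' X) (radj_obj R' P) n (w r))"
      using w_eq X n r unfolding radj_transpose_eq_iff[OF assms(1,4,5,6) RP \<theta> w] by blast
    then show "coinv_to_hom K H D N' R' P (w r) X n =
        rhm_comp D N' (coinv_to_hom K H D N R P r) u X n"
      unfolding \<theta>_def rhm_comp_apply[OF X p] rhm_comp_apply[OF X n] tm(2)[OF X n r]
        coinv_to_hom_apply[OF r' X n] coinv_to_hom_apply[OF assms(8) X un] by (rule sym)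
  qed
  then show "coinv_to_hom K H D N' R' P (radj_precomp K H D N R N' R' P u r) =
      rhm_comp D N' (coinv_to_hom K H D N R P r) u"
    unfolding w_def .
qed

text \<open>Since \<open>R\<close> may be any right adjoint, the equality can only mean that the
  canonical map is an isomorphism; naturality in both arguments expresses its canonicity. The
  embedding of K into the carrier type makes the trivial comodule available to the
  adjunction.\<close>

theorem corollary5p7:
  fixes K :: "'k ring" and H :: "('k, 'h) hopf" and D :: "('o, 'f, 'k, 'h) cocat"
    and N :: "('o, 'f, 'k, 'h, 'n) rhm" and P :: "('o, 'f, 'k, 'h, 'p) rhm"
    and R :: "('o, 'f, 'k, 'h, 'n, 'p, 'm) radj"
  assumes "field K" and "hopf_algebra K H"
    and "bij_betw (antipode H) (carrier H) (carrier H)"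
    and "co_H_category K H D"
    and "rel_hopf_module K H D N" and "rel_hopf_module K H D P"
    and "\<exists>\<iota> :: 'k \<Rightarrow> 'm. inj_on \<iota> (carrier K)"
    and "right_adjoint K H D N R"
  shows "coinv_to_hom K H D N R P \<in>
           lin_iso K (coinvariants K H (radj_obj R P)) (rhm_hom_space K H D N P) \<and>
         (\<forall>P' g r. rel_hopf_module K H D P' \<and> g \<in> rhm_hom K H D P P' \<and>
           r \<in> carrier (coinvariants K H (radj_obj R P)) \<longrightarrow>
           radj_map R P P' g r \<in> carrier (coinvariants K H (radj_obj R P')) \<and>
           coinv_to_hom K H D N R P' (radj_map R P P' g r) =
             rhm_comp D N g (coinv_to_hom K H D N R P r)) \<and>
         (\<forall>N' (R' :: ('o, 'f, 'k, 'h, 'n, 'p, 'm) radj) u r.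
           rel_hopf_module K H D N' \<and> right_adjoint K H D N' R' \<and> u \<in> rhm_hom K H D N' N \<and>
           r \<in> carrier (coinvariants K H (radj_obj R P)) \<longrightarrow>
           radj_precomp K H D N R N' R' P u r \<in> carrier (coinvariants K H (radj_obj R' P)) \<and>
           coinv_to_hom K H D N' R' P (radj_precomp K H D N R N' R' P u r) =
             rhm_comp D N' (coinv_to_hom K H D N R P r) u)"
proof -
  interpret K: field K by fact
  note H = hopf_algebraD[OF assms(2)]
  obtain \<iota> :: "'k \<Rightarrow> 'm" where \<iota>: "inj_on \<iota> (carrier K)" using assms(7) by blast
  have "coinv_to_hom K H D N R P \<in> extensional (carrier (coinvariants K H (radj_obj R P)))"
    by (simp add: coinv_to_hom_def)
  moreover have "carrier (rhm_hom_space K H D N P) = rhm_hom K H D N P"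
    by (simp add: rhm_hom_space_def)
  ultimately have "coinv_to_hom K H D N R P \<in>
      lin_iso K (coinvariants K H (radj_obj R P)) (rhm_hom_space K H D N P)"
    using coinv_to_hom_linear[OF H(1) assms(5,8,6)]
      coinv_to_hom_bij[OF H(2) K.is_cring assms(5,8,6) \<iota>]
    by (simp add: lin_iso_def lin_hom_def)
  then show ?thesis
    using coinv_to_hom_natural[OF H(1) assms(5,8,6)]
      coinv_to_hom_natural_source[OF H(1) assms(5,8) _ _ assms(6)]
    by blast
qed

end
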